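(* Let $T>0$ and let $\mathcal D\subset\mathbb R^d$, $d\in\{1,2\}$, be a bounded domain with smooth boundary. Suppose that the nonlinearity $f$ and the noise satisfy (A1) and (A2) of the context, and let the time stepsize $\tau=T/M$ satisfy $\tau\le\frac{1}{6\max\{0,C_1\}}$ (no restriction if $C_1\le0$). Let $e_{N,m}=X^N(t_m)-X_{N,m}$ be the temporal error and $R_{m+1}$ the local remainders defined in the context. Then, for any $m\in\{0,1,\dots,M-1\}$, $M\in\mathbb N$, there exists a constant $\widehat C>0$, independent of $m$ and $N$, such that $$\mathbb E\Big[\big\|e_{N,m+1}\big\|_{\mathbb H^1}^2\Big]\le\widehat C\left(\sum_{i=1}^{m+1}\mathbb E\Big[\big\|R_i\big\|_{\mathbb H^1}^2\Big]+\tau^{-1}\sum_{i=0}^{m}\mathbb E\Big[\big\|\mathbb E[R_{i+1}\,|\,\mathcal F_{t_i}]\big\|_{\mathbb H^1}^2\Big]\right).$$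
   Context: Spaces. $U=L^2(\mathcal D;\mathbb R)$ with norm $\|\cdot\|$ and inner product $\langle\cdot,\cdot\rangle$; $\Lambda=-\Delta$ with $\mathrm{Dom}(\Lambda)=H^2(\mathcal D)\cap H^1_0(\mathcal D)$ (homogeneous Dirichlet conditions); $(\lambda_j,\varphi_j)_{j\ge1}$ are its eigenpairs, with $\lambda_1\le\lambda_2\le\cdots$ and $(\varphi_j)$ an orthonormal basis of $U$. $\dot H^1=\mathrm{Dom}(\Lambda^{1/2})$ with $\|u\|_1=\|\Lambda^{1/2}u\|$, and $\mathbb H^1=\dot H^1\times U$ with $\|[x_1,x_2]^T\|_{\mathbb H^1}^2=\|x_1\|_1^2+\|x_2\|^2$. (A1) $F(v)(x)=f(v(x))$, where $f:\mathbb R\to\mathbb R$ is twice continuously differentiable and there are constants $C_0,C_2,C_3>0$, $C_1\in\mathbb R$, $\gamma\ge2$ such that for all $y\in\mathbb R$: $yf(y)\le C_0(1+|y|^2)$, $f'(y)\le C_1$, $|f'(y)|\le C_2(1+|y|^{\gamma-1})$, $|f''(y)|\le C_3(1+|y|^{\gamma-2})$. (A2) $W^Q$ is a $Q$-Wiener process on a filtered probability space $(\Omega,\mathcal F,\mathbb P,\{\mathcal F_t\}_{t\ge0})$, with $Q\in\mathcal L(U)$ self-adjoint, positive semidefinite and $\Lambda^{1/2}Q^{1/2}$ Hilbert–Schmidt on $U$. Spectral Galerkin semi-discretization of the stochastic wave equation $\mathrm du=v\,\mathrm dt$, $\mathrm dv=(\Delta u+F(v))\,\mathrm dt+\mathrm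 dW^Q$ with $\mathcal F_0$-measurable initial value $X_0=[u_0,v_0]^T$: $U_N=\mathrm{span}\{\varphi_1,\dots,\varphi_N\}$; $P_N\psi=\sum_{i=1}^N\langle\psi,\varphi_i\rangle\varphi_i$, acting componentwise on pairs; $\Lambda_N=\Lambda P_N$ on $U_N$; $F_N=P_NF$. $X^N=[u^N,v^N]^T$ is the $U_N\times U_N$-valued solution of $\mathrm dX^N=A_NX^N\,\mathrm dt+\mathbf F_N(X^N)\,\mathrm dt+B_N\,\mathrm dW^Q$, $X^N(0)=P_NX_0$, with $A_N=\begin{bmatrix}0&I\\-\Lambda_N&0\end{bmatrix}$, $\mathbf F_N([x_1,x_2]^T)=[0,F_N(x_2)]^T$, $B_N=[0,P_N]^T$. Put $E_N(t)=e^{tA_N}$. Time discretization. With $t_m=m\tau$, $\tau=T/M$, $\Delta W_m=W^Q(t_{m+1})-W^Q(t_m)$, $X_{N,0}=X^N(0)$, the $U_N\times U_N$-valued $X_{N,m+1}$ is the solution of $X_{N,m+1}=E_N(\tau)X_{N,m}+\tau\,\mathbf F_N(X_{N,m+1})+E_N(\tau)B_N\Delta W_m$, which is uniquely solvable whenever $C_1\tau<1$. Remainders. For $0\le m\le M-1$, $$R_{m+1}=\int_{t_m}^{t_{m+1}}\Big(E_N(t_{m+1}-s)\mathbf F_N(X^N(s))-\mathbf F_N(X^N(t_{m+1}))\Big)\mathrm ds+\int_{t_m}^{t_{m+1}}E_N(t_{m+1}-s)B_N\,\mathrm dW^Q(s)-E_N(\tau)B_N\Delta W_m ,$$ so that $X^N(t_{m+1})=E_N(\tau)X^N(t_m)+\tau\mathbf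 F_N(X^N(t_{m+1}))+E_N(\tau)B_N\Delta W_m+R_{m+1}$. *)

theory Defs
  imports "HOL-Probability.Probability"
begin

section \<open>The space of square-integrable functions\<close>

definition sq_integrable :: "('a::euclidean_space \<Rightarrow> real) \<Rightarrow> bool" where
  "sq_integrable g \<longleftrightarrow> g \<in> borel_measurable lborel \<and> integrable lborel (\<lambda>x. (g x)\<^sup>2)"

definition l2_rel :: "('a::euclidean_space \<Rightarrow> real) \<Rightarrow> ('a \<Rightarrow> real) \<Rightarrow> bool" where
  "l2_rel g h \<longleftrightarrow> sq_integrable g \<and> sq_integrable h \<and> (AE x in lborel. g x = h x)"

lemma sq_integrable_mult:
  assumes "sq_integrable g" "sq_integrable h"
  shows "integrable lborel (\<lambda>x. g x * h x)"
proof (rule Bochner_Integration.integrable_bound)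
  show "integrable lborel (\<lambda>x. (g x)\<^sup>2 + (h x)\<^sup>2)"
    using assms by (auto simp: sq_integrable_def)
  show "(\<lambda>x. g x * h x) \<in> borel_measurable lborel"
    using assms by (auto simp: sq_integrable_def)
  show "AE x in lborel. norm (g x * h x) \<le> norm ((g x)\<^sup>2 + (h x)\<^sup>2)"
  proof (intro AE_I2)
    fix x
    have "2 * (\<bar>g x\<bar> * \<bar>h x\<bar>) \<le> \<bar>g x\<bar>\<^sup>2 + \<bar>h x\<bar>\<^sup>2"
      using sum_squares_bound[of "\<bar>g x\<bar>" "\<bar>h x\<bar>"] by (simp add: mult.assoc)
    then have "\<bar>g x\<bar> * \<bar>h x\<bar> \<le> \<bar>g x\<bar>\<^sup>2 + \<bar>h x\<bar>\<^sup>2"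
      using mult_nonneg_nonneg[OF abs_ge_zero[of "g x"] abs_ge_zero[of "h x"]] by linarith
    then show "norm (g x * h x) \<le> norm ((g x)\<^sup>2 + (h x)\<^sup>2)"
      by (simp add: abs_mult)
  qed
qed

lemma sq_integrable_add:
  assumes "sq_integrable g" "sq_integrable h"
  shows "sq_integrable (\<lambda>x. g x + h x)"
  using assms sq_integrable_mult[OF assms]
  by (auto simp: sq_integrable_def power2_sum mult.assoc)

lemma sq_integrable_scale: "sq_integrable g \<Longrightarrow> sq_integrable (\<lambda>x. c * g x)"
  by (auto simp: sq_integrable_def power_mult_distrib)

lemma sq_integrable_zero: "sq_integrable (\<lambda>x. 0)"
  by (simp add: sq_integrable_def)

lemma sq_integrable_uminus: "sq_integrable g \<Longrightarrow> sq_integrable (\<lambda>x. - g x)"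
  by (auto simp: sq_integrable_def)

lemma sq_integrable_diff:
  assumes "sq_integrable g" "sq_integrable h"
  shows "sq_integrable (\<lambda>x. g x - h x)"
  using sq_integrable_add[OF assms(1) sq_integrable_uminus[OF assms(2)]] by simp

quotient_type (overloaded) 'a L2 = "'a::euclidean_space \<Rightarrow> real" / partial: l2_rel
proof (rule part_equivpI)
  show "\<exists>g. l2_rel g g"
    using sq_integrable_zero by (auto simp: l2_rel_def)
  show "symp l2_rel"
    by (auto intro!: sympI simp: l2_rel_def)
  show "transp l2_rel"
    by (auto intro!: transpI simp: l2_rel_def)
qed

instantiation L2 :: (euclidean_space) real_vector
begin

lift_definition zero_L2 :: "'a L2" is "\<lambda>x. 0"
  using sq_integrable_zero by (simp add: l2_rel_def)

lift_definition plus_L2 :: "'a L2 \<Rightarrow> 'a L2 \<Rightarrow> 'a L2" is "\<lambda>g h x. g x + h x"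
  by (auto simp: l2_rel_def sq_integrable_add)

lift_definition uminus_L2 :: "'a L2 \<Rightarrow> 'a L2" is "\<lambda>g x. - g x"
  by (auto simp: l2_rel_def sq_integrable_uminus)

lift_definition minus_L2 :: "'a L2 \<Rightarrow> 'a L2 \<Rightarrow> 'a L2" is "\<lambda>g h x. g x - h x"
  by (auto simp: l2_rel_def sq_integrable_diff)

lift_definition scaleR_L2 :: "real \<Rightarrow> 'a L2 \<Rightarrow> 'a L2" is "\<lambda>c g x. c * g x"
  by (auto simp: l2_rel_def sq_integrable_scale)

instance
proof
  fix a b c :: "'a L2" and r s :: real
  show "a + b + c = a + (b + c)" by transfer (auto simp: l2_rel_def sq_integrable_add add.assoc)
  show "a + b = b + a" by transfer (auto simp: l2_rel_def sq_integrable_add add.commute)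
  show "0 + a = a" by transfer (auto simp: l2_rel_def)
  show "- a + a = 0" by transfer (auto simp: l2_rel_def sq_integrable_zero)
  show "a - b = a + - b"
    by transfer (auto simp: l2_rel_def sq_integrable_diff)
  show "r *\<^sub>R (a + b) = r *\<^sub>R a + r *\<^sub>R b"
    by transfer (auto simp: l2_rel_def sq_integrable_add sq_integrable_scale distrib_left)
  show "(r + s) *\<^sub>R a = r *\<^sub>R a + s *\<^sub>R a"
    by transfer (auto simp: l2_rel_def sq_integrable_add sq_integrable_scale distrib_right)
  show "r *\<^sub>R s *\<^sub>R a = (r * s) *\<^sub>R a"
    by transfer (auto simp: l2_rel_def sq_integrable_scale mult.assoc)
  show "1 *\<^sub>R a = a" by transfer (auto simp: l2_rel_def)
qed

end

instantiation L2 :: (euclidean_space) real_inner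
begin

lift_definition inner_L2 :: "'a L2 \<Rightarrow> 'a L2 \<Rightarrow> real" is "\<lambda>g h. \<integral>x. g x * h x \<partial>lborel"
  by (intro integral_cong_AE) (auto simp: l2_rel_def sq_integrable_def)

definition norm_L2 :: "'a L2 \<Rightarrow> real" where "norm_L2 u = sqrt (inner u u)"
definition dist_L2 :: "'a L2 \<Rightarrow> 'a L2 \<Rightarrow> real" where "dist_L2 u v = norm (u - v)"
definition sgn_L2 :: "'a L2 \<Rightarrow> 'a L2" where "sgn_L2 u = u /\<^sub>R norm u"
definition uniformity_L2 :: "('a L2 \<times> 'a L2) filter" where
  "uniformity_L2 = (INF e\<in>{0<..}. principal {(u, v). dist u v < e})"
definition open_L2 :: "'a L2 set \<Rightarrow> bool" where
  "open_L2 S = (\<forall>u\<in>S. \<forall>\<^sub>F (u', v) in uniformity. u' = u \<longrightarrow> v \<in> S)"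

instance
proof
  fix a b c :: "'a L2" and r :: real and S :: "'a L2 set"
  show "dist a b = norm (a - b)" by (fact dist_L2_def)
  show "sgn a = a /\<^sub>R norm a" by (fact sgn_L2_def)
  show "(uniformity :: ('a L2 \<times> 'a L2) filter) = (INF e\<in>{0<..}. principal {(u, v). dist u v < e})"
    by (fact uniformity_L2_def)
  show "open S = (\<forall>u\<in>S. \<forall>\<^sub>F (u', v) in uniformity. u' = u \<longrightarrow> v \<in> S)"
    by (fact open_L2_def)
  show "inner a b = inner b a" by transfer (simp add: mult.commute)
  show "inner (a + b) c = inner a c + inner b c"
    by transfer (simp add: l2_rel_def distrib_right sq_integrable_mult)
  show "inner (r *\<^sub>R a) b = r * inner a b"
    by transfer (simp add: l2_rel_def mult.assoc)
  show "0 \<le> inner a a" by transfer simp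
  show "(inner a a = 0) = (a = 0)"
  proof transfer
    fix g :: "'a \<Rightarrow> real"
    assume g: "l2_rel g g"
    then have "integrable lborel (\<lambda>x. g x * g x)" by (simp add: l2_rel_def sq_integrable_mult)
    from integral_nonneg_eq_0_iff_AE[OF this] g
    show "((\<integral>x. g x * g x \<partial>lborel) = 0) = l2_rel g (\<lambda>x. 0)"
      by (simp add: l2_rel_def sq_integrable_zero)
  qed
  show "norm a = sqrt (inner a a)" by (fact norm_L2_def)
qed

end

definition to_L2 :: "('a::euclidean_space \<Rightarrow> real) \<Rightarrow> 'a L2" where
  "to_L2 g = (if sq_integrable g then abs_L2 g else 0)"

text \<open>\<open>L\<^sup>2(D)\<close> is identified with the subspace of the functions on the whole space that vanish
  almost everywhere outside \<open>D\<close>.\<close>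

definition L2_on :: "'a::euclidean_space set \<Rightarrow> 'a L2 set" where
  "L2_on D = {u. AE x in lborel. x \<notin> D \<longrightarrow> rep_L2 u x = 0}"


section \<open>Smooth domains and the Dirichlet Laplacian\<close>

definition partial_deriv :: "'a::euclidean_space \<Rightarrow> ('a \<Rightarrow> real) \<Rightarrow> 'a \<Rightarrow> real" where
  "partial_deriv b g x = frechet_derivative g (at x) b"

primrec Ck_on :: "nat \<Rightarrow> ('a::euclidean_space \<Rightarrow> real) \<Rightarrow> 'a set \<Rightarrow> bool" where
  "Ck_on 0 g S \<longleftrightarrow> continuous_on S g"
| "Ck_on (Suc k) g S \<longleftrightarrow>
     (\<forall>x\<in>S. g differentiable (at x)) \<and> (\<forall>b\<in>Basis. Ck_on k (partial_deriv b g) S)"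

definition smooth_on :: "'a::euclidean_space set \<Rightarrow> ('a \<Rightarrow> real) \<Rightarrow> bool" where
  "smooth_on S g \<longleftrightarrow> (\<forall>k. Ck_on k g S)"

definition smooth_boundary :: "'a::euclidean_space set \<Rightarrow> bool" where
  "smooth_boundary D \<longleftrightarrow>
     (\<forall>p\<in>frontier D. \<exists>V g. open V \<and> p \<in> V \<and> smooth_on V g \<and>
        (\<forall>x\<in>V. \<exists>b\<in>Basis. partial_deriv b g x \<noteq> 0) \<and> D \<inter> V = {x\<in>V. g x < 0})"

definition smooth_bounded_domain :: "'a::euclidean_space set \<Rightarrow> bool" where
  "smooth_bounded_domain D \<longleftrightarrow>
     open D \<and> connected D \<and> D \<noteq> {} \<and> bounded D \<and> smooth_boundary D"

definition test_functions :: "'a::euclidean_space set \<Rightarrow> ('a \<Rightarrow> real) set" where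
  "test_functions D = {\<psi>. smooth_on UNIV \<psi> \<and> compact (closure {x. \<psi> x \<noteq> 0}) \<and>
     closure {x. \<psi> x \<noteq> 0} \<subseteq> D}"

definition weak_partial :: "'a::euclidean_space set \<Rightarrow> 'a \<Rightarrow> 'a L2 \<Rightarrow> 'a L2 \<Rightarrow> bool" where
  "weak_partial D b u g \<longleftrightarrow> u \<in> L2_on D \<and> g \<in> L2_on D \<and>
     (\<forall>\<psi>\<in>test_functions D. inner u (to_L2 (partial_deriv b \<psi>)) = - inner g (to_L2 \<psi>))"

definition H2 :: "'a::euclidean_space set \<Rightarrow> 'a L2 set" where
  "H2 D = {u. \<exists>g h. \<forall>b\<in>Basis. weak_partial D b u (g b) \<and>
     (\<forall>c\<in>Basis. weak_partial D c (g b) (h b c))}"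

definition H1_0 :: "'a::euclidean_space set \<Rightarrow> 'a L2 set" where
  "H1_0 D = {u. \<exists>g. (\<forall>b\<in>Basis. weak_partial D b u (g b)) \<and>
     (\<exists>\<psi>. (\<forall>n::nat. \<psi> n \<in> test_functions D) \<and> (\<lambda>n. to_L2 (\<psi> n)) \<longlonglongrightarrow> u \<and>
        (\<forall>b\<in>Basis. (\<lambda>n. to_L2 (partial_deriv b (\<psi> n))) \<longlonglongrightarrow> g b))}"

definition neg_laplacian :: "'a::euclidean_space set \<Rightarrow> 'a L2 \<Rightarrow> 'a L2 \<Rightarrow> bool" where
  "neg_laplacian D u w \<longleftrightarrow>
     (\<exists>g h. (\<forall>b\<in>Basis. weak_partial D b u (g b) \<and> weak_partial D b (g b) (h b)) \<and>
        w = - (\<Sum>b\<in>Basis. h b))"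

definition orthonormal_basis :: "'h::real_inner set \<Rightarrow> (nat \<Rightarrow> 'h) \<Rightarrow> bool" where
  "orthonormal_basis V e \<longleftrightarrow> (\<forall>i. e i \<in> V) \<and>
     (\<forall>i j. inner (e i) (e j) = (if i = j then 1 else 0)) \<and> V \<subseteq> closure (span (range e))"

text \<open>Eigenpairs are numbered from 0, so \<open>(lam j, \<phi> j)\<close> is the pair of index \<open>j + 1\<close> in
  the numbering from 1.\<close>

definition dirichlet_eigenpairs ::
  "'a::euclidean_space set \<Rightarrow> (nat \<Rightarrow> real) \<Rightarrow> (nat \<Rightarrow> 'a L2) \<Rightarrow> bool" where
  "dirichlet_eigenpairs D lam \<phi> \<longleftrightarrow> orthonormal_basis (L2_on D) \<phi> \<and> mono lam \<and>
     (\<forall>j. \<phi> j \<in> H2 D \<inter> H1_0 D \<and> neg_laplacian D (\<phi> j) (lam j *\<^sub>R \<phi> j))"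

definition dom_sqrt_lap ::
  "'a::euclidean_space set \<Rightarrow> (nat \<Rightarrow> real) \<Rightarrow> (nat \<Rightarrow> 'a L2) \<Rightarrow> 'a L2 set" where
  "dom_sqrt_lap D lam \<phi> =
     {u \<in> L2_on D. summable (\<lambda>j. (sqrt (lam j) * inner u (\<phi> j)) *\<^sub>R \<phi> j)}"

definition sqrt_lap ::
  "(nat \<Rightarrow> real) \<Rightarrow> (nat \<Rightarrow> 'a L2) \<Rightarrow> 'a::euclidean_space L2 \<Rightarrow> 'a L2" where
  "sqrt_lap lam \<phi> u = (\<Sum>j. (sqrt (lam j) * inner u (\<phi> j)) *\<^sub>R \<phi> j)"

definition norm_H1 ::
  "(nat \<Rightarrow> real) \<Rightarrow> (nat \<Rightarrow> 'a L2) \<Rightarrow> 'a::euclidean_space L2 \<times> 'a L2 \<Rightarrow> real" where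
  "norm_H1 lam \<phi> x = sqrt ((norm (sqrt_lap lam \<phi> (fst x)))\<^sup>2 + (norm (snd x))\<^sup>2)"


section \<open>The nonlinearity\<close>

text \<open>\<open>\<bar>y\<bar>\<close> to a real power with the convention that the zeroth power of 0 is 1
  (in contrast to \<open>powr\<close>); this matters for \<open>\<gamma> = 2\<close>.\<close>

definition abs_power :: "real \<Rightarrow> real \<Rightarrow> real" where
  "abs_power y a = (if a = 0 then 1 else \<bar>y\<bar> powr a)"

definition nonlinearity_A1 ::
  "(real \<Rightarrow> real) \<Rightarrow> real \<Rightarrow> real \<Rightarrow> real \<Rightarrow> real \<Rightarrow> real \<Rightarrow> bool" where
  "nonlinearity_A1 f C0 C1 C2 C3 \<gamma> \<longleftrightarrow>
     (\<forall>y. f differentiable (at y)) \<and> (\<forall>y. deriv f differentiable (at y)) \<and>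
     continuous_on UNIV (deriv (deriv f)) \<and>
     C0 > 0 \<and> C2 > 0 \<and> C3 > 0 \<and> \<gamma> \<ge> 2 \<and>
     (\<forall>y. y * f y \<le> C0 * (1 + \<bar>y\<bar>\<^sup>2)) \<and>
     (\<forall>y. deriv f y \<le> C1) \<and>
     (\<forall>y. \<bar>deriv f y\<bar> \<le> C2 * (1 + abs_power y (\<gamma> - 1))) \<and>
     (\<forall>y. \<bar>deriv (deriv f) y\<bar> \<le> C3 * (1 + abs_power y (\<gamma> - 2)))"

definition nemytskii :: "'a::euclidean_space set \<Rightarrow> (real \<Rightarrow> real) \<Rightarrow> 'a L2 \<Rightarrow> 'a L2" where
  "nemytskii D f v = to_L2 (\<lambda>x. indicator D x * f (rep_L2 v x))"


section \<open>The noise and the stochastic integral\<close>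

definition bounded_operator ::
  "'u::real_normed_vector set \<Rightarrow> 'h::real_normed_vector set \<Rightarrow> ('u \<Rightarrow> 'h) \<Rightarrow> bool" where
  "bounded_operator V H L \<longleftrightarrow> (\<forall>u\<in>V. L u \<in> H) \<and>
     (\<forall>u\<in>V. \<forall>v\<in>V. L (u + v) = L u + L v) \<and> (\<forall>c. \<forall>u\<in>V. L (c *\<^sub>R u) = c *\<^sub>R L u) \<and>
     (\<exists>K. \<forall>u\<in>V. norm (L u) \<le> K * norm u)"

definition psd_operator :: "'u::real_inner set \<Rightarrow> ('u \<Rightarrow> 'u) \<Rightarrow> bool" where
  "psd_operator V Q \<longleftrightarrow> bounded_operator V V Q \<and>
     (\<forall>u\<in>V. \<forall>v\<in>V. inner (Q u) v = inner u (Q v)) \<and> (\<forall>u\<in>V. inner (Q u) u \<ge> 0)"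

definition is_operator_sqrt :: "'u::real_inner set \<Rightarrow> ('u \<Rightarrow> 'u) \<Rightarrow> ('u \<Rightarrow> 'u) \<Rightarrow> bool" where
  "is_operator_sqrt V Q S \<longleftrightarrow> psd_operator V S \<and> (\<forall>u\<in>V. S (S u) = Q u)"

definition hilbert_schmidt :: "'u::real_inner set \<Rightarrow> ('u \<Rightarrow> 'u) \<Rightarrow> bool" where
  "hilbert_schmidt V L \<longleftrightarrow> bounded_operator V V L \<and>
     (\<exists>e. orthonormal_basis V e \<and> summable (\<lambda>k. (norm (L (e k)))\<^sup>2))"

text \<open>\<open>Qh\<close> plays the role of \<open>Q\<^sup>1\<^sup>/\<^sup>2\<close>, which is unique on \<open>L\<^sup>2(D)\<close>.\<close>

definition covariance_A2 ::
  "'a::euclidean_space set \<Rightarrow> (nat \<Rightarrow> real) \<Rightarrow> (nat \<Rightarrow> 'a L2) \<Rightarrow>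
   ('a L2 \<Rightarrow> 'a L2) \<Rightarrow> ('a L2 \<Rightarrow> 'a L2) \<Rightarrow> bool" where
  "covariance_A2 D lam \<phi> Q Qh \<longleftrightarrow>
     psd_operator (L2_on D) Q \<and> is_operator_sqrt (L2_on D) Q Qh \<and>
     (\<forall>u\<in>L2_on D. Qh u \<in> dom_sqrt_lap D lam \<phi>) \<and>
     hilbert_schmidt (L2_on D) (\<lambda>u. sqrt_lap lam \<phi> (Qh u))"

definition filtered_prob_space :: "'w measure \<Rightarrow> (real \<Rightarrow> 'w measure) \<Rightarrow> bool" where
  "filtered_prob_space P F \<longleftrightarrow> prob_space P \<and> (\<forall>t\<ge>0. subalgebra P (F t)) \<and>
     (\<forall>s t. 0 \<le> s \<longrightarrow> s \<le> t \<longrightarrow> sets (F s) \<subseteq> sets (F t))"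

definition centered_gaussian :: "'w measure \<Rightarrow> ('w \<Rightarrow> real) \<Rightarrow> real \<Rightarrow> bool" where
  "centered_gaussian P Z v \<longleftrightarrow> Z \<in> borel_measurable P \<and>
     (if v = 0 then AE \<omega> in P. Z \<omega> = 0
      else v > 0 \<and> distributed P lborel Z (normal_density 0 (sqrt v)))"

definition Q_wiener_process ::
  "'w measure \<Rightarrow> (real \<Rightarrow> 'w measure) \<Rightarrow> 'u::real_inner set \<Rightarrow> ('u \<Rightarrow> 'u) \<Rightarrow>
   (real \<Rightarrow> 'w \<Rightarrow> 'u) \<Rightarrow> bool" where
  "Q_wiener_process P F V Q W \<longleftrightarrow>
     (\<forall>t\<ge>0. W t \<in> borel_measurable (F t) \<and> (\<forall>\<omega>\<in>space P. W t \<omega> \<in> V)) \<and>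
     (AE \<omega> in P. W 0 \<omega> = 0) \<and>
     (AE \<omega> in P. continuous_on {0..} (\<lambda>t. W t \<omega>)) \<and>
     (\<forall>s t. 0 \<le> s \<longrightarrow> s \<le> t \<longrightarrow>
        prob_space.indep_set P (sets (F s))
          {(\<lambda>\<omega>. W t \<omega> - W s \<omega>) -` A \<inter> space P |A. A \<in> sets borel} \<and>
        (\<forall>h\<in>V. centered_gaussian P (\<lambda>\<omega>. inner (W t \<omega> - W s \<omega>) h) ((t - s) * inner (Q h) h)))"

text \<open>The stochastic integral over \<open>[a, b]\<close> of a deterministic integrand \<open>G\<close> whose values are
  operators from \<open>V\<close> to \<open>H\<close>: the \<open>L\<^sup>2(P)\<close> limit of the integrals of step functions which
  converge to \<open>G\<close> in the norm of the Ito isometry,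
  the square of which is the integral of the squared Hilbert-Schmidt norm of \<open>G s \<circ> Qh\<close>.
  Since \<open>G\<close> is deterministic, deterministic step functions suffice. The Hilbert-Schmidt norm is
  computed in the orthonormal basis \<open>e\<close> of \<open>V\<close>, on which it does not depend.\<close>

definition hs_norm_sq :: "(nat \<Rightarrow> 'u) \<Rightarrow> ('u \<Rightarrow> 'h::real_normed_vector) \<Rightarrow> ennreal" where
  "hs_norm_sq e L = (\<Sum>i. ennreal ((norm (L (e i)))\<^sup>2))"

definition step_integrand ::
  "nat \<Rightarrow> (nat \<Rightarrow> real) \<Rightarrow> (nat \<Rightarrow> 'u \<Rightarrow> 'h::real_normed_vector) \<Rightarrow> real \<Rightarrow> 'u \<Rightarrow> 'h" where
  "step_integrand n p L s u = (\<Sum>k<n. indicator {p k<..p (Suc k)} s *\<^sub>R L k u)"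

definition step_integral ::
  "(real \<Rightarrow> 'w \<Rightarrow> 'u::real_normed_vector) \<Rightarrow> nat \<Rightarrow> (nat \<Rightarrow> real) \<Rightarrow>
   (nat \<Rightarrow> 'u \<Rightarrow> 'h::real_normed_vector) \<Rightarrow> 'w \<Rightarrow> 'h" where
  "step_integral W n p L \<omega> = (\<Sum>k<n. L k (W (p (Suc k)) \<omega> - W (p k) \<omega>))"

definition has_stochastic_integral ::
  "'w measure \<Rightarrow> 'u::real_inner set \<Rightarrow> 'h::real_inner set \<Rightarrow> (nat \<Rightarrow> 'u) \<Rightarrow> ('u \<Rightarrow> 'u) \<Rightarrow>
   (real \<Rightarrow> 'w \<Rightarrow> 'u) \<Rightarrow> (real \<Rightarrow> 'u \<Rightarrow> 'h) \<Rightarrow> real \<Rightarrow> real \<Rightarrow> ('w \<Rightarrow> 'h) \<Rightarrow> bool" where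
  "has_stochastic_integral P V H e Qh W G a b I \<longleftrightarrow>
     I \<in> borel_measurable P \<and> (\<forall>\<omega>\<in>space P. I \<omega> \<in> H) \<and>
     (\<exists>n p L.
        (\<forall>j::nat. p j 0 = a \<and> p j (n j) = b \<and>
           (\<forall>k<n j. p j k \<le> p j (Suc k) \<and> bounded_operator V H (L j k))) \<and>
        (\<lambda>j. \<integral>\<^sup>+s\<in>{a..b}. hs_norm_sq e
           (\<lambda>u. G s (Qh u) - step_integrand (n j) (p j) (L j) s (Qh u)) \<partial>lborel)
           \<longlonglongrightarrow> 0 \<and>
        (\<lambda>j. \<integral>\<^sup>+\<omega>. ennreal ((norm (I \<omega> - step_integral W (n j) (p j) (L j) \<omega>))\<^sup>2) \<partial>P)
           \<longlonglongrightarrow> 0)"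

definition stochastic_integral ::
  "'w measure \<Rightarrow> 'u::real_inner set \<Rightarrow> 'h::real_inner set \<Rightarrow> (nat \<Rightarrow> 'u) \<Rightarrow> ('u \<Rightarrow> 'u) \<Rightarrow>
   (real \<Rightarrow> 'w \<Rightarrow> 'u) \<Rightarrow> (real \<Rightarrow> 'u \<Rightarrow> 'h) \<Rightarrow> real \<Rightarrow> real \<Rightarrow> 'w \<Rightarrow> 'h" where
  "stochastic_integral P V H e Qh W G a b =
     (SOME I. has_stochastic_integral P V H e Qh W G a b I)"


section \<open>Spectral Galerkin semi-discretization\<close>

definition U_N :: "(nat \<Rightarrow> 'a::euclidean_space L2) \<Rightarrow> nat \<Rightarrow> 'a L2 set" where
  "U_N \<phi> N = span (\<phi> ` {..<N})"

definition P_N :: "(nat \<Rightarrow> 'a::euclidean_space L2) \<Rightarrow> nat \<Rightarrow> 'a L2 \<Rightarrow> 'a L2" where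
  "P_N \<phi> N u = (\<Sum>i<N. inner u (\<phi> i) *\<^sub>R \<phi> i)"

text \<open>The negative Dirichlet Laplacian applied to \<open>P_N \<phi> N u\<close>.\<close>

definition Lam_N ::
  "(nat \<Rightarrow> real) \<Rightarrow> (nat \<Rightarrow> 'a::euclidean_space L2) \<Rightarrow> nat \<Rightarrow> 'a L2 \<Rightarrow> 'a L2" where
  "Lam_N lam \<phi> N u = (\<Sum>i<N. (lam i * inner u (\<phi> i)) *\<^sub>R \<phi> i)"

definition A_N ::
  "(nat \<Rightarrow> real) \<Rightarrow> (nat \<Rightarrow> 'a::euclidean_space L2) \<Rightarrow> nat \<Rightarrow>
   'a L2 \<times> 'a L2 \<Rightarrow> 'a L2 \<times> 'a L2" where
  "A_N lam \<phi> N x = (snd x, - Lam_N lam \<phi> N (fst x))"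

definition FF_N ::
  "'a::euclidean_space set \<Rightarrow> (real \<Rightarrow> real) \<Rightarrow> (nat \<Rightarrow> 'a L2) \<Rightarrow> nat \<Rightarrow>
   'a L2 \<times> 'a L2 \<Rightarrow> 'a L2 \<times> 'a L2" where
  "FF_N D f \<phi> N x = (0, P_N \<phi> N (nemytskii D f (snd x)))"

definition B_N :: "(nat \<Rightarrow> 'a::euclidean_space L2) \<Rightarrow> nat \<Rightarrow> 'a L2 \<Rightarrow> 'a L2 \<times> 'a L2" where
  "B_N \<phi> N w = (0, P_N \<phi> N w)"

definition operator_exp :: "('h::real_normed_vector \<Rightarrow> 'h) \<Rightarrow> 'h \<Rightarrow> 'h" where
  "operator_exp L x = (\<Sum>k. (L ^^ k) x /\<^sub>R fact k)"

definition E_N ::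
  "(nat \<Rightarrow> real) \<Rightarrow> (nat \<Rightarrow> 'a::euclidean_space L2) \<Rightarrow> nat \<Rightarrow> real \<Rightarrow>
   'a L2 \<times> 'a L2 \<Rightarrow> 'a L2 \<times> 'a L2" where
  "E_N lam \<phi> N t = operator_exp (\<lambda>x. t *\<^sub>R A_N lam \<phi> N x)"

text \<open>The integral of the constant operator \<open>B_N \<phi> N\<close> against \<open>W\<close> over \<open>[0, t]\<close> is
  \<open>B_N \<phi> N (W t - W 0)\<close>.\<close>

definition galerkin_solution ::
  "'a::euclidean_space set \<Rightarrow> (nat \<Rightarrow> real) \<Rightarrow> (nat \<Rightarrow> 'a L2) \<Rightarrow> (real \<Rightarrow> real) \<Rightarrow>
   'w measure \<Rightarrow> (real \<Rightarrow> 'w measure) \<Rightarrow> (real \<Rightarrow> 'w \<Rightarrow> 'a L2) \<Rightarrow> ('w \<Rightarrow> 'a L2 \<times> 'a L2) \<Rightarrow>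
   real \<Rightarrow> nat \<Rightarrow> (real \<Rightarrow> 'w \<Rightarrow> 'a L2 \<times> 'a L2) \<Rightarrow> bool" where
  "galerkin_solution D lam \<phi> f P F W X0 T N X \<longleftrightarrow>
     (\<forall>t\<in>{0..T}. X t \<in> borel_measurable (F t)) \<and>
     (\<forall>\<omega>\<in>space P. (\<forall>t\<in>{0..T}. X t \<omega> \<in> U_N \<phi> N \<times> U_N \<phi> N) \<and>
        continuous_on {0..T} (\<lambda>t. X t \<omega>)) \<and>
     (AE \<omega> in P. \<forall>t\<in>{0..T}. X t \<omega> =
        (P_N \<phi> N (fst (X0 \<omega>)), P_N \<phi> N (snd (X0 \<omega>)))
        + integral {0..t} (\<lambda>s. A_N lam \<phi> N (X s \<omega>) + FF_N D f \<phi> N (X s \<omega>))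
        + B_N \<phi> N (W t \<omega> - W 0 \<omega>))"


section \<open>Time discretization\<close>

definition time_scheme ::
  "'a::euclidean_space set \<Rightarrow> (nat \<Rightarrow> real) \<Rightarrow> (nat \<Rightarrow> 'a L2) \<Rightarrow> (real \<Rightarrow> real) \<Rightarrow>
   'w measure \<Rightarrow> (real \<Rightarrow> 'w \<Rightarrow> 'a L2) \<Rightarrow> nat \<Rightarrow> (real \<Rightarrow> 'w \<Rightarrow> 'a L2 \<times> 'a L2) \<Rightarrow>
   real \<Rightarrow> nat \<Rightarrow> (nat \<Rightarrow> 'w \<Rightarrow> 'a L2 \<times> 'a L2) \<Rightarrow> bool" where
  "time_scheme D lam \<phi> f P W N X \<tau> M Y \<longleftrightarrow>
     (\<forall>\<omega>\<in>space P. Y 0 \<omega> = X 0 \<omega> \<and>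
        (\<forall>m<M. Y (Suc m) \<omega> \<in> U_N \<phi> N \<times> U_N \<phi> N \<and>
           Y (Suc m) \<omega> = E_N lam \<phi> N \<tau> (Y m \<omega>) + \<tau> *\<^sub>R FF_N D f \<phi> N (Y (Suc m) \<omega>)
             + E_N lam \<phi> N \<tau> (B_N \<phi> N (W (real (Suc m) * \<tau>) \<omega> - W (real m * \<tau>) \<omega>))))"

text \<open>\<open>local_remainder \<dots> \<tau> m\<close> is the remainder over \<open>[m \<tau>, (m + 1) \<tau>]\<close>, that is \<open>R\<close> with
  index \<open>m + 1\<close>.\<close>

definition local_remainder ::
  "'a::euclidean_space set \<Rightarrow> (nat \<Rightarrow> real) \<Rightarrow> (nat \<Rightarrow> 'a L2) \<Rightarrow> (real \<Rightarrow> real) \<Rightarrow>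
   'w measure \<Rightarrow> ('a L2 \<Rightarrow> 'a L2) \<Rightarrow> (real \<Rightarrow> 'w \<Rightarrow> 'a L2) \<Rightarrow> nat \<Rightarrow>
   (real \<Rightarrow> 'w \<Rightarrow> 'a L2 \<times> 'a L2) \<Rightarrow> real \<Rightarrow> nat \<Rightarrow> 'w \<Rightarrow> 'a L2 \<times> 'a L2" where
  "local_remainder D lam \<phi> f P Qh W N X \<tau> m \<omega> =
     (let a = real m * \<tau>; b = real (Suc m) * \<tau> in
        integral {a..b} (\<lambda>s. E_N lam \<phi> N (b - s) (FF_N D f \<phi> N (X s \<omega>)) - FF_N D f \<phi> N (X b \<omega>))
        + stochastic_integral P (L2_on D) (U_N \<phi> N \<times> U_N \<phi> N) \<phi> Qh W
            (\<lambda>s w. E_N lam \<phi> N (b - s) (B_N \<phi> N w)) a b \<omega>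
        - E_N lam \<phi> N \<tau> (B_N \<phi> N (W b \<omega> - W a \<omega>)))"

text \<open>Conditional expectation of a random variable with values in the finite-dimensional space
  \<open>U_N \<phi> N \<times> U_N \<phi> N\<close>, coordinatewise.\<close>

definition cond_exp_N ::
  "'w measure \<Rightarrow> 'w measure \<Rightarrow> (nat \<Rightarrow> 'a::euclidean_space L2) \<Rightarrow> nat \<Rightarrow>
   ('w \<Rightarrow> 'a L2 \<times> 'a L2) \<Rightarrow> 'w \<Rightarrow> 'a L2 \<times> 'a L2" where
  "cond_exp_N P G \<phi> N Z \<omega> =
     (\<Sum>i<N. real_cond_exp P G (\<lambda>\<omega>. inner (fst (Z \<omega>)) (\<phi> i)) \<omega> *\<^sub>R \<phi> i,
      \<Sum>i<N. real_cond_exp P G (\<lambda>\<omega>. inner (snd (Z \<omega>)) (\<phi> i)) \<omega> *\<^sub>R \<phi> i)"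

text \<open>Expectation of a squared norm, with values in \<open>[0, \<infinity>]\<close>.\<close>

definition mean_sq_H1 ::
  "'w measure \<Rightarrow> (nat \<Rightarrow> real) \<Rightarrow> (nat \<Rightarrow> 'a::euclidean_space L2) \<Rightarrow>
   ('w \<Rightarrow> 'a L2 \<times> 'a L2) \<Rightarrow> ennreal" where
  "mean_sq_H1 P lam \<phi> Z = (\<integral>\<^sup>+\<omega>. ennreal ((norm_H1 lam \<phi> (Z \<omega>))\<^sup>2) \<partial>P)"

end

theory Submission
  imports Defs
begin

text \<open>In the eigenbasis, \<open>E_N\<close> is a rotation and hence an isometry of the energy norm. Subtracting the
  scheme from the identity for the exact solution, testing with \<open>e\<^bsub>m+1\<^esub>\<close> and using the one-sided
  Lipschitz condition on \<open>f\<close> gives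
  \<open>(1 - 2 C\<^sub>1\<^sup>+ \<tau>) \<parallel>e\<^bsub>m+1\<^esub>\<parallel>\<^sup>2 \<le> \<parallel>E_N \<tau> e\<^bsub>m\<^esub> + R\<^bsub>m+1\<^esub>\<parallel>\<^sup>2\<close>. Since \<open>e\<^bsub>m\<^esub>\<close> is measurable at time \<open>t\<^bsub>m\<^esub>\<close>,
  the remainder may be replaced by its conditional expectation in the mixed term, which costs
  \<open>\<tau> \<parallel>e\<^bsub>m\<^esub>\<parallel>\<^sup>2 + \<tau>\<^sup>-\<^sup>1 \<parallel>E[R\<^bsub>m+1\<^esub> | F\<^bsub>m\<^esub>]\<parallel>\<^sup>2\<close>, and a discrete Gronwall argument concludes.

  Three points need an argument of their own. The superposition operator of \<open>f\<close> maps \<open>U_N\<close> into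
  \<open>L\<^sup>2\<close> because in dimension one and two \<open>H\<^sup>1\<^sub>0\<close> embeds into every \<open>L\<^sup>p\<close>. The identity that defines the
  remainders holds because the stochastic convolution is, by partial integration, the pathwise limit of
  Riemann sums, and the Ito inequality identifies this limit with the stochastic integral. The numerical
  solution is adapted because the solution map of the implicit step is Lipschitz continuous.\<close>

section \<open>Square-integrable functions and the Dirichlet eigenvalues\<close>

text \<open>The constant must not depend on \<open>N\<close>, while several facts about the Galerkin
  problem (square integrability of the nonlinearity, continuity of its coefficients, time regularity
  of the noise integrand) carry bounds that may grow with \<open>N\<close>. They serve only
  well-definedness, measurability and limits; the final estimate uses \<open>max 0 C1\<close>,
  \<open>T\<close> and the isometry of the wave group alone. Its constant is
  \<open>3 / 2 * exp ((3 * max 0 C1 + 1) * T)\<close>: for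
  \<open>x = max 0 C1 * \<tau> \<le> 1 / 6\<close> one has
  \<open>(1 + 3 * x) * (1 - 2 * x) \<ge> 1\<close>, so the implicit step costs a factor
  \<open>1 + 3 * x \<le> 3 / 2\<close>, and the weight \<open>\<tau>\<close> in the mixed term
  contributes the \<open>1\<close>. Second moments are never shown to be finite; expectations take
  values in \<open>[0, \<infinity>]\<close>, where an infinite right-hand side does no harm. The
  term \<open>stochastic_integral\<close> is a chosen value, so existence and almost sure uniqueness
  come before any formula for the remainder. The eigenvalues are only assumed ordered; their sign,
  on which energy norm and rotation rest, is derived.\<close>

lemma l2_rel_rep: "l2_rel (rep_L2 u) (rep_L2 u)"
  by (rule Quotient3_rep_reflp[OF Quotient3_L2])

lemma sq_integrable_rep: "sq_integrable (rep_L2 u)"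
  using l2_rel_rep[of u] by (simp add: l2_rel_def)

lemma rep_L2_measurable [measurable]: "rep_L2 u \<in> borel_measurable borel"
  using sq_integrable_rep[of u] by (simp add: sq_integrable_def)

text \<open>Elements of \<open>L2\<close> are classes, and \<open>rep_L2\<close> picks a
  representative. Operations on classes agree with the pointwise ones only almost everywhere; every
  pointwise argument below starts from such an AE statement.\<close>

lemma rep_to_L2: "sq_integrable g \<Longrightarrow> AE x in lborel. rep_L2 (to_L2 g) x = g x"
  using Quotient3_rep_abs[OF Quotient3_L2, of g] by (simp add: to_L2_def l2_rel_def)

lemma inner_L2_rep: "inner u v = (\<integral>x. rep_L2 u x * rep_L2 v x \<partial>lborel)"
  using inner_L2.abs_eq[OF l2_rel_rep l2_rel_rep, of u v] by (simp add: Quotient3_abs_rep[OF Quotient3_L2])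

lemma norm_L2_rep: "(norm u)\<^sup>2 = (\<integral>x. (rep_L2 u x)\<^sup>2 \<partial>lborel)"
  unfolding power2_norm_eq_inner inner_L2_rep by (simp add: power2_eq_square)

lemma rep_add: "AE x in lborel. rep_L2 (u + v) x = rep_L2 u x + rep_L2 v x"
  using rep_to_L2[of "\<lambda>x. rep_L2 u x + rep_L2 v x"] plus_L2.abs_eq[OF l2_rel_rep l2_rel_rep, of u v]
  by (simp add: to_L2_def sq_integrable_add sq_integrable_rep Quotient3_abs_rep[OF Quotient3_L2])

lemma rep_diff: "AE x in lborel. rep_L2 (u - v) x = rep_L2 u x - rep_L2 v x"
  using rep_to_L2[of "\<lambda>x. rep_L2 u x - rep_L2 v x"] minus_L2.abs_eq[OF l2_rel_rep l2_rel_rep, of u v]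
  by (simp add: to_L2_def sq_integrable_diff sq_integrable_rep Quotient3_abs_rep[OF Quotient3_L2])

lemma rep_scaleR: "AE x in lborel. rep_L2 (c *\<^sub>R u) x = c * rep_L2 u x"
  using rep_to_L2[of "\<lambda>x. c * rep_L2 u x"] scaleR_L2.abs_eq[OF l2_rel_rep, of c u]
  by (simp add: to_L2_def sq_integrable_scale sq_integrable_rep Quotient3_abs_rep[OF Quotient3_L2])

lemma rep_zero: "AE x in lborel. rep_L2 0 x = 0"
  using rep_to_L2[OF sq_integrable_zero] by (simp add: to_L2_def zero_L2.abs_eq sq_integrable_zero)

lemma rep_sum:
  "finite I \<Longrightarrow> AE x in lborel. rep_L2 (\<Sum>i\<in>I. c i *\<^sub>R u i) x = (\<Sum>i\<in>I. c i * rep_L2 (u i) x)"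
proof (induction I rule: finite_induct)
  case empty
  show ?case using rep_zero by simp
next
  case (insert i I)
  show ?case
    using insert.IH rep_add[of "c i *\<^sub>R u i" "\<Sum>i\<in>I. c i *\<^sub>R u i"] rep_scaleR[of "c i" "u i"]
    by eventually_elim (simp add: insert.hyps)
qed

lemma norm_to_L2: "sq_integrable g \<Longrightarrow> (norm (to_L2 g))\<^sup>2 = (\<integral>x. (g x)\<^sup>2 \<partial>lborel)"
  unfolding norm_L2_rep using rep_to_L2[of g]
  by (intro integral_cong_AE) (auto simp: sq_integrable_def)

lemma inner_to_L2:
  "sq_integrable g \<Longrightarrow> inner (to_L2 g) u = (\<integral>x. g x * rep_L2 u x \<partial>lborel)"
  unfolding inner_L2_rep using rep_to_L2[of g]
  by (intro integral_cong_AE) (auto simp: sq_integrable_def)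

lemma L2_on_add:
  assumes "u \<in> L2_on D" "v \<in> L2_on D"
  shows "u + v \<in> L2_on D"
  using assms rep_add[of u v] unfolding L2_on_def mem_Collect_eq by eventually_elim auto

lemma L2_on_scaleR:
  assumes "u \<in> L2_on D"
  shows "c *\<^sub>R u \<in> L2_on D"
  using assms rep_scaleR[of c u] unfolding L2_on_def mem_Collect_eq by eventually_elim auto

lemma L2_on_zero: "0 \<in> L2_on D"
  unfolding L2_on_def mem_Collect_eq using rep_zero by eventually_elim auto

lemma subspace_L2_on: "subspace (L2_on D)"
  by (simp add: subspace_def L2_on_zero L2_on_add L2_on_scaleR)

section \<open>Test functions, weak derivatives and the sign of the eigenvalues\<close>

lemma smooth_on_partial_deriv:
  "smooth_on S g \<Longrightarrow> b \<in> Basis \<Longrightarrow> smooth_on S (partial_deriv b g)"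
  unfolding smooth_on_def using Ck_on.simps(2) by blast

lemma smooth_on_differentiable: "smooth_on S g \<Longrightarrow> x \<in> S \<Longrightarrow> g differentiable (at x)"
  unfolding smooth_on_def using Ck_on.simps(2)[of 0] by blast

lemma smooth_on_continuous: "smooth_on S g \<Longrightarrow> continuous_on S g"
  unfolding smooth_on_def using Ck_on.simps(1) by blast

lemma partial_deriv_outside_support:
  assumes "x \<notin> closure {x. \<psi> x \<noteq> 0}"
  shows "partial_deriv b \<psi> x = 0"
proof -
  let ?U = "- closure {x. \<psi> x \<noteq> 0}"
  have "(\<psi> has_derivative (\<lambda>_. 0)) (at x)"
  proof (rule has_derivative_transform_within_open[of "\<lambda>_. 0" _ _ _ ?U])
    show "\<And>y. y \<in> ?U \<Longrightarrow> 0 = \<psi> y"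
      using closure_subset[of "{x. \<psi> x \<noteq> 0}"] by auto
  qed (use assms in auto)
  then show ?thesis
    by (simp add: partial_deriv_def frechet_derivative_at[symmetric])
qed

text \<open>Differentiation cannot enlarge the support. Because of this closure, a derivative of a
  test function may itself be inserted into a weak formulation, and the moment bounds apply to
  gradients as elements of \<open>L2\<close>.\<close>

lemma test_functions_partial_deriv:
  assumes "\<psi> \<in> test_functions D" "b \<in> Basis"
  shows "partial_deriv b \<psi> \<in> test_functions D"
proof -
  have sub: "closure {x. partial_deriv b \<psi> x \<noteq> 0} \<subseteq> closure {x. \<psi> x \<noteq> 0}"
    by (rule closure_minimal) (use partial_deriv_outside_support in auto)
  have "compact (closure {x. partial_deriv b \<psi> x \<noteq> 0})"
    using compact_Int_closed[of "closure {x. \<psi> x \<noteq> 0}" "closure {x. partial_deriv b \<psi> x \<noteq> 0}"] assms(1) sub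
    by (auto simp: test_functions_def Int_absorb1)
  then show ?thesis
    using assms sub by (auto simp: test_functions_def smooth_on_partial_deriv)
qed

lemma test_function_bounded_support:
  assumes "\<psi> \<in> test_functions D"
  obtains B r where "\<And>x. \<bar>\<psi> x\<bar> \<le> B" "\<And>x. x \<notin> cball 0 r \<Longrightarrow> \<psi> x = 0" "r > 0"
proof -
  let ?S = "closure {x. \<psi> x \<noteq> 0}"
  have c: "compact ?S" and cont: "continuous_on UNIV \<psi>"
    using assms by (auto simp: test_functions_def smooth_on_continuous)
  obtain r where r: "r > 0" "?S \<subseteq> cball 0 r"
    using compact_imp_bounded[OF c] by (auto simp: bounded_pos_less subset_iff intro: less_imp_le)
  have "bounded (\<psi> ` cball 0 r)"
    by (intro compact_imp_bounded compact_continuous_image continuous_on_subset[OF cont]) auto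
  then obtain B where B: "B > 0" "\<And>x. x \<in> cball 0 r \<Longrightarrow> \<bar>\<psi> x\<bar> \<le> B"
    by (auto simp: bounded_pos)
  have z: "\<psi> x = 0" if "x \<notin> cball 0 r" for x
    using that r closure_subset[of "{x. \<psi> x \<noteq> 0}"] by blast
  show ?thesis
    by (rule that[of B r]) (use B z r in fastforce)+
qed

lemma test_function_measurable:
  "\<psi> \<in> test_functions D \<Longrightarrow> \<psi> \<in> borel_measurable borel"
  by (intro borel_measurable_continuous_onI) (auto simp: test_functions_def smooth_on_continuous)

lemma bounded_support_integrable:
  fixes g :: "'a::euclidean_space \<Rightarrow> real"
  assumes "g \<in> borel_measurable borel" "\<And>x. \<bar>g x\<bar> \<le> B" "\<And>x. x \<notin> cball 0 r \<Longrightarrow> g x = 0"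
  shows "integrable lborel g"
proof (rule Bochner_Integration.integrable_bound)
  show "integrable lborel (\<lambda>x::'a. B * indicator (cball 0 r) x)"
    using emeasure_bounded_finite[OF bounded_cball, of "0::'a" r]
    by (intro Bochner_Integration.integrable_mult_right integrable_real_indicator) (simp_all add: less_top)
  show "AE x in lborel. norm (g x) \<le> norm (B * indicator (cball 0 r) x)"
    using assms(2,3) order.trans[OF assms(2) abs_ge_self] by (auto simp: indicator_def)
qed (use assms(1) in simp)

lemma test_function_sq_integrable:
  assumes "\<psi> \<in> test_functions D"
  shows "sq_integrable \<psi>"
proof -
  obtain B r where B: "\<And>x. \<bar>\<psi> x\<bar> \<le> B" and r: "\<And>x. x \<notin> cball 0 r \<Longrightarrow> \<psi> x = 0" "r > 0"
    using test_function_bounded_support[OF assms] by metis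
  note [measurable] = test_function_measurable[OF assms]
  have "integrable lborel (\<lambda>x. (\<psi> x)\<^sup>2)"
  proof (rule bounded_support_integrable[where B="B\<^sup>2" and r=r])
    show "\<bar>(\<psi> x)\<^sup>2\<bar> \<le> B\<^sup>2" for x
      using power_mono[OF B[of x] abs_ge_zero, of 2] by simp
  qed (use r in auto)
  then show ?thesis by (simp add: sq_integrable_def)
qed

text \<open>Weak derivatives are compared only with derivatives of test functions, which are again test
  functions, so the density of test functions in \<open>L\<^sup>2(D)\<close> is not needed.\<close>

lemma weak_partial_unique_limit:
  assumes "weak_partial D b u g" "weak_partial D b u g'" "b \<in> Basis"
    and "\<And>n::nat. \<psi> n \<in> test_functions D" "(\<lambda>n. to_L2 (partial_deriv b (\<psi> n))) \<longlonglongrightarrow> g"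
  shows "inner g' g = inner g g"
proof (rule LIMSEQ_unique)
  let ?d = "\<lambda>n. to_L2 (partial_deriv b (\<psi> n))"
  have eq: "inner g' (?d n) = inner g (?d n)" for n
    using assms(1,2) test_functions_partial_deriv[OF assms(4)[of n] assms(3)] unfolding weak_partial_def
    by (metis add.inverse_inverse)
  show "(\<lambda>n. inner g' (?d n)) \<longlonglongrightarrow> inner g' g"
    by (intro tendsto_intros assms)
  show "(\<lambda>n. inner g' (?d n)) \<longlonglongrightarrow> inner g g"
    unfolding eq by (intro tendsto_intros assms)
qed

lemma H1_0_E:
  assumes "u \<in> H1_0 D"
  obtains g \<psi> where "\<forall>b\<in>Basis. weak_partial D b u (g b)"
    and "\<forall>n::nat. \<psi> n \<in> test_functions D" "(\<lambda>n. to_L2 (\<psi> n)) \<longlonglongrightarrow> u"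
      "\<forall>b\<in>Basis. (\<lambda>n. to_L2 (partial_deriv b (\<psi> n))) \<longlonglongrightarrow> g b"
  using assms unfolding H1_0_def mem_Collect_eq by (elim exE conjE)

text \<open>The eigenvalue equals the Dirichlet energy of its normalized eigenfunction, which is a
  sum of squared norms. Integration by parts is available only against test functions, so it is done
  along the approximating sequence that \<open>H1_0\<close> provides.\<close>

lemma dirichlet_eigenvalue_nonneg:
  assumes "dirichlet_eigenpairs D lam \<phi>"
  shows "lam j \<ge> 0"
proof -
  have phi: "\<phi> j \<in> H1_0 D" "neg_laplacian D (\<phi> j) (lam j *\<^sub>R \<phi> j)" "inner (\<phi> j) (\<phi> j) = 1"
    using assms by (auto simp: dirichlet_eigenpairs_def orthonormal_basis_def)
  obtain g \<psi> where g: "\<forall>b\<in>Basis. weak_partial D b (\<phi> j) (g b)"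
    and \<psi>: "\<forall>n::nat. \<psi> n \<in> test_functions D" "(\<lambda>n. to_L2 (\<psi> n)) \<longlonglongrightarrow> \<phi> j"
      "\<forall>b\<in>Basis. (\<lambda>n. to_L2 (partial_deriv b (\<psi> n))) \<longlonglongrightarrow> g b"
    using phi(1) by (rule H1_0_E)
  obtain g' h where g': "\<And>b. b \<in> Basis \<Longrightarrow> weak_partial D b (\<phi> j) (g' b)"
    "\<And>b. b \<in> Basis \<Longrightarrow> weak_partial D b (g' b) (h b)" and eig: "lam j *\<^sub>R \<phi> j = - (\<Sum>b\<in>Basis. h b)"
    using phi(2) unfolding neg_laplacian_def by (auto simp del: Ck_on.simps)
  \<comment> \<open>\<open>H1_0\<close> and \<open>neg_laplacian\<close> supply two weak gradients
    \<open>g\<close> and \<open>g'\<close> of the same function. Only \<open>g\<close> is a limit of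
    gradients of test functions, while only \<open>g'\<close> comes with second derivatives; the
    limit produces the mixed product, which uniqueness then turns into
    \<open>inner (g b) (g b)\<close>.\<close>
  have ip: "- inner (h b) (\<phi> j) = inner (g b) (g b)" if b: "b \<in> Basis" for b
  proof -
    have "inner (g' b) (to_L2 (partial_deriv b (\<psi> n))) = - inner (h b) (to_L2 (\<psi> n))" for n
      using g'(2)[OF b] \<psi>(1) by (auto simp: weak_partial_def)
    then have "(\<lambda>n. - inner (h b) (to_L2 (\<psi> n))) \<longlonglongrightarrow> inner (g' b) (g b)"
      using tendsto_inner[OF tendsto_const bspec[OF \<psi>(3) b], of "g' b"] by simp
    moreover have "(\<lambda>n. - inner (h b) (to_L2 (\<psi> n))) \<longlonglongrightarrow> - inner (h b) (\<phi> j)"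
      by (intro tendsto_intros \<psi>)
    ultimately have "- inner (h b) (\<phi> j) = inner (g' b) (g b)"
      by (rule LIMSEQ_unique[rotated])
    then show ?thesis
      using weak_partial_unique_limit[OF bspec[OF g b] g'(1)[OF b] b spec[OF \<psi>(1)] bspec[OF \<psi>(3) b]] by simp
  qed
  have "lam j = inner (lam j *\<^sub>R \<phi> j) (\<phi> j)"
    using phi(3) by simp
  also have "\<dots> = (\<Sum>b\<in>Basis. - inner (h b) (\<phi> j))"
    unfolding eig by (simp add: inner_sum_left sum_negf)
  also have "\<dots> = (\<Sum>b\<in>Basis. inner (g b) (g b))"
    by (intro sum.cong ip) auto
  finally show ?thesis
    by (simp add: sum_nonneg)
qed

section \<open>Sobolev embedding in dimension one and two\<close>

text \<open>Fundamental theorem of calculus, started at a point to the left of the support, where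
  \<open>h\<close> vanishes.\<close>

lemma line_bound:
  fixes h h' :: "real \<Rightarrow> real"
  assumes "\<And>t. (h has_real_derivative h' t) (at t)" "continuous_on UNIV h'"
    and "\<And>t. \<bar>t\<bar> > r \<Longrightarrow> h t = 0"
  shows "ennreal \<bar>h t\<bar> \<le> (\<integral>\<^sup>+s. ennreal \<bar>h' s\<bar> \<partial>lborel)"
proof -
  \<comment> \<open>To the left of \<open>t\<close> and beyond distance \<open>r\<close> from the
    origin; the absolute value covers negative \<open>r\<close>.\<close>
  define s where "s = - (\<bar>t\<bar> + \<bar>r\<bar> + 1)"
  have s: "s \<le> t" "h s = 0" using assms(3)[of s] by (auto simp: s_def)
  have bi: "has_bochner_integral lborel (\<lambda>x. indicator {s..t} x *\<^sub>R h' x) (h t - h s)"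
    using s(1) assms(1) assms(2)
    by (intro has_bochner_integral_FTC_Icc) 
       (auto intro: continuous_on_subset has_vector_derivative_at_within simp: has_real_derivative_iff_has_vector_derivative)
  have "ennreal \<bar>h t\<bar> = ennreal (norm (\<integral>x. indicator {s..t} x *\<^sub>R h' x \<partial>lborel))"
    using has_bochner_integral_integral_eq[OF bi] s(2) by simp
  also have "\<dots> \<le> (\<integral>\<^sup>+x. norm (indicator {s..t} x *\<^sub>R h' x) \<partial>lborel)"
    by (rule integral_norm_bound_ennreal) (use bi in \<open>auto simp: has_bochner_integral_iff\<close>)
  also have "\<dots> \<le> (\<integral>\<^sup>+s. ennreal \<bar>h' s\<bar> \<partial>lborel)"
    by (intro nn_integral_mono) (auto simp: indicator_def)
  finally show ?thesis .
qed

lemma partial_deriv_line: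
  assumes "\<psi> differentiable (at (x + t *\<^sub>R b))"
  shows "((\<lambda>t. \<psi> (x + t *\<^sub>R b)) has_real_derivative partial_deriv b \<psi> (x + t *\<^sub>R b)) (at t)"
proof -
  have "(\<psi> has_derivative frechet_derivative \<psi> (at (x + t *\<^sub>R b))) (at (x + t *\<^sub>R b))"
    using assms by (rule frechet_derivative_works[THEN iffD1])
  then have "((\<psi> \<circ> (\<lambda>t. x + t *\<^sub>R b)) has_derivative frechet_derivative \<psi> (at (x + t *\<^sub>R b)) \<circ> (\<lambda>s. s *\<^sub>R b)) (at t)"
    by (intro diff_chain_at) (auto intro!: derivative_eq_intros)
  moreover have "linear (frechet_derivative \<psi> (at (x + t *\<^sub>R b)))"
    using assms by (rule linear_frechet_derivative)
  ultimately show ?thesis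
    by (simp add: has_field_derivative_def partial_deriv_def o_def linear_cmul fun_eq_iff mult.commute[of _ "frechet_derivative _ _ _"])
qed

text \<open>\<open>lborel\<close> is the image of a product measure indexed by \<open>Basis\<close>,
  so one or two basis vectors reduce the integral to one or two line integrals.\<close>

lemma nn_integral_lborel_dim1:
  fixes h :: "'a::euclidean_space \<Rightarrow> ennreal"
  assumes [measurable]: "h \<in> borel_measurable borel" and B: "Basis = {p::'a}"
  shows "(\<integral>\<^sup>+x. h x \<partial>lborel) = (\<integral>\<^sup>+y. h (y *\<^sub>R p) \<partial>lborel)"
proof -
  interpret product_sigma_finite "\<lambda>b::'a. lborel :: real measure" ..
  have "(\<integral>\<^sup>+x. h x \<partial>lborel) = (\<integral>\<^sup>+f. h (f p *\<^sub>R p) \<partial>Pi\<^sub>M {p} (\<lambda>b::'a. lborel :: real measure))"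
    unfolding lborel_eq[where 'a='a] by (subst nn_integral_distr) (auto simp: B)
  also have "\<dots> = (\<integral>\<^sup>+y. h (y *\<^sub>R p) \<partial>lborel)"
    by (subst product_nn_integral_singleton[symmetric]) auto
  finally show ?thesis .
qed

lemma nn_integral_lborel_dim2:
  fixes h :: "'a::euclidean_space \<Rightarrow> ennreal"
  assumes [measurable]: "h \<in> borel_measurable borel" and B: "Basis = {p, q::'a}" "p \<noteq> q"
  shows "(\<integral>\<^sup>+x. h x \<partial>lborel) = (\<integral>\<^sup>+y. \<integral>\<^sup>+z. h (y *\<^sub>R p + z *\<^sub>R q) \<partial>lborel \<partial>lborel)"
proof -
  interpret product_sigma_finite "\<lambda>b::'a. lborel :: real measure" ..
  have "(\<integral>\<^sup>+x. h x \<partial>lborel)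
      = (\<integral>\<^sup>+f. h (f p *\<^sub>R p + f q *\<^sub>R q) \<partial>Pi\<^sub>M {p, q} (\<lambda>b::'a. lborel :: real measure))"
    unfolding lborel_eq[where 'a='a] using B(2) by (subst nn_integral_distr) (auto simp: B)
  also have "\<dots> = (\<integral>\<^sup>+z. h (fst z *\<^sub>R p + snd z *\<^sub>R q) \<partial>(lborel \<Otimes>\<^sub>M lborel))"
    using B(2) by (subst product_nn_integral_pair) auto
  also have "\<dots> = (\<integral>\<^sup>+y. \<integral>\<^sup>+z. h (y *\<^sub>R p + z *\<^sub>R q) \<partial>lborel \<partial>lborel)"
    by (subst lborel.nn_integral_fst[symmetric]) auto
  finally show ?thesis .
qed

text \<open>Integrating along a line in direction \<open>p\<close> bounds the function by a quantity
  \<open>A\<close> of the other coordinate alone, and along direction \<open>q\<close> by a quantity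
  \<open>C\<close> of the first coordinate alone. The product of the two bounds separates, so its
  double integral is a product of full integrals. The derivative \<open>w'\<close> is abstract so
  that \<open>w\<close> can be a power of a test function.\<close>

lemma gagliardo_nirenberg_dim2:
  fixes w :: "'a::euclidean_space \<Rightarrow> real"
  assumes B: "Basis = {p, q::'a}" "p \<noteq> q"
    and der: "\<And>b x t. b \<in> Basis \<Longrightarrow> ((\<lambda>t. w (x + t *\<^sub>R b)) has_real_derivative w' b (x + t *\<^sub>R b)) (at t)"
    and cont: "\<And>b. b \<in> Basis \<Longrightarrow> continuous_on UNIV (w' b)" "continuous_on UNIV w"
    and supp: "\<And>x. x \<notin> cball 0 r \<Longrightarrow> w x = 0"
  shows "(\<integral>\<^sup>+x. ennreal ((w x)\<^sup>2) \<partial>lborel)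
    \<le> (\<integral>\<^sup>+x. ennreal \<bar>w' p x\<bar> \<partial>lborel) * (\<integral>\<^sup>+x. ennreal \<bar>w' q x\<bar> \<partial>lborel)"
proof -
  have pq: "p \<in> Basis" "q \<in> Basis" using B by auto
  have [measurable]: "w' p \<in> borel_measurable borel" "w' q \<in> borel_measurable borel" "w \<in> borel_measurable borel"
    using cont pq by (auto intro: borel_measurable_continuous_onI)
  have inn: "inner p q = 0" "inner p p = 1" "inner q q = 1"
    using pq B(2) by (auto simp: inner_Basis)
  have supp': "w (y *\<^sub>R p + z *\<^sub>R q) = 0" if "\<bar>y\<bar> > r \<or> \<bar>z\<bar> > r" for y z
  proof (rule supp)
    have "\<bar>y\<bar> \<le> norm (y *\<^sub>R p + z *\<^sub>R q)" "\<bar>z\<bar> \<le> norm (y *\<^sub>R p + z *\<^sub>R q)"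
      using Basis_le_norm[OF pq(1), of "y *\<^sub>R p + z *\<^sub>R q"] Basis_le_norm[OF pq(2), of "y *\<^sub>R p + z *\<^sub>R q"] inn
      by (auto simp: inner_add_left inner_commute[of q p])
    with that show "y *\<^sub>R p + z *\<^sub>R q \<notin> cball 0 r" by auto
  qed
  define A where "A z = (\<integral>\<^sup>+y. ennreal \<bar>w' p (y *\<^sub>R p + z *\<^sub>R q)\<bar> \<partial>lborel)" for z
  define C where "C y = (\<integral>\<^sup>+z. ennreal \<bar>w' q (y *\<^sub>R p + z *\<^sub>R q)\<bar> \<partial>lborel)" for y
  have [measurable]: "A \<in> borel_measurable borel" "C \<in> borel_measurable borel"
    unfolding A_def C_def by measurable
  have "ennreal ((w (y *\<^sub>R p + z *\<^sub>R q))\<^sup>2) \<le> C y * A z" for y z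
  proof -
    have "ennreal \<bar>w (y *\<^sub>R p + z *\<^sub>R q)\<bar> \<le> A z"
      unfolding A_def
    proof (rule line_bound[where h="\<lambda>y. w (y *\<^sub>R p + z *\<^sub>R q)"])
      show "((\<lambda>y. w (y *\<^sub>R p + z *\<^sub>R q)) has_real_derivative w' p (t *\<^sub>R p + z *\<^sub>R q)) (at t)" for t
        using der[OF pq(1), of "z *\<^sub>R q" t] by (simp add: add.commute)
      show "continuous_on UNIV (\<lambda>a. w' p (a *\<^sub>R p + z *\<^sub>R q))"
        by (rule continuous_on_compose2[OF cont(1)[OF pq(1)]]) (auto intro!: continuous_intros)
    qed (use supp' in auto)
    moreover have "ennreal \<bar>w (y *\<^sub>R p + z *\<^sub>R q)\<bar> \<le> C y"
      unfolding C_def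
    proof (rule line_bound[where h="\<lambda>z. w (y *\<^sub>R p + z *\<^sub>R q)"])
      show "((\<lambda>z. w (y *\<^sub>R p + z *\<^sub>R q)) has_real_derivative w' q (y *\<^sub>R p + t *\<^sub>R q)) (at t)" for t
        using der[OF pq(2), of "y *\<^sub>R p" t] by (simp add: add.commute)
      show "continuous_on UNIV (\<lambda>a. w' q (y *\<^sub>R p + a *\<^sub>R q))"
        by (rule continuous_on_compose2[OF cont(1)[OF pq(2)]]) (auto intro!: continuous_intros)
    qed (use supp' in auto)
    ultimately have "ennreal \<bar>w (y *\<^sub>R p + z *\<^sub>R q)\<bar> * ennreal \<bar>w (y *\<^sub>R p + z *\<^sub>R q)\<bar> \<le> C y * A z"
      by (intro mult_mono) auto
    then show ?thesis
      by (simp add: ennreal_mult[symmetric] power2_eq_square abs_mult_self_eq)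
  qed
  then have "(\<integral>\<^sup>+y. \<integral>\<^sup>+z. ennreal ((w (y *\<^sub>R p + z *\<^sub>R q))\<^sup>2) \<partial>lborel \<partial>lborel)
     \<le> (\<integral>\<^sup>+y. \<integral>\<^sup>+z. C y * A z \<partial>lborel \<partial>lborel)"
    by (intro nn_integral_mono) auto
  also have "\<dots> = (\<integral>\<^sup>+y. C y \<partial>lborel) * (\<integral>\<^sup>+z. A z \<partial>lborel)"
    by (simp add: nn_integral_cmult nn_integral_multc)
  also have "(\<integral>\<^sup>+z. A z \<partial>lborel) = (\<integral>\<^sup>+x. ennreal \<bar>w' p x\<bar> \<partial>lborel)"
    unfolding A_def by (subst nn_integral_lborel_dim2[OF _ B], simp, subst lborel_pair.Fubini') auto
  also have "(\<integral>\<^sup>+y. C y \<partial>lborel) = (\<integral>\<^sup>+x. ennreal \<bar>w' q x\<bar> \<partial>lborel)"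
    unfolding C_def by (subst nn_integral_lborel_dim2[OF _ B]) auto
  finally show ?thesis
    by (subst nn_integral_lborel_dim2[OF _ B]) (auto simp: mult.commute)
qed

section \<open>Moments of functions in the Sobolev space\<close>

lemma sq_integrable_abs: "sq_integrable g \<Longrightarrow> sq_integrable (\<lambda>x. \<bar>g x\<bar>)"
  by (auto simp: sq_integrable_def)

text \<open>Cauchy-Schwarz for the classes of the absolute values, whose norms are those of the
  original functions.\<close>

lemma nn_integral_mult_le:
  assumes "sq_integrable g" "sq_integrable h"
  shows "(\<integral>\<^sup>+x. ennreal \<bar>g x * h x\<bar> \<partial>lborel) \<le> ennreal (norm (to_L2 g) * norm (to_L2 h))"
proof -
  let ?g = "to_L2 (\<lambda>x. \<bar>g x\<bar>)" and ?h = "to_L2 (\<lambda>x. \<bar>h x\<bar>)"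
  have n: "norm (to_L2 (\<lambda>x. \<bar>k x\<bar>)) = norm (to_L2 k)" if "sq_integrable k" for k :: "'a \<Rightarrow> real"
    by (rule power2_eq_imp_eq) (simp_all add: norm_to_L2 that sq_integrable_abs)
  have "(\<integral>\<^sup>+x. ennreal \<bar>g x * h x\<bar> \<partial>lborel) = ennreal (\<integral>x. \<bar>g x\<bar> * \<bar>h x\<bar> \<partial>lborel)"
    using sq_integrable_mult[OF assms[THEN sq_integrable_abs]]
    by (subst nn_integral_eq_integral[symmetric]) (auto simp: abs_mult)
  also have "(\<integral>x. \<bar>g x\<bar> * \<bar>h x\<bar> \<partial>lborel) = inner ?g ?h"
    using assms rep_to_L2[OF sq_integrable_abs[OF assms(2)]]
    by (subst inner_to_L2) (auto intro!: integral_cong_AE simp: sq_integrable_abs sq_integrable_def)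
  also have "ennreal (inner ?g ?h) \<le> ennreal (norm (to_L2 g) * norm (to_L2 h))"
    using norm_cauchy_schwarz[of ?g ?h] n assms by (intro ennreal_leI) simp
  finally show ?thesis .
qed

lemma test_function_power_sq_integrable:
  assumes "\<psi> \<in> test_functions D" "k \<ge> 1"
  shows "sq_integrable (\<lambda>x. \<psi> x ^ k)"
proof -
  obtain B r where B: "\<And>x. \<bar>\<psi> x\<bar> \<le> B" and r: "\<And>x. x \<notin> cball 0 r \<Longrightarrow> \<psi> x = 0" "r > 0"
    using test_function_bounded_support[OF assms(1)] by metis
  note [measurable] = test_function_measurable[OF assms(1)]
  have "integrable lborel (\<lambda>x. (\<psi> x ^ k)\<^sup>2)"
  proof (rule bounded_support_integrable[where B="(B^k)\<^sup>2" and r=r])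
    show "\<bar>(\<psi> x ^ k)\<^sup>2\<bar> \<le> (B^k)\<^sup>2" for x
      using power_mono[OF B[of x] abs_ge_zero, of "k * 2"] by (simp add: power_mult power_even_abs power_abs[symmetric])
  qed (use r assms(2) in auto)
  then show ?thesis by (simp add: sq_integrable_def)
qed

text \<open>The moment of order \<open>2 * k\<close>, written as the square of a \<open>k\<close>-th
  power because it is then the squared \<open>L2\<close> norm of that power, the form in which
  Cauchy-Schwarz returns it. Values in \<open>[0, \<infinity>]\<close> suit Fatou's lemma.\<close>

definition even_moment :: "nat \<Rightarrow> ('a::euclidean_space \<Rightarrow> real) \<Rightarrow> ennreal" where
  "even_moment k g = (\<integral>\<^sup>+x. ennreal ((g x ^ k)\<^sup>2) \<partial>lborel)"

lemma even_moment_norm: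
  assumes "sq_integrable (\<lambda>x. g x ^ k)"
  shows "ennreal ((norm (to_L2 (\<lambda>x. g x ^ k)))\<^sup>2) = even_moment k g"
  unfolding norm_to_L2[OF assms] even_moment_def using assms
  by (subst nn_integral_eq_integral) (auto simp: sq_integrable_def)

text \<open>In dimension two this is the Gagliardo-Nirenberg inequality for the power \<open>\<psi>\<^bsup>k+1\<^esup>\<close>; in dimension
  one the supremum of \<open>\<psi>\<^sup>2\<close> is bounded.\<close>

lemma even_moment_step:
  fixes \<psi> :: "'a::euclidean_space \<Rightarrow> real"
  assumes dim: "DIM('a) = 1 \<or> DIM('a) = 2" and \<psi>: "\<psi> \<in> test_functions D"
    and R: "norm (to_L2 \<psi>) \<le> R" "\<And>b. b \<in> Basis \<Longrightarrow> norm (to_L2 (partial_deriv b \<psi>)) \<le> R"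
    and k: "k \<ge> 1"
  shows "even_moment (Suc k) \<psi> \<le> ennreal (2 * (real (Suc k) * R)\<^sup>2) * even_moment k \<psi>"
proof -
  have R0: "R \<ge> 0" using R(1) norm_ge_zero order.trans by blast
  have diff: "\<psi> differentiable (at x)" for x
    using \<psi> by (auto simp: test_functions_def intro: smooth_on_differentiable)
  have cont: "continuous_on UNIV \<psi>" "\<And>b. b \<in> Basis \<Longrightarrow> continuous_on UNIV (partial_deriv b \<psi>)"
    using \<psi> by (auto simp: test_functions_def intro!: smooth_on_continuous smooth_on_partial_deriv)
  obtain B r where B: "\<And>x. \<bar>\<psi> x\<bar> \<le> B" and r: "\<And>x. x \<notin> cball 0 r \<Longrightarrow> \<psi> x = 0" "r > 0"
    using test_function_bounded_support[OF \<psi>] by metis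
  have [measurable]: "\<psi> \<in> borel_measurable borel"
    by (rule test_function_measurable[OF \<psi>])
  have sqd: "sq_integrable (partial_deriv b \<psi>)" if "b \<in> Basis" for b
    by (rule test_function_sq_integrable[OF test_functions_partial_deriv[OF \<psi> that]])
  have der: "((\<lambda>t. \<psi> (x + t *\<^sub>R b) ^ j) has_real_derivative
      real j * \<psi> (x + t *\<^sub>R b) ^ (j - 1) * partial_deriv b \<psi> (x + t *\<^sub>R b)) (at t)" for x t b j
    by (rule derivative_eq_intros partial_deriv_line diff refl)+ simp
  show ?thesis
    using dim
  proof
    assume "DIM('a) = 1"
    then obtain p where p: "Basis = {p::'a}" by (auto simp: card_Suc_eq numeral_2_eq_2 elim!: card_1_singletonE)
    then have pB: "p \<in> Basis" by auto
    have pp: "inner p p = 1" using pB by (simp add: inner_Basis)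
    \<comment> \<open>The derivative of the square is twice the product of function and derivative;
      Cauchy-Schwarz bounds its integral by \<open>2 * R * R\<close>.\<close>
    have sup: "ennreal ((\<psi> x)\<^sup>2) \<le> ennreal (2 * R\<^sup>2)" for x
    proof -
      have x: "x = inner x p *\<^sub>R p"
        using euclidean_representation[of x] by (simp add: p)
      have "ennreal \<bar>\<psi> (inner x p *\<^sub>R p) ^ 2\<bar>
          \<le> (\<integral>\<^sup>+s. ennreal \<bar>real 2 * \<psi> (s *\<^sub>R p) ^ (2 - 1) * partial_deriv p \<psi> (s *\<^sub>R p)\<bar> \<partial>lborel)"
      proof (rule line_bound[where h="\<lambda>t. \<psi> (t *\<^sub>R p) ^ 2" and r=r])
        show "((\<lambda>t. \<psi> (t *\<^sub>R p) ^ 2) has_real_derivative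
            real 2 * \<psi> (t *\<^sub>R p) ^ (2 - 1) * partial_deriv p \<psi> (t *\<^sub>R p)) (at t)" for t
          using der[of 0 p 2 t] by simp
        show "continuous_on UNIV (\<lambda>s. real 2 * \<psi> (s *\<^sub>R p) ^ (2 - 1) * partial_deriv p \<psi> (s *\<^sub>R p))"
          by (intro continuous_intros continuous_on_compose2[OF cont(1)] continuous_on_compose2[OF cont(2)[OF pB]]) auto
        show "\<psi> (t *\<^sub>R p) ^ 2 = 0" if "\<bar>t\<bar> > r" for t
          using that r(1)[of "t *\<^sub>R p"] pB by simp
      qed
      also have "\<dots> = (\<integral>\<^sup>+x. ennreal \<bar>2 * \<psi> x * partial_deriv p \<psi> x\<bar> \<partial>lborel)"
        using sqd[OF pB] by (subst nn_integral_lborel_dim1[OF _ p]) (auto simp: sq_integrable_def)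
      also have "\<dots> = 2 * (\<integral>\<^sup>+x. ennreal \<bar>\<psi> x * partial_deriv p \<psi> x\<bar> \<partial>lborel)"
        using sqd[OF pB]
        by (subst nn_integral_cmult[symmetric]) (auto simp: sq_integrable_def abs_mult mult.assoc ennreal_mult)
      also have "\<dots> \<le> 2 * ennreal (R * R)"
        using R(1) R(2)[OF pB] R0
        by (intro mult_left_mono order.trans[OF nn_integral_mult_le[OF test_function_sq_integrable[OF \<psi>] sqd[OF pB]]]
              ennreal_leI mult_mono) auto
      finally show ?thesis
        unfolding x[symmetric] by (simp add: ennreal_mult power2_eq_square)
    qed
    have "even_moment (Suc k) \<psi> = (\<integral>\<^sup>+x. ennreal ((\<psi> x)\<^sup>2) * ennreal ((\<psi> x ^ k)\<^sup>2) \<partial>lborel)"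
      unfolding even_moment_def by (simp add: ennreal_mult[symmetric] power_mult_distrib)
    also have "\<dots> \<le> (\<integral>\<^sup>+x. ennreal (2 * R\<^sup>2) * ennreal ((\<psi> x ^ k)\<^sup>2) \<partial>lborel)"
      by (intro nn_integral_mono mult_right_mono sup) auto
    also have "\<dots> = ennreal (2 * R\<^sup>2) * even_moment k \<psi>"
      unfolding even_moment_def by (intro nn_integral_cmult) auto
    \<comment> \<open>A larger constant than obtained, so that both dimensions share one
      recursion.\<close>
    also have "\<dots> \<le> ennreal (2 * (real (Suc k) * R)\<^sup>2) * even_moment k \<psi>"
      using R0 by (intro mult_right_mono ennreal_leI mult_left_mono power_mono mult_right_mono[of 1 "real (Suc k)" R, unfolded mult_1_left]) auto
    finally show ?thesis .
  next
    assume "DIM('a) = 2"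
    then obtain p q where B2: "Basis = {p, q::'a}" "p \<noteq> q"
      by (auto simp: card_2_iff)
    then have pq: "p \<in> Basis" "q \<in> Basis" by auto
    let ?w' = "\<lambda>b x. real (Suc k) * \<psi> x ^ k * partial_deriv b \<psi> x"
    let ?n = "norm (to_L2 (\<lambda>x. \<psi> x ^ k))"
    note sqk = test_function_power_sq_integrable[OF \<psi> k]
    have "even_moment (Suc k) \<psi> \<le> (\<integral>\<^sup>+x. ennreal \<bar>?w' p x\<bar> \<partial>lborel) * (\<integral>\<^sup>+x. ennreal \<bar>?w' q x\<bar> \<partial>lborel)"
      unfolding even_moment_def
    proof (rule gagliardo_nirenberg_dim2[OF B2])
      show "((\<lambda>t. \<psi> (x + t *\<^sub>R b) ^ Suc k) has_real_derivative ?w' b (x + t *\<^sub>R b)) (at t)" for b x t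
        using der[of x b "Suc k" t] by simp
    qed (use r in \<open>auto intro!: continuous_intros cont\<close>)
    \<comment> \<open>Each directional derivative of the power contributes one factor
      \<open>norm (to_L2 (\<lambda>x. \<psi> x ^ k))\<close>; the two directions together give back
      the lower moment.\<close>
    also have "\<dots> \<le> ennreal (real (Suc k) * (?n * R)) * ennreal (real (Suc k) * (?n * R))"
    proof -
      have "(\<integral>\<^sup>+x. ennreal \<bar>?w' b x\<bar> \<partial>lborel) \<le> ennreal (real (Suc k) * (?n * R))" if b: "b \<in> Basis" for b
      proof -
        have "(\<integral>\<^sup>+x. ennreal \<bar>?w' b x\<bar> \<partial>lborel)
            = ennreal (real (Suc k)) * (\<integral>\<^sup>+x. ennreal \<bar>\<psi> x ^ k * partial_deriv b \<psi> x\<bar> \<partial>lborel)"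
          using sqd[OF b]
          by (subst nn_integral_cmult[symmetric]) (auto simp: sq_integrable_def abs_mult mult.assoc ennreal_mult)
        also have "\<dots> \<le> ennreal (real (Suc k)) * ennreal (?n * R)"
          using R(2)[OF b] R0
          by (intro mult_left_mono order.trans[OF nn_integral_mult_le[OF sqk sqd[OF b]]]
              ennreal_leI mult_mono) auto
        finally show ?thesis using R0 by (simp add: ennreal_mult)
      qed
      from this[OF pq(1)] this[OF pq(2)] show ?thesis by (intro mult_mono) auto
    qed
    also have "\<dots> = ennreal ((real (Suc k) * R)\<^sup>2) * even_moment k \<psi>"
      unfolding even_moment_norm[OF sqk, symmetric] using R0
      by (simp add: ennreal_mult[symmetric] power2_eq_square mult_ac)
    also have "\<dots> \<le> ennreal (2 * (real (Suc k) * R)\<^sup>2) * even_moment k \<psi>"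
      by (intro mult_right_mono ennreal_leI) auto
    finally show ?thesis .
  qed
qed

text \<open>The bound has to be uniform over all test functions of a given size, since it will be
  passed to a limit. The induction starts at the first power, where the moment is the squared norm;
  the moment for \<open>k = 0\<close> is the infinite measure of the whole space.\<close>

lemma even_moment_test_function_bound:
  assumes "DIM('a::euclidean_space) = 1 \<or> DIM('a) = 2" "R \<ge> 0"
  shows "\<exists>K. \<forall>(\<psi>::'a \<Rightarrow> real)\<in>test_functions D. norm (to_L2 \<psi>) \<le> R \<longrightarrow>
    (\<forall>b\<in>Basis. norm (to_L2 (partial_deriv b \<psi>)) \<le> R) \<longrightarrow> even_moment (Suc k) \<psi> \<le> ennreal K"
proof (induction k)
  case 0
  have "even_moment (Suc 0) \<psi> \<le> ennreal (R\<^sup>2)" if "\<psi> \<in> test_functions D" "norm (to_L2 \<psi>) \<le> R" for \<psi> :: "'a \<Rightarrow> real"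
  proof -
    have "ennreal ((norm (to_L2 \<psi>))\<^sup>2) = even_moment (Suc 0) \<psi>"
      using even_moment_norm[of \<psi> "Suc 0"] test_function_sq_integrable[OF that(1)] by simp
    moreover have "ennreal ((norm (to_L2 \<psi>))\<^sup>2) \<le> ennreal (R\<^sup>2)"
      using that(2) by (intro ennreal_leI power_mono) auto
    ultimately show ?thesis by simp
  qed
  then show ?case by blast
next
  case (Suc k)
  then obtain K where K: "\<forall>(\<psi>::'a \<Rightarrow> real)\<in>test_functions D. norm (to_L2 \<psi>) \<le> R \<longrightarrow>
    (\<forall>b\<in>Basis. norm (to_L2 (partial_deriv b \<psi>)) \<le> R) \<longrightarrow> even_moment (Suc k) \<psi> \<le> ennreal K"
    by blast
  show ?case
  proof (intro exI[of _ "2 * (real (Suc (Suc k)) * R)\<^sup>2 * K"] ballI impI)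
    fix \<psi> :: "'a \<Rightarrow> real"
    assume \<psi>: "\<psi> \<in> test_functions D" "norm (to_L2 \<psi>) \<le> R" "\<forall>b\<in>Basis. norm (to_L2 (partial_deriv b \<psi>)) \<le> R"
    have "even_moment (Suc (Suc k)) \<psi> \<le> ennreal (2 * (real (Suc (Suc k)) * R)\<^sup>2) * even_moment (Suc k) \<psi>"
      by (rule even_moment_step[OF assms(1)]) (use \<psi> in auto)
    also have "\<dots> \<le> ennreal (2 * (real (Suc (Suc k)) * R)\<^sup>2) * ennreal K"
      using K \<psi> by (intro mult_left_mono) auto
    also have "\<dots> = ennreal (2 * (real (Suc (Suc k)) * R)\<^sup>2 * K)"
      by (rule ennreal_mult'[symmetric]) simp
    finally show "even_moment (Suc (Suc k)) \<psi> \<le> ennreal (2 * (real (Suc (Suc k)) * R)\<^sup>2 * K)" .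
  qed
qed

text \<open>Convergence in \<open>L2\<close> is convergence to zero in \<open>L1\<close> of the
  squared differences, and a subsequence of those vanishes almost everywhere.\<close>

lemma L2_convergent_AE_subseq:
  assumes "(\<lambda>n. to_L2 (g n)) \<longlonglongrightarrow> u" "\<And>n::nat. sq_integrable (g n)"
  obtains s :: "nat \<Rightarrow> nat" where "strict_mono s" "AE x in lborel. (\<lambda>n. g (s n) x) \<longlonglongrightarrow> rep_L2 u x"
proof -
  define h where "h n x = (g n x - rep_L2 u x)\<^sup>2" for n x
  have sq: "sq_integrable (\<lambda>x. g n x - rep_L2 u x)" for n
    by (intro sq_integrable_diff assms sq_integrable_rep)
  have hint: "integrable lborel (h n)" for n
    using sq[of n] by (simp add: sq_integrable_def h_def[abs_def])
  have "(\<integral>x. norm (h n x) \<partial>lborel) = (norm (to_L2 (g n) - u))\<^sup>2" for n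
  proof -
    have "AE x in lborel. (rep_L2 (to_L2 (g n) - u) x)\<^sup>2 = h n x"
      using rep_diff[of "to_L2 (g n)" u] rep_to_L2[OF assms(2)[of n]]
      by eventually_elim (simp add: h_def)
    then have "(\<integral>x. (rep_L2 (to_L2 (g n) - u) x)\<^sup>2 \<partial>lborel) = (\<integral>x. h n x \<partial>lborel)"
      using hint[of n] by (intro integral_cong_AE) auto
    then show ?thesis
      by (simp add: norm_L2_rep h_def)
  qed
  moreover have "(\<lambda>n. (norm (to_L2 (g n) - u))\<^sup>2) \<longlonglongrightarrow> 0"
    using tendsto_power[OF tendsto_norm_zero[OF LIM_zero[OF assms(1)]], of 2] by simp
  ultimately have "(\<lambda>n. \<integral>x. norm (h n x) \<partial>lborel) \<longlonglongrightarrow> 0" by simp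
  from tendsto_L1_AE_subseq[OF hint this] obtain s :: "nat \<Rightarrow> nat"
    where s: "strict_mono s" "AE x in lborel. (\<lambda>n. h (s n) x) \<longlonglongrightarrow> 0" by blast
  have "AE x in lborel. (\<lambda>n. g (s n) x) \<longlonglongrightarrow> rep_L2 u x"
    using s(2)
  proof eventually_elim
    case (elim x)
    then have "(\<lambda>n. \<bar>g (s n) x - rep_L2 u x\<bar>) \<longlonglongrightarrow> 0"
      using tendsto_real_sqrt[OF elim] by (simp add: h_def)
    then show ?case by (simp add: tendsto_rabs_zero_iff LIM_zero_iff)
  qed
  with s(1) show ?thesis by (rule that)
qed

text \<open>The approximating test functions converge together with their gradients, hence satisfy
  the uniform moment bound for one common \<open>R\<close>; Fatou's lemma along an almost everywhere
  convergent subsequence carries it over to the limit.\<close>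

lemma H1_0_even_moment_finite:
  fixes u :: "'a::euclidean_space L2"
  assumes dim: "DIM('a) = 1 \<or> DIM('a) = 2" and "u \<in> H1_0 D"
  shows "even_moment (Suc k) (rep_L2 u) < \<infinity>"
proof -
  obtain g \<psi> where g: "\<forall>b\<in>Basis. weak_partial D b u (g b)"
    and \<psi>: "\<forall>n::nat. \<psi> n \<in> test_functions D" "(\<lambda>n. to_L2 (\<psi> n)) \<longlonglongrightarrow> u"
      "\<forall>b\<in>Basis. (\<lambda>n. to_L2 (partial_deriv b (\<psi> n))) \<longlonglongrightarrow> g b"
    using assms(2) by (rule H1_0_E)
  have "Bseq (\<lambda>n. to_L2 (\<psi> n))" "\<And>b. b \<in> Basis \<Longrightarrow> Bseq (\<lambda>n. to_L2 (partial_deriv b (\<psi> n)))"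
    using \<psi> by (auto intro!: convergent_imp_Bseq convergentI)
  then obtain R0 where R0: "R0 > 0" "\<And>n. norm (to_L2 (\<psi> n)) \<le> R0"
    and B: "\<forall>b\<in>Basis. \<exists>K. \<forall>n. norm (to_L2 (partial_deriv b (\<psi> n))) \<le> K"
    unfolding Bseq_def by blast
  from bchoice[OF B] obtain Rb where
    Rb: "\<And>b n. b \<in> Basis \<Longrightarrow> norm (to_L2 (partial_deriv b (\<psi> n))) \<le> Rb b"
    by blast
  \<comment> \<open>One radius for the functions and for all their partial derivatives.\<close>
  define R where "R = R0 + (\<Sum>b\<in>Basis. \<bar>Rb b\<bar>)"
  have R: "R \<ge> 0" "\<And>n. norm (to_L2 (\<psi> n)) \<le> R"
    using R0 by (auto simp: R_def sum_nonneg intro: add_increasing2 less_imp_le)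
  have "\<bar>Rb b\<bar> \<le> R" if "b \<in> Basis" for b
    using member_le_sum[OF that, of "\<lambda>b. \<bar>Rb b\<bar>"] R0(1) by (simp add: R_def)
  then have R': "norm (to_L2 (partial_deriv b (\<psi> n))) \<le> R" if "b \<in> Basis" for b n
    using order.trans[OF Rb[OF that, of n] order.trans[OF abs_ge_self]] that by simp
  from even_moment_test_function_bound[OF dim R(1), of D k] obtain K
    where K: "\<forall>\<psi>\<in>test_functions D. norm (to_L2 \<psi>) \<le> R \<longrightarrow>
      (\<forall>b\<in>Basis. norm (to_L2 (partial_deriv b \<psi>)) \<le> R) \<longrightarrow> even_moment (Suc k) \<psi> \<le> ennreal K" ..
  have K: "even_moment (Suc k) (\<psi> n) \<le> ennreal K" for n
    using bspec[OF K spec[OF \<psi>(1), of n]] R(2) R' by simp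
  obtain s :: "nat \<Rightarrow> nat" where s: "strict_mono s" "AE x in lborel. (\<lambda>n. \<psi> (s n) x) \<longlonglongrightarrow> rep_L2 u x"
    by (rule L2_convergent_AE_subseq[OF \<psi>(2)]) (use \<psi>(1) test_function_sq_integrable in auto)
  have [measurable]: "\<psi> n \<in> borel_measurable borel" for n
    using \<psi>(1) test_function_measurable by auto
  have "even_moment (Suc k) (rep_L2 u)
      = (\<integral>\<^sup>+x. liminf (\<lambda>n. ennreal ((\<psi> (s n) x ^ Suc k)\<^sup>2)) \<partial>lborel)"
    unfolding even_moment_def using s(2)
  proof (intro nn_integral_cong_AE, eventually_elim)
    case (elim x)
    have "(\<lambda>n. ennreal ((\<psi> (s n) x ^ Suc k)\<^sup>2)) \<longlonglongrightarrow> ennreal ((rep_L2 u x ^ Suc k)\<^sup>2)"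
      by (intro tendsto_ennrealI tendsto_power elim)
    then show ?case by (rule lim_imp_Liminf[OF sequentially_bot, symmetric])
  qed
  also have "\<dots> \<le> liminf (\<lambda>n. even_moment (Suc k) (\<psi> (s n)))"
    unfolding even_moment_def by (rule nn_integral_liminf) simp
  also have "\<dots> \<le> ennreal K"
    by (rule Liminf_le[OF sequentially_bot]) (intro always_eventually allI K)
  finally show ?thesis by (simp add: le_less_trans)
qed

section \<open>The nonlinearity on the Galerkin space\<close>

text \<open>Membership in every Lebesgue space of finite exponent over \<open>D\<close>. The
  indicator admits constants when \<open>D\<close> is bounded, which makes the class stable under
  sums and pointwise domination.\<close>

definition all_moments :: "'a::euclidean_space set \<Rightarrow> ('a \<Rightarrow> real) \<Rightarrow> bool" where
  "all_moments D g \<longleftrightarrow> g \<in> borel_measurable borel \<and>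
     (\<forall>k. integrable lborel (\<lambda>x. indicator D x * \<bar>g x\<bar> ^ k))"

lemma power_add_le:
  fixes a b :: real
  assumes "a \<ge> 0" "b \<ge> 0"
  shows "(a + b) ^ k \<le> 2 ^ k * (a ^ k + b ^ k)"
proof -
  have "(a + b) ^ k \<le> (2 * max a b) ^ k"
    using assms by (intro power_mono) auto
  also have "\<dots> = 2 ^ k * (max a b) ^ k" by (simp add: power_mult_distrib)
  also have "\<dots> \<le> 2 ^ k * (a ^ k + b ^ k)"
    using assms by (intro mult_left_mono) (auto simp: max_def)
  finally show ?thesis .
qed

lemma all_moments_dominated:
  assumes "all_moments D h" "g \<in> borel_measurable borel" "D \<in> sets borel"
    and "\<And>x. x \<in> D \<Longrightarrow> \<bar>g x\<bar> \<le> c * \<bar>h x\<bar>"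
  shows "all_moments D g"
  unfolding all_moments_def
proof (intro conjI allI assms(2))
  fix k
  note [measurable] = assms(2,3)
  show "integrable lborel (\<lambda>x. indicator D x * \<bar>g x\<bar> ^ k)"
  proof (rule Bochner_Integration.integrable_bound)
    show "integrable lborel (\<lambda>x. \<bar>c\<bar> ^ k * (indicator D x * \<bar>h x\<bar> ^ k))"
      using assms(1) by (intro integrable_mult_right) (auto simp: all_moments_def)
    have "\<bar>g x\<bar> ^ k \<le> \<bar>c\<bar> ^ k * \<bar>h x\<bar> ^ k" if "x \<in> D" for x
    proof -
      have "\<bar>g x\<bar> \<le> \<bar>c\<bar> * \<bar>h x\<bar>"
        using order.trans[OF assms(4)[OF that] mult_right_mono[OF abs_ge_self]] by simp
      then show ?thesis using power_mono[of "\<bar>g x\<bar>" "\<bar>c\<bar> * \<bar>h x\<bar>" k] by (simp add: power_mult_distrib)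
    qed
    then show "AE x in lborel. norm (indicator D x * \<bar>g x\<bar> ^ k) \<le> norm (\<bar>c\<bar> ^ k * (indicator D x * \<bar>h x\<bar> ^ k))"
      by (auto simp: indicator_def abs_mult power_abs[symmetric])
  qed measurable
qed

lemma all_moments_add:
  assumes "all_moments D g" "all_moments D h" "D \<in> sets borel"
  shows "all_moments D (\<lambda>x. \<bar>g x\<bar> + \<bar>h x\<bar>)"
  unfolding all_moments_def
proof (intro conjI allI)
  have m [measurable]: "g \<in> borel_measurable borel" "h \<in> borel_measurable borel" "D \<in> sets borel"
    using assms by (auto simp: all_moments_def)
  show "(\<lambda>x. \<bar>g x\<bar> + \<bar>h x\<bar>) \<in> borel_measurable borel" by measurable
  fix k
  show "integrable lborel (\<lambda>x. indicator D x * \<bar>\<bar>g x\<bar> + \<bar>h x\<bar>\<bar> ^ k)"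
  proof (rule Bochner_Integration.integrable_bound)
    show "integrable lborel (\<lambda>x. 2 ^ k * (indicator D x * \<bar>g x\<bar> ^ k + indicator D x * \<bar>h x\<bar> ^ k))"
      using assms by (intro integrable_mult_right Bochner_Integration.integrable_add) (auto simp: all_moments_def)
    show "AE x in lborel. norm (indicator D x * \<bar>\<bar>g x\<bar> + \<bar>h x\<bar>\<bar> ^ k)
        \<le> norm (2 ^ k * (indicator D x * \<bar>g x\<bar> ^ k + indicator D x * \<bar>h x\<bar> ^ k))"
      using power_add_le[of "\<bar>g _\<bar>" "\<bar>h _\<bar>" k] by (auto simp: indicator_def)
  qed measurable
qed

lemma all_moments_const:
  assumes "bounded D" "D \<in> sets borel"
  shows "all_moments D (\<lambda>x. c)"
  using assms emeasure_bounded_finite[OF assms(1)]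
  by (auto simp: all_moments_def intro!: integrable_mult_left integrable_real_indicator)

lemma all_moments_sum:
  assumes "finite I" "\<And>i. i \<in> I \<Longrightarrow> all_moments D (g i)" "bounded D" "D \<in> sets borel"
  shows "all_moments D (\<lambda>x. \<Sum>i\<in>I. \<bar>g i x\<bar>)"
  using assms(1,2)
proof (induction I rule: finite_induct)
  case empty
  show ?case using all_moments_const[OF assms(3,4), of 0] by simp
next
  case (insert i I)
  have "all_moments D (g i)" "all_moments D (\<lambda>x. \<Sum>i\<in>I. \<bar>g i x\<bar>)"
    using insert by simp_all
  then have "all_moments D (\<lambda>x. \<bar>g i x\<bar> + \<bar>\<Sum>i\<in>I. \<bar>g i x\<bar>\<bar>)"
    by (rule all_moments_add) fact
  then show ?case using insert.hyps by (simp add: sum_nonneg abs_of_nonneg)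
qed

lemma all_moments_power_sq_integrable:
  assumes "all_moments D g" "D \<in> sets borel"
  shows "sq_integrable (\<lambda>x. indicator D x * \<bar>g x\<bar> ^ k)"
proof -
  have "(indicator D x * \<bar>g x\<bar> ^ k)\<^sup>2 = indicator D x * \<bar>g x\<bar> ^ (k * 2)" for x
    by (simp add: power_mult_distrib power_mult indicator_def)
  then show ?thesis using assms by (auto simp: sq_integrable_def all_moments_def)
qed

lemma H1_0_all_moments:
  fixes u :: "'a::euclidean_space L2"
  assumes "DIM('a) = 1 \<or> DIM('a) = 2" "u \<in> H1_0 D" "bounded D" and [measurable]: "D \<in> sets borel"
  shows "all_moments D (rep_L2 u)"
  unfolding all_moments_def
proof (intro conjI allI)
  fix k
  have "integrable lborel (\<lambda>x. (rep_L2 u x ^ Suc k)\<^sup>2)"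
    using H1_0_even_moment_finite[OF assms(1,2), of k]
    by (intro integrableI_bounded) (simp_all add: even_moment_def)
  moreover have "integrable lborel (\<lambda>x. indicator D x :: real)"
    using emeasure_bounded_finite[OF assms(3)] by (intro integrable_real_indicator) auto
  ultimately have int: "integrable lborel (\<lambda>x. indicator D x + (rep_L2 u x ^ Suc k)\<^sup>2)"
    by (rule Bochner_Integration.integrable_add[rotated])
  show "integrable lborel (\<lambda>x. indicator D x * \<bar>rep_L2 u x\<bar> ^ k)"
  proof (rule Bochner_Integration.integrable_bound[OF int])
    \<comment> \<open>Odd exponents are covered too: below 1 the power is at most 1, above 1 the
      exponent may be raised to \<open>2 * (k + 1)\<close>.\<close>
    have "a ^ k \<le> 1 + (a ^ Suc k)\<^sup>2" if "a \<ge> 0" for a :: real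
    proof (cases "a \<le> 1")
      case True
      then show ?thesis using power_le_one[OF that, of k] by (simp add: add_increasing2)
    next
      case False
      then have "a ^ k \<le> a ^ (Suc k * 2)" by (intro power_increasing) auto
      then show ?thesis by (simp only: power_mult)
    qed
    from this[of "\<bar>rep_L2 u _\<bar>"]
    show "AE x in lborel. norm (indicator D x * \<bar>rep_L2 u x\<bar> ^ k) \<le> norm (indicator D x + (rep_L2 u x ^ Suc k)\<^sup>2)"
      by (auto simp: indicator_def power_abs[symmetric] abs_of_nonneg simp del: power_Suc)
  qed measurable
qed simp

text \<open>The growth bound on the derivative is integrated by the mean value theorem. With the
  base \<open>1 + \<bar>y\<bar> \<ge> 1\<close>, the real exponent may be rounded up to a natural
  number.\<close>

lemma nonlinearity_growth:
  assumes "nonlinearity_A1 f C0 C1 C2 C3 \<gamma>"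
  obtains K p where "\<And>y. \<bar>f y\<bar> \<le> K * (1 + \<bar>y\<bar>) ^ p" "K \<ge> 0"
proof -
  define m where "m = nat \<lceil>\<gamma>\<rceil>"
  have C2: "C2 > 0" and g2: "\<gamma> \<ge> 2" and df: "\<And>y. f differentiable (at y)"
    and bd: "\<And>y. \<bar>deriv f y\<bar> \<le> C2 * (1 + abs_power y (\<gamma> - 1))"
    using assms by (auto simp: nonlinearity_A1_def)
  have bd2: "\<bar>deriv f y\<bar> \<le> 2 * C2 * (1 + \<bar>y\<bar>) ^ m" for y
  proof -
    have "abs_power y (\<gamma> - 1) \<le> (1 + \<bar>y\<bar>) powr (\<gamma> - 1)"
      using g2 by (auto simp: abs_power_def intro: powr_mono2)
    also have "\<dots> \<le> (1 + \<bar>y\<bar>) powr real m"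
      using g2 by (intro powr_mono) (simp_all add: m_def, linarith)
    also have "\<dots> = (1 + \<bar>y\<bar>) ^ m" by (intro powr_realpow) auto
    finally have "abs_power y (\<gamma> - 1) \<le> (1 + \<bar>y\<bar>) ^ m" .
    moreover have "1 \<le> (1 + \<bar>y\<bar>) ^ m" by (rule one_le_power) simp
    ultimately have "1 + abs_power y (\<gamma> - 1) \<le> 2 * (1 + \<bar>y\<bar>) ^ m" by linarith
    then have "C2 * (1 + abs_power y (\<gamma> - 1)) \<le> C2 * (2 * (1 + \<bar>y\<bar>) ^ m)"
      by (rule mult_left_mono) (use C2 in simp)
    from order.trans[OF bd this] show ?thesis by (simp only: mult_ac)
  qed
  have mvt: "\<bar>f y - f 0\<bar> \<le> 2 * C2 * (1 + \<bar>y\<bar>) ^ m * \<bar>y\<bar>" for y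
  proof -
    have "norm (f y - f 0) \<le> (2 * C2 * (1 + \<bar>y\<bar>) ^ m) * norm (y - 0)"
    proof (rule field_differentiable_bound[where S="cball 0 \<bar>y\<bar>" and f=f and f'="deriv f" and x=y and y=0 and B="2 * C2 * (1 + \<bar>y\<bar>) ^ m"])
      show "(f has_field_derivative deriv f z) (at z within cball 0 \<bar>y\<bar>)" for z
        by (rule has_field_derivative_at_within) (simp add: DERIV_deriv_iff_real_differentiable df)
      show "norm (deriv f z) \<le> 2 * C2 * (1 + \<bar>y\<bar>) ^ m" if "z \<in> cball 0 \<bar>y\<bar>" for z
      proof (rule order.trans[OF _ mult_left_mono[OF power_mono]])
        show "norm (deriv f z) \<le> 2 * C2 * (1 + \<bar>z\<bar>) ^ m" using bd2[of z] by simp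
        show "1 + \<bar>z\<bar> \<le> 1 + \<bar>y\<bar>" using that by simp
      qed (use C2 in simp_all)
    qed simp_all
    then show ?thesis by simp
  qed
  show ?thesis
  \<comment> \<open>The extra power absorbs the factor \<open>\<bar>y\<bar>\<close> from the mean
    value theorem.\<close>
  proof (rule that[of "\<bar>f 0\<bar> + 2 * C2" "Suc m"])
    fix y :: real
    let ?z = "1 + \<bar>y\<bar>"
    have z: "1 \<le> ?z ^ Suc m" by (rule one_le_power) simp
    have "\<bar>f y\<bar> \<le> \<bar>f 0\<bar> + 2 * C2 * ?z ^ m * \<bar>y\<bar>" using mvt[of y] by linarith
    also have "\<bar>f 0\<bar> \<le> \<bar>f 0\<bar> * ?z ^ Suc m"
      using mult_left_mono[OF z, of "\<bar>f 0\<bar>"] by simp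
    also have "2 * C2 * ?z ^ m * \<bar>y\<bar> \<le> 2 * C2 * ?z ^ m * ?z"
      using C2 by (intro mult_left_mono) simp_all
    finally show "\<bar>f y\<bar> \<le> (\<bar>f 0\<bar> + 2 * C2) * ?z ^ Suc m" by (simp add: algebra_simps)
  qed (use C2 in auto)
qed

locale dirichlet_problem =
  fixes D :: "'a::euclidean_space set" and lam :: "nat \<Rightarrow> real" and \<phi> :: "nat \<Rightarrow> 'a L2"
  assumes dim: "DIM('a) = 1 \<or> DIM('a) = 2"
    and domain: "smooth_bounded_domain D"
    and eigenpairs: "dirichlet_eigenpairs D lam \<phi>"
begin

lemma D_measurable [measurable]: "D \<in> sets borel" and D_bounded: "bounded D"
  using domain by (auto simp: smooth_bounded_domain_def)

lemma phi_orthonormal: "inner (\<phi> i) (\<phi> j) = (if i = j then 1 else 0)"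
  using eigenpairs by (auto simp: dirichlet_eigenpairs_def orthonormal_basis_def)

lemma phi_L2_on: "\<phi> i \<in> L2_on D"
  using eigenpairs by (auto simp: dirichlet_eigenpairs_def orthonormal_basis_def)

lemma lam_nonneg: "lam j \<ge> 0"
  by (rule dirichlet_eigenvalue_nonneg[OF eigenpairs])

text \<open>The restriction on the dimension is spent here: it gives the eigenfunctions all moments,
  which the polynomially growing nonlinearity requires.\<close>

lemma phi_all_moments: "all_moments D (rep_L2 (\<phi> i))"
  using eigenpairs
  by (intro H1_0_all_moments dim D_bounded D_measurable) (auto simp: dirichlet_eigenpairs_def)

text \<open>Coefficients form a function on all of \<open>nat\<close>, whose product topology then
  serves for continuity and measurability; values from \<open>N\<close> on are ignored.\<close>

definition lincomb :: "nat \<Rightarrow> (nat \<Rightarrow> real) \<Rightarrow> 'a L2" where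
  "lincomb N c = (\<Sum>i<N. c i *\<^sub>R \<phi> i)"

lemma inner_lincomb: "inner (lincomb N c) (\<phi> j) = (if j < N then c j else 0)"
  by (simp add: lincomb_def inner_sum_left phi_orthonormal if_distrib sum.delta cong: if_cong)

lemma inner_lincomb_lincomb: "inner (lincomb N c) (lincomb N d) = (\<Sum>i<N. c i * d i)"
  by (subst (2) lincomb_def) (simp add: inner_sum_right inner_lincomb mult.commute)

lemma lincomb_in_U_N: "lincomb N c \<in> U_N \<phi> N"
  unfolding lincomb_def U_N_def by (intro span_sum span_scale span_base) auto

lemma U_N_lincomb:
  assumes "u \<in> U_N \<phi> N"
  shows "u = lincomb N (\<lambda>i. inner u (\<phi> i))"
proof -
  have "u \<in> span (\<phi> ` {..<N})" using assms by (simp add: U_N_def)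
  then show ?thesis
  proof (induction rule: span_induct_alt)
    case base
    show ?case by (simp add: lincomb_def)
  next
    case (step c x y)
    obtain k where k: "k < N" "x = \<phi> k" using step by auto
    have "lincomb N (\<lambda>i. inner (c *\<^sub>R x + y) (\<phi> i)) = c *\<^sub>R lincomb N (\<lambda>i. inner x (\<phi> i)) + y"
      unfolding arg_cong[OF step.IH, of "(+) (c *\<^sub>R lincomb N (\<lambda>i. inner x (\<phi> i)))"]
      by (simp add: lincomb_def inner_add_left scaleR_add_left sum.distrib scaleR_sum_right)
    also have "lincomb N (\<lambda>i. inner x (\<phi> i)) = x"
      using k by (simp add: lincomb_def phi_orthonormal if_distrib[of "\<lambda>t. t *\<^sub>R _"] sum.delta cong: if_cong)
    finally show ?case by simp
  qed
qed

lemma P_N_lincomb: "P_N \<phi> N u = lincomb N (\<lambda>i. inner u (\<phi> i))"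
  by (simp add: P_N_def lincomb_def)

lemma lincomb_all_moments: "all_moments D (\<lambda>x. 1 + (\<Sum>i<N. \<bar>r * rep_L2 (\<phi> i) x\<bar>))"
proof -
  have "all_moments D (\<lambda>x. \<bar>1\<bar> + \<bar>\<Sum>i<N. \<bar>r * rep_L2 (\<phi> i) x\<bar>\<bar>)"
    by (intro all_moments_add all_moments_const all_moments_sum D_bounded D_measurable
          all_moments_dominated[OF phi_all_moments, where c="\<bar>r\<bar>"]) (auto simp: abs_mult)
  then show ?thesis by (simp add: sum_nonneg abs_of_nonneg)
qed

end

locale dirichlet_nonlinearity = dirichlet_problem D lam \<phi>
  for D :: "'a::euclidean_space set" and lam \<phi> +
  fixes f :: "real \<Rightarrow> real" and C0 C1 C2 C3 \<gamma> :: real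
  assumes nonlinearity: "nonlinearity_A1 f C0 C1 C2 C3 \<gamma>"
begin

lemma f_continuous: "continuous_on UNIV f"
  using nonlinearity
  by (auto simp: nonlinearity_A1_def intro!: continuous_at_imp_continuous_on differentiable_imp_continuous_within)

lemma f_measurable [measurable]: "f \<in> borel_measurable borel"
  by (rule borel_measurable_continuous_onI[OF f_continuous])

text \<open>Mean value theorem and the upper bound on the derivative. The expression is symmetric in
  \<open>y\<close> and \<open>z\<close>, so ordered arguments suffice.\<close>

lemma f_one_sided_lipschitz: "(f y - f z) * (y - z) \<le> C1 * (y - z)\<^sup>2"
proof -
  have *: "(f y - f z) * (y - z) \<le> C1 * (y - z)\<^sup>2" if "y < z" for y z
  proof -
    have "(f has_real_derivative deriv f x) (at x)" for x
      using nonlinearity by (simp add: nonlinearity_A1_def DERIV_deriv_iff_real_differentiable)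
    from MVT2[OF that this] obtain x where "f z - f y = (z - y) * deriv f x"
      by blast
    then have "(f y - f z) * (y - z) = deriv f x * (y - z)\<^sup>2" by algebra
    then show ?thesis
      using nonlinearity by (simp add: nonlinearity_A1_def mult_right_mono)
  qed
  show ?thesis
    using *[of y z] *[of z y] by (cases y z rule: linorder_cases) (auto simp: algebra_simps power2_eq_square)
qed

text \<open>One majorant for \<open>1 + \<bar>y\<bar>\<close> valid at all linear combinations with
  coefficients bounded by \<open>r\<close>; this uniformity is what dominated convergence in the
  coefficients asks for.\<close>

definition dominator :: "nat \<Rightarrow> real \<Rightarrow> 'a \<Rightarrow> real" where
  "dominator N r x = 1 + (\<Sum>i<N. \<bar>r * rep_L2 (\<phi> i) x\<bar>)"

lemma f_lincomb_bound:
  obtains K p where "K \<ge> 0" "\<And>N r c x. (\<forall>i<N. \<bar>c i\<bar> \<le> r) \<Longrightarrow>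
    \<bar>f (\<Sum>i<N. c i * rep_L2 (\<phi> i) x)\<bar> \<le> K * dominator N r x ^ p"
proof -
  obtain K p where K: "\<And>y. \<bar>f y\<bar> \<le> K * (1 + \<bar>y\<bar>) ^ p" "K \<ge> 0"
    using nonlinearity_growth[OF nonlinearity] by metis
  show ?thesis
  proof (rule that[of K p])
    fix N :: nat and r :: real and x :: 'a and c :: "nat \<Rightarrow> real" assume c: "\<forall>i<N. \<bar>c i\<bar> \<le> r"
    have "\<bar>\<Sum>i<N. c i * rep_L2 (\<phi> i) x\<bar> \<le> (\<Sum>i<N. \<bar>r * rep_L2 (\<phi> i) x\<bar>)"
      using c by (intro order.trans[OF sum_abs] sum_mono)
        (auto simp: abs_mult intro!: mult_right_mono intro: order.trans[OF _ abs_ge_self])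
    then have "(1 + \<bar>\<Sum>i<N. c i * rep_L2 (\<phi> i) x\<bar>) ^ p \<le> dominator N r x ^ p"
      unfolding dominator_def by (intro power_mono) auto
    then show "\<bar>f (\<Sum>i<N. c i * rep_L2 (\<phi> i) x)\<bar> \<le> K * dominator N r x ^ p"
      using K by (meson mult_left_mono order.trans)
  qed (fact K)
qed

lemma dominator_nonneg: "dominator N r x \<ge> 0"
  by (simp add: dominator_def sum_nonneg add_nonneg_nonneg)

lemma dominator_sq_integrable: "sq_integrable (\<lambda>x. K * (indicator D x * dominator N r x ^ p))"
proof (rule sq_integrable_scale)
  have "all_moments D (dominator N r)"
    unfolding dominator_def[abs_def] by (rule lincomb_all_moments)
  from all_moments_power_sq_integrable[OF this D_measurable, of p]
  show "sq_integrable (\<lambda>x. indicator D x * dominator N r x ^ p)"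
    by (simp add: abs_of_nonneg dominator_nonneg)
qed

lemma rep_lincomb: "AE x in lborel. rep_L2 (lincomb N c) x = (\<Sum>i<N. c i * rep_L2 (\<phi> i) x)"
  unfolding lincomb_def by (rule rep_sum) simp

text \<open>\<open>to_L2\<close> returns 0 on functions that are not square integrable. This lemma
  ensures that on the Galerkin space \<open>nemytskii\<close> is the genuine superposition operator
  and not that default.\<close>

lemma nemytskii_sq_integrable:
  assumes "u \<in> U_N \<phi> N"
  shows "sq_integrable (\<lambda>x. indicator D x * f (rep_L2 u x))"
proof -
  define c where "c i = inner u (\<phi> i)" for i
  have u: "u = lincomb N c" using U_N_lincomb[OF assms] by (simp add: c_def[abs_def])
  define r where "r = (\<Sum>i<N. \<bar>c i\<bar>)"
  have r: "\<bar>c i\<bar> \<le> r" if "i < N" for i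
    using that member_le_sum[of i "{..<N}" "\<lambda>i. \<bar>c i\<bar>"] by (simp add: r_def)
  obtain K p where K: "K \<ge> 0" "\<And>N r c x. (\<forall>i<N. \<bar>c i\<bar> \<le> r) \<Longrightarrow>
    \<bar>f (\<Sum>i<N. c i * rep_L2 (\<phi> i) x)\<bar> \<le> K * dominator N r x ^ p"
    using f_lincomb_bound by blast
  have "integrable lborel (\<lambda>x. (indicator D x * f (rep_L2 u x))\<^sup>2)"
  proof (rule Bochner_Integration.integrable_bound)
    show "integrable lborel (\<lambda>x. (K * (indicator D x * dominator N r x ^ p))\<^sup>2)"
      using dominator_sq_integrable by (simp add: sq_integrable_def)
    show "AE x in lborel. norm ((indicator D x * f (rep_L2 u x))\<^sup>2)
        \<le> norm ((K * (indicator D x * dominator N r x ^ p))\<^sup>2)"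
      using rep_lincomb[of N c]
    proof eventually_elim
      case (elim x)
      have "\<bar>f (rep_L2 u x)\<bar> \<le> \<bar>K * dominator N r x ^ p\<bar>"
        unfolding u elim using r by (intro order.trans[OF K(2) abs_ge_self]) simp
      then show ?case
        by (auto simp: indicator_def abs_le_square_iff[symmetric] intro!: power_mono)
    qed
  qed measurable
  then show ?thesis by (simp add: sq_integrable_def)
qed

text \<open>Integration of the scalar inequality. Outside \<open>D\<close> the integrand on the left
  is zero, and \<open>max 0 C1\<close> makes the right side nonnegative there; the sign also keeps
  the later step estimates uniform.\<close>

lemma nemytskii_one_sided_lipschitz:
  assumes "u \<in> U_N \<phi> N" "v \<in> U_N \<phi> N"
  shows "inner (nemytskii D f u - nemytskii D f v) (u - v) \<le> max 0 C1 * (norm (u - v))\<^sup>2"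
proof -
  note sq = nemytskii_sq_integrable[OF assms(1)] nemytskii_sq_integrable[OF assms(2)]
  have int: "integrable lborel (\<lambda>x. (rep_L2 (u - v) x)\<^sup>2)"
    "integrable lborel (\<lambda>x. rep_L2 (nemytskii D f u - nemytskii D f v) x * rep_L2 (u - v) x)"
    using sq_integrable_rep[of "u - v"] unfolding sq_integrable_def
    by (blast, intro sq_integrable_mult sq_integrable_rep)
  have "inner (nemytskii D f u - nemytskii D f v) (u - v)
      = (\<integral>x. rep_L2 (nemytskii D f u - nemytskii D f v) x * rep_L2 (u - v) x \<partial>lborel)"
    by (rule inner_L2_rep)
  also have "\<dots> \<le> (\<integral>x. max 0 C1 * (rep_L2 (u - v) x)\<^sup>2 \<partial>lborel)"
  proof (rule integral_mono_AE)
    show "AE x in lborel. rep_L2 (nemytskii D f u - nemytskii D f v) x * rep_L2 (u - v) x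
        \<le> max 0 C1 * (rep_L2 (u - v) x)\<^sup>2"
      using rep_diff[of "nemytskii D f u" "nemytskii D f v"] rep_diff[of u v]
        rep_to_L2[OF sq(1)] rep_to_L2[OF sq(2)]
    proof eventually_elim
      case (elim x)
      have "C1 * (rep_L2 u x - rep_L2 v x)\<^sup>2 \<le> max 0 C1 * (rep_L2 u x - rep_L2 v x)\<^sup>2"
        by (intro mult_right_mono) auto
      then show ?case
        unfolding elim(1,2) unfolding nemytskii_def elim(3,4)
        using f_one_sided_lipschitz[of "rep_L2 u x" "rep_L2 v x"] by (auto simp: indicator_def)
    qed
  qed (use int in auto)
  also have "\<dots> = max 0 C1 * (norm (u - v))\<^sup>2"
    by (simp add: norm_L2_rep)
  finally show ?thesis .
qed

text \<open>Convergence in the product topology is coordinatewise; finitely many convergent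
  coefficient sequences have a common bound \<open>r\<close>, so \<open>dominator N r\<close>
  supplies an integrable majorant for dominated convergence.\<close>

lemma nemytskii_continuous:
  "continuous_on UNIV (\<lambda>c. inner (nemytskii D f (lincomb N c)) (\<phi> j))"
  unfolding continuous_on_sequentially
proof (intro allI ballI impI)
  fix c :: "nat \<Rightarrow> nat \<Rightarrow> real" and a assume "(\<forall>n. c n \<in> UNIV) \<and> c \<longlonglongrightarrow> a"
  then have conv: "(\<lambda>n. c n i) \<longlonglongrightarrow> a i" for i
    using continuous_on_tendsto_compose[OF continuous_on_product_coordinates, of c a sequentially i] by simp
  have "Bseq (\<lambda>n. c n i)" for i
    using conv by (intro convergent_imp_Bseq convergentI)
  then obtain B where B: "\<And>i n. \<bar>c n i\<bar> \<le> B i"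
    unfolding Bseq_def real_norm_def by metis
  define r where "r = (\<Sum>i<N. \<bar>B i\<bar>)"
  have r: "\<bar>c n i\<bar> \<le> r" if "i < N" for i n
    using that member_le_sum[of i "{..<N}" "\<lambda>i. \<bar>B i\<bar>"] B[of n i] by (simp add: r_def)
  obtain K p where K: "K \<ge> 0" "\<And>N r c x. (\<forall>i<N. \<bar>c i\<bar> \<le> r) \<Longrightarrow>
    \<bar>f (\<Sum>i<N. c i * rep_L2 (\<phi> i) x)\<bar> \<le> K * dominator N r x ^ p"
    using f_lincomb_bound by blast
  have ip: "inner (nemytskii D f (lincomb N b)) (\<phi> j)
      = (\<integral>x. indicator D x * f (rep_L2 (lincomb N b) x) * rep_L2 (\<phi> j) x \<partial>lborel)" for b
    unfolding nemytskii_def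
    by (rule inner_to_L2[OF nemytskii_sq_integrable[OF lincomb_in_U_N]])
  have all: "AE x in lborel. \<forall>n. rep_L2 (lincomb N (c n)) x = (\<Sum>i<N. c n i * rep_L2 (\<phi> i) x)"
    unfolding AE_all_countable using rep_lincomb by blast
  show "((\<lambda>c. inner (nemytskii D f (lincomb N c)) (\<phi> j)) \<circ> c) \<longlonglongrightarrow> inner (nemytskii D f (lincomb N a)) (\<phi> j)"
    unfolding o_def ip
  proof (rule integral_dominated_convergence)
    let ?w = "\<lambda>x. K * (indicator D x * dominator N r x ^ p) * \<bar>rep_L2 (\<phi> j) x\<bar>"
    show "integrable lborel ?w"
      by (intro sq_integrable_mult dominator_sq_integrable sq_integrable_abs sq_integrable_rep)
    show "AE x in lborel. (\<lambda>n. indicator D x * f (rep_L2 (lincomb N (c n)) x) * rep_L2 (\<phi> j) x)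
        \<longlonglongrightarrow> indicator D x * f (rep_L2 (lincomb N a) x) * rep_L2 (\<phi> j) x"
      using all rep_lincomb[of N a]
    proof eventually_elim
      case (elim x)
      have "(\<lambda>n. \<Sum>i<N. c n i * rep_L2 (\<phi> i) x) \<longlonglongrightarrow> (\<Sum>i<N. a i * rep_L2 (\<phi> i) x)"
        by (intro tendsto_intros conv)
      then have "(\<lambda>n. f (\<Sum>i<N. c n i * rep_L2 (\<phi> i) x)) \<longlonglongrightarrow> f (\<Sum>i<N. a i * rep_L2 (\<phi> i) x)"
        by (rule continuous_on_tendsto_compose[OF f_continuous]) auto
      with elim show ?case by (auto intro!: tendsto_intros)
    qed
    show "AE x in lborel. norm (indicator D x * f (rep_L2 (lincomb N (c n)) x) * rep_L2 (\<phi> j) x) \<le> ?w x" for n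
      using rep_lincomb[of N "c n"]
    proof eventually_elim
      case (elim x)
      have "\<bar>f (rep_L2 (lincomb N (c n)) x)\<bar> \<le> K * dominator N r x ^ p"
        unfolding elim using r by (intro K(2)) simp
      then show ?case by (auto simp: abs_mult indicator_def intro!: mult_right_mono)
    qed
  qed measurable
qed

end

section \<open>The wave group in spectral coordinates\<close>

definition wave_cos :: "real \<Rightarrow> real \<Rightarrow> real" where
  "wave_cos l t = cos (sqrt l * t)"

text \<open>At \<open>l = 0\<close> the limit value \<open>t\<close> is taken. The formulas then
  hold for every nonnegative eigenvalue, and nonnegativity is all that has been derived.\<close>

definition wave_sin :: "real \<Rightarrow> real \<Rightarrow> real" where
  "wave_sin l t = (if l = 0 then t else sin (sqrt l * t) / sqrt l)"

lemma wave_0 [simp]: "wave_cos l 0 = 1" "wave_sin l 0 = 0"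
  by (simp_all add: wave_cos_def wave_sin_def)

lemma wave_energy: "l \<ge> 0 \<Longrightarrow> (wave_cos l t)\<^sup>2 + l * (wave_sin l t)\<^sup>2 = 1"
  by (simp add: wave_cos_def wave_sin_def power_divide)

lemma wave_cos_deriv:
  assumes "l \<ge> 0"
  shows "(wave_cos l has_real_derivative - l * wave_sin l t) (at t)"
proof -
  have "(wave_cos l has_real_derivative - sin (sqrt l * t) * sqrt l) (at t)"
    unfolding wave_cos_def[abs_def] by (auto intro!: derivative_eq_intros)
  moreover have "- sin (sqrt l * t) * sqrt l = - l * wave_sin l t"
    using assms real_sqrt_mult_self[of l] by (auto simp: wave_sin_def field_simps)
  ultimately show ?thesis by simp
qed

lemma wave_sin_deriv:
  assumes "l \<ge> 0"
  shows "(wave_sin l has_real_derivative wave_cos l t) (at t)"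
  unfolding wave_sin_def[abs_def] wave_cos_def using assms
  by (cases "l = 0") (auto intro!: derivative_eq_intros simp: abs_of_nonneg mult.assoc)

text \<open>The two-by-two block of \<open>t *\<^sub>R A_N\<close> on a single mode with eigenvalue
  \<open>l\<close>.\<close>

definition wave_step :: "real \<Rightarrow> real \<Rightarrow> real \<times> real \<Rightarrow> real \<times> real" where
  "wave_step l t x = (t * snd x, - (t * l * fst x))"

text \<open>For \<open>l > 0\<close>, scaling the first coordinate by \<open>sqrt l\<close> turns
  the block into multiplication by a purely imaginary number, so the series is a complex
  exponential. For \<open>l = 0\<close> the block is nilpotent and two terms remain.\<close>

lemma wave_step_exp:
  assumes "l \<ge> 0"
  shows "(\<lambda>k. fst ((wave_step l t ^^ k) (a, b)) / fact k) sums (wave_cos l t * a + wave_sin l t * b)"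
    and "(\<lambda>k. snd ((wave_step l t ^^ k) (a, b)) / fact k) sums (- l * wave_sin l t * a + wave_cos l t * b)"
proof -
  let ?x = "\<lambda>k. fst ((wave_step l t ^^ k) (a, b))" and ?y = "\<lambda>k. snd ((wave_step l t ^^ k) (a, b))"
  have "(\<lambda>k. ?x k / fact k) sums (wave_cos l t * a + wave_sin l t * b) \<and>
    (\<lambda>k. ?y k / fact k) sums (- l * wave_sin l t * a + wave_cos l t * b)"
  proof (cases "l = 0")
    case True
    have z: "(wave_step 0 t ^^ k) (a, b) = (0, 0)" if "k \<notin> {0, 1}" for k
    proof -
      have "k = Suc (Suc (k - 2))" using that by auto
      moreover have "(wave_step 0 t ^^ Suc (Suc m)) (a, b) = (0, 0)" for m
        by (induction m) (simp_all add: wave_step_def)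
      ultimately show ?thesis by metis
    qed
    have "(\<lambda>k. ?x k / fact k) sums (\<Sum>k\<in>{0, 1}. ?x k / fact k)"
      "(\<lambda>k. ?y k / fact k) sums (\<Sum>k\<in>{0, 1}. ?y k / fact k)"
      unfolding True by (rule sums_finite; use z in simp)+
    then show ?thesis
      by (simp add: True wave_cos_def wave_sin_def wave_step_def add.commute)
  next
    case False
    define w where "w = sqrt l"
    have w: "w > 0" "l = w * w" using assms False by (auto simp: w_def)
    \<comment> \<open>In this complex coordinate one step is multiplication by minus the imaginary
      unit times \<open>w * t\<close>.\<close>
    let ?z = "\<lambda>k. Complex (w * ?x k) (?y k)"
    have step: "?z (Suc k) = Complex 0 (- (w * t)) * ?z k" for k
      by (simp add: complex_eq_iff wave_step_def w)
    have z: "?z k = Complex 0 (- (w * t)) ^ k * Complex (w * a) b" for k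
    proof (induction k)
      case (Suc k)
      show ?case unfolding step Suc.IH by simp
    qed simp
    have "(\<lambda>k. Complex 0 (- (w * t)) ^ k /\<^sub>R fact k * Complex (w * a) b) sums
        (exp (Complex 0 (- (w * t))) * Complex (w * a) b)"
      by (intro sums_mult2 exp_converges)
    then have s: "(\<lambda>k. ?z k /\<^sub>R fact k) sums (exp (Complex 0 (- (w * t))) * Complex (w * a) b)"
      by (simp only: z mult_scaleR_left)
    have e: "exp (Complex 0 (- (w * t))) * Complex (w * a) b
        = Complex (w * (wave_cos l t * a + wave_sin l t * b)) (- l * wave_sin l t * a + wave_cos l t * b)"
      using w False by (simp add: complex_eq_iff Re_exp Im_exp wave_cos_def wave_sin_def w_def[symmetric] field_simps)
    have "(\<lambda>k. w * (?x k / fact k)) sums (w * (wave_cos l t * a + wave_sin l t * b))"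
      using sums_Re[OF s] unfolding e by (simp add: field_simps)
    moreover have "(\<lambda>k. ?y k / fact k) sums (- l * wave_sin l t * a + wave_cos l t * b)"
      using sums_Im[OF s] unfolding e by (simp add: field_simps)
    ultimately show ?thesis
      using w(1) sums_mult_iff[of w "\<lambda>k. ?x k / fact k" "wave_cos l t * a + wave_sin l t * b"] by blast
  qed
  then show "(\<lambda>k. ?x k / fact k) sums (wave_cos l t * a + wave_sin l t * b)"
    "(\<lambda>k. ?y k / fact k) sums (- l * wave_sin l t * a + wave_cos l t * b)" by auto
qed

lemma sums_Pair:
  fixes f :: "nat \<Rightarrow> 'b::real_normed_vector" and g :: "nat \<Rightarrow> 'c::real_normed_vector"
  assumes "f sums a" "g sums b"
  shows "(\<lambda>k. (f k, g k)) sums (a, b)"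
proof -
  have "(\<Sum>k<n. (f k, g k)) = (\<Sum>k<n. f k, \<Sum>k<n. g k)" for n
    by (induction n) (auto simp: zero_prod_def)
  then show ?thesis
    using assms unfolding sums_def by (auto intro: tendsto_Pair)
qed

context dirichlet_problem
begin

lemma A_N_lincomb:
  "t *\<^sub>R A_N lam \<phi> N (lincomb N a, lincomb N b)
    = (lincomb N (\<lambda>j. fst (wave_step (lam j) t (a j, b j))), lincomb N (\<lambda>j. snd (wave_step (lam j) t (a j, b j))))"
  by (simp add: A_N_def Lam_N_def inner_lincomb wave_step_def)
     (simp add: lincomb_def scaleR_sum_right mult_ac flip: sum_negf scaleR_minus_left)

lemma A_N_power_lincomb:
  "((\<lambda>x. t *\<^sub>R A_N lam \<phi> N x) ^^ k) (lincomb N a, lincomb N b)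
    = (lincomb N (\<lambda>j. fst ((wave_step (lam j) t ^^ k) (a j, b j))),
       lincomb N (\<lambda>j. snd ((wave_step (lam j) t ^^ k) (a j, b j))))"
  by (induction k) (simp_all add: A_N_lincomb)

lemma lincomb_sums:
  "(\<And>i. i < N \<Longrightarrow> (\<lambda>k. c k i) sums s i) \<Longrightarrow> (\<lambda>k. lincomb N (c k)) sums lincomb N s"
  unfolding lincomb_def by (intro sums_sum sums_scaleR_left) auto

lemma lincomb_scaleR: "r *\<^sub>R lincomb N c = lincomb N (\<lambda>i. r * c i)"
  by (simp add: lincomb_def scaleR_sum_right)

lemma lincomb_add: "lincomb N c + lincomb N d = lincomb N (\<lambda>i. c i + d i)"
  by (simp add: lincomb_def scaleR_add_left sum.distrib)

lemma lincomb_diff: "lincomb N c - lincomb N d = lincomb N (\<lambda>i. c i - d i)"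
  by (simp add: lincomb_def scaleR_diff_left sum_subtractf)

text \<open>The generator is block diagonal in the eigenbasis, so the operator exponential is summed
  mode by mode.\<close>

lemma E_N_lincomb:
  "E_N lam \<phi> N t (lincomb N a, lincomb N b)
    = (lincomb N (\<lambda>j. wave_cos (lam j) t * a j + wave_sin (lam j) t * b j),
       lincomb N (\<lambda>j. - lam j * wave_sin (lam j) t * a j + wave_cos (lam j) t * b j))"
proof -
  have "(\<lambda>k. ((\<lambda>x. t *\<^sub>R A_N lam \<phi> N x) ^^ k) (lincomb N a, lincomb N b) /\<^sub>R fact k) sums
    (lincomb N (\<lambda>j. wave_cos (lam j) t * a j + wave_sin (lam j) t * b j),
       lincomb N (\<lambda>j. - lam j * wave_sin (lam j) t * a j + wave_cos (lam j) t * b j))"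
    unfolding A_N_power_lincomb scaleR_Pair lincomb_scaleR
    using wave_step_exp[OF lam_nonneg] by (intro sums_Pair lincomb_sums) (simp_all add: divide_inverse mult.commute)
  then show ?thesis by (simp add: E_N_def operator_exp_def sums_iff)
qed

lemma norm_H1_lincomb:
  "(norm_H1 lam \<phi> (lincomb N a, lincomb N b))\<^sup>2 = (\<Sum>j<N. lam j * (a j)\<^sup>2 + (b j)\<^sup>2)"
proof -
  have "sqrt_lap lam \<phi> (lincomb N a) = lincomb N (\<lambda>j. sqrt (lam j) * a j)"
    unfolding sqrt_lap_def
    by (subst suminf_finite[of "{..<N}"]) (simp_all add: inner_lincomb lincomb_def[of _ "\<lambda>j. sqrt (lam j) * a j"])
  then have "(norm (sqrt_lap lam \<phi> (lincomb N a)))\<^sup>2 = (\<Sum>j<N. lam j * (a j)\<^sup>2)"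
    using real_sqrt_pow2[OF lam_nonneg]
    by (simp add: power2_norm_eq_inner inner_lincomb_lincomb power_mult_distrib flip: power2_eq_square)
  moreover have "(norm (lincomb N b))\<^sup>2 = (\<Sum>j<N. (b j)\<^sup>2)"
    unfolding power2_norm_eq_inner inner_lincomb_lincomb by (simp add: power2_eq_square)
  moreover have "(norm_H1 lam \<phi> (lincomb N a, lincomb N b))\<^sup>2
      = (norm (sqrt_lap lam \<phi> (lincomb N a)))\<^sup>2 + (norm (lincomb N b))\<^sup>2"
    by (simp add: norm_H1_def)
  ultimately show ?thesis
    by (simp add: sum.distrib)
qed

end

section \<open>Riemann-Stieltjes sums\<close>

definition grid :: "real \<Rightarrow> real \<Rightarrow> nat \<Rightarrow> nat \<Rightarrow> real" where
  "grid a b n k = a + real k * ((b - a) / real n)"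

lemma grid_0: "grid a b n 0 = a"
  by (simp add: grid_def)

lemma grid_n: "n > 0 \<Longrightarrow> grid a b n n = b"
  by (simp add: grid_def)

lemma grid_Suc: "grid a b n (Suc k) = grid a b n k + (b - a) / real n"
  by (simp add: grid_def distrib_right del: times_divide_eq_right)

lemma grid_mono: "a \<le> b \<Longrightarrow> k \<le> m \<Longrightarrow> grid a b n k \<le> grid a b n m"
  unfolding grid_def by (intro add_left_mono mult_right_mono) auto

lemma grid_in: "a \<le> b \<Longrightarrow> k \<le> n \<Longrightarrow> n > 0 \<Longrightarrow> grid a b n k \<in> {a..b}"
  using grid_mono[of a b 0 k n] grid_mono[of a b k n n] by (simp add: grid_0 grid_n)

lemma integral_grid:
  fixes g :: "real \<Rightarrow> real"
  assumes "a \<le> b" "continuous_on {a..b} g" "n > 0" "m \<le> n"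
  shows "(\<Sum>k<m. integral {grid a b n k..grid a b n (Suc k)} g) = integral {a..grid a b n m} g"
  using assms(4)
proof (induction m)
  case (Suc m)
  have "integral {a..grid a b n m} g + integral {grid a b n m..grid a b n (Suc m)} g
      = integral {a..grid a b n (Suc m)} g"
    using grid_in[of a b m n] grid_in[of a b "Suc m" n] grid_mono[of a b m "Suc m" n] assms Suc.prems
    by (intro Henstock_Kurzweil_Integration.integral_combine integrable_continuous_real continuous_on_subset[OF assms(2)]) auto
  with Suc show ?case by simp
qed (simp add: grid_0)

text \<open>An increment of \<open>q\<close> is the integral of \<open>q'\<close> over the cell. The
  error of a cell is therefore at most the oscillation of \<open>\<beta>\<close> times the bound of
  \<open>q'\<close> times the cell length, and uniform continuity finishes.\<close>

lemma riemann_stieltjes_right: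
  fixes \<beta> q q' :: "real \<Rightarrow> real"
  assumes ab: "a \<le> b" and \<beta>: "continuous_on {a..b} \<beta>" and q': "continuous_on {a..b} q'"
    and q: "\<And>s. s \<in> {a..b} \<Longrightarrow> (q has_real_derivative q' s) (at s within {a..b})"
  shows "(\<lambda>n. \<Sum>k<Suc n. \<beta> (grid a b (Suc n) (Suc k)) * (q (grid a b (Suc n) (Suc k)) - q (grid a b (Suc n) k)))
    \<longlonglongrightarrow> integral {a..b} (\<lambda>s. \<beta> s * q' s)" (is "?S \<longlonglongrightarrow> ?I")
proof (rule LIMSEQ_I)
  fix r :: real assume "r > 0"
  have "bounded (q' ` {a..b})"
    by (intro compact_imp_bounded compact_continuous_image q') simp
  then obtain K where K: "K > 0" "\<And>s. s \<in> {a..b} \<Longrightarrow> \<bar>q' s\<bar> \<le> K"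
    by (auto simp: bounded_pos)
  \<comment> \<open>Makes the total error \<open>\<epsilon> * K * (b - a)\<close> smaller than
    \<open>r\<close>; the added 1 covers \<open>a = b\<close>.\<close>
  define \<epsilon> where "\<epsilon> = r / (2 * K * (b - a + 1))"
  have \<epsilon>: "\<epsilon> > 0" using \<open>r > 0\<close> K(1) ab by (simp add: \<epsilon>_def)
  have "uniformly_continuous_on {a..b} \<beta>"
    by (intro compact_uniformly_continuous \<beta>) simp
  then obtain d where d: "d > 0" "\<And>s t. s \<in> {a..b} \<Longrightarrow> t \<in> {a..b} \<Longrightarrow> \<bar>t - s\<bar> < d \<Longrightarrow> \<bar>\<beta> t - \<beta> s\<bar> < \<epsilon>"
    using \<epsilon> by (auto simp: uniformly_continuous_on_def dist_real_def)
  obtain n0 :: nat where "(b - a) / d < real n0"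
    using reals_Archimedean2 by blast
  then have "b - a < real n0 * d" using d(1) by (simp add: divide_less_eq)
  also have "\<dots> \<le> real (Suc n0) * d" using d(1) by (intro mult_right_mono) auto
  finally have n0: "(b - a) / real (Suc n0) < d" by (simp add: divide_less_eq mult.commute)
  show "\<exists>no. \<forall>n\<ge>no. norm (?S n - ?I) < r"
  proof (intro exI[of _ n0] allI impI)
    fix n assume n: "n \<ge> n0"
    let ?g = "grid a b (Suc n)" and ?h = "(b - a) / real (Suc n)"
    have h: "?h < d"
      using n ab by (intro le_less_trans[OF _ n0] divide_left_mono) auto
    have I: "?I = (\<Sum>k<Suc n. integral {?g k..?g (Suc k)} (\<lambda>s. \<beta> s * q' s))"
      using integral_grid[OF ab continuous_on_mult[OF \<beta> q'], of "Suc n" "Suc n"] by (simp only: grid_n[OF zero_less_Suc] order.refl zero_less_Suc)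
    have "\<bar>\<beta> (?g (Suc k)) * (q (?g (Suc k)) - q (?g k)) - integral {?g k..?g (Suc k)} (\<lambda>s. \<beta> s * q' s)\<bar>
        \<le> \<epsilon> * K * ?h" if k: "k < Suc n" for k
    proof -
      have g: "?g k \<in> {a..b}" "?g (Suc k) \<in> {a..b}" "?g k \<le> ?g (Suc k)"
        using k by (auto intro!: grid_in grid_mono ab simp del: atLeastAtMost_iff)
      then have sub: "{?g k..?g (Suc k)} \<subseteq> {a..b}" by auto
      have i1: "(q' has_integral (q (?g (Suc k)) - q (?g k))) {?g k..?g (Suc k)}"
        using g(3)
      proof (rule fundamental_theorem_of_calculus)
        fix s assume "s \<in> {?g k..?g (Suc k)}"
        then have "(q has_real_derivative q' s) (at s within {?g k..?g (Suc k)})"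
          using sub by (intro DERIV_subset[OF q]) auto
        then show "(q has_vector_derivative q' s) (at s within {?g k..?g (Suc k)})"
          by (simp add: has_real_derivative_iff_has_vector_derivative)
      qed
      have i2: "((\<lambda>s. \<beta> s * q' s) has_integral integral {?g k..?g (Suc k)} (\<lambda>s. \<beta> s * q' s)) {?g k..?g (Suc k)}"
        by (intro integrable_integral integrable_continuous_real continuous_on_mult
            continuous_on_subset[OF \<beta> sub] continuous_on_subset[OF q' sub])
      have "((\<lambda>s. \<beta> (?g (Suc k)) * q' s - \<beta> s * q' s) has_integral
          (\<beta> (?g (Suc k)) * (q (?g (Suc k)) - q (?g k)) - integral {?g k..?g (Suc k)} (\<lambda>s. \<beta> s * q' s))) {?g k..?g (Suc k)}"
        by (intro has_integral_diff has_integral_mult_right i1 i2)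
      note int = this
      have "norm (\<beta> (?g (Suc k)) * (q (?g (Suc k)) - q (?g k)) - integral {?g k..?g (Suc k)} (\<lambda>s. \<beta> s * q' s))
          \<le> \<epsilon> * K * Henstock_Kurzweil_Integration.content {?g k..?g (Suc k)}"
      proof (rule has_integral_bound_real[OF _ finite.emptyI int])
        fix s assume "s \<in> {?g k..?g (Suc k)} - {}"
        then have s: "s \<in> {?g k..?g (Suc k)}" by simp
        have "\<bar>?g (Suc k) - s\<bar> < d" using s h by (auto simp: grid_Suc)
        then have "\<bar>\<beta> (?g (Suc k)) - \<beta> s\<bar> < \<epsilon>"
          using d(2)[of s "?g (Suc k)"] g s sub by auto
        moreover have "\<bar>q' s\<bar> \<le> K" using K s sub by auto
        ultimately have "\<bar>\<beta> (?g (Suc k)) - \<beta> s\<bar> * \<bar>q' s\<bar> \<le> \<epsilon> * K"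
          using \<epsilon> by (intro mult_mono) auto
        then show "norm (\<beta> (?g (Suc k)) * q' s - \<beta> s * q' s) \<le> \<epsilon> * K"
          by (simp add: left_diff_distrib[symmetric] abs_mult)
      qed (use \<epsilon> K in auto)
      then show ?thesis using g by (simp add: grid_Suc)
    qed
    then have "\<bar>?S n - ?I\<bar> \<le> (\<Sum>k<Suc n. \<epsilon> * K * ?h)"
      unfolding I sum_subtractf[symmetric] by (intro order.trans[OF sum_abs] sum_mono) auto
    also have "\<dots> = \<epsilon> * K * (b - a)" by simp
    also have "\<dots> = r * ((b - a) / (2 * (b - a + 1)))"
      using K(1) by (simp add: \<epsilon>_def)
    also have "\<dots> < r * 1"
      using \<open>r > 0\<close> ab by (intro mult_strict_left_mono) (simp_all add: pos_divide_less_eq)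
    finally show "norm (?S n - ?I) < r" by simp
  qed
qed

text \<open>Moves the increments from the continuous but possibly very rough \<open>\<beta>\<close>
  to the smooth weight \<open>q\<close>.\<close>

lemma abel_summation:
  fixes q \<beta> :: "nat \<Rightarrow> real"
  shows "(\<Sum>k<n. q k * (\<beta> (Suc k) - \<beta> k)) = q n * \<beta> n - q 0 * \<beta> 0 - (\<Sum>k<n. \<beta> (Suc k) * (q (Suc k) - q k))"
  by (induction n) (simp_all add: algebra_simps)

text \<open>Left-point sums against increments of \<open>\<beta>\<close>, as they occur in the step
  integrals, converge path by path although \<open>\<beta>\<close> is merely continuous: after
  summation by parts only increments of \<open>q\<close> remain.\<close>

lemma riemann_stieltjes_left:
  fixes \<beta> q q' :: "real \<Rightarrow> real"
  assumes ab: "a \<le> b" and \<beta>: "continuous_on {a..b} \<beta>" and q': "continuous_on {a..b} q'"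
    and q: "\<And>s. s \<in> {a..b} \<Longrightarrow> (q has_real_derivative q' s) (at s within {a..b})"
  shows "(\<lambda>n. \<Sum>k<Suc n. q (grid a b (Suc n) k) * (\<beta> (grid a b (Suc n) (Suc k)) - \<beta> (grid a b (Suc n) k)))
    \<longlonglongrightarrow> q b * \<beta> b - q a * \<beta> a - integral {a..b} (\<lambda>s. \<beta> s * q' s)"
proof -
  have "(\<lambda>n. q b * \<beta> b - q a * \<beta> a - (\<Sum>k<Suc n. \<beta> (grid a b (Suc n) (Suc k)) * (q (grid a b (Suc n) (Suc k)) - q (grid a b (Suc n) k))))
    \<longlonglongrightarrow> q b * \<beta> b - q a * \<beta> a - integral {a..b} (\<lambda>s. \<beta> s * q' s)"
    by (intro tendsto_diff tendsto_const riemann_stieltjes_right assms)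
  then show ?thesis
    unfolding abel_summation[of "\<lambda>k. q (grid a b (Suc _) k)" "\<lambda>k. \<beta> (grid a b (Suc _) k)"]
    by (simp only: grid_0 grid_n[OF zero_less_Suc])
qed

text \<open>The product rule applied to \<open>p * u + q * (v - \<beta>)\<close>, where \<open>v - \<beta>\<close> is differentiable
  although \<open>\<beta>\<close> is not.\<close>

lemma wave_variation_of_constants:
  fixes u v \<beta> F p q :: "real \<Rightarrow> real"
  assumes ab: "0 \<le> a" "a \<le> b" "b \<le> T"
    and cont: "continuous_on {0..T} u" "continuous_on {0..T} v" "continuous_on {0..T} \<beta>" "continuous_on {0..T} F"
    and u: "\<And>t. t \<in> {0..T} \<Longrightarrow> u t = u0 + integral {0..t} v"
    and v: "\<And>t. t \<in> {0..T} \<Longrightarrow> v t = v0 + integral {0..t} (\<lambda>s. F s - l * u s) + (\<beta> t - \<beta> 0)"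
    and p: "\<And>s. (p has_real_derivative l * q s) (at s)" and q: "\<And>s. (q has_real_derivative - p s) (at s)"
  shows "(\<lambda>n. \<Sum>k<Suc n. q (grid a b (Suc n) k) * (\<beta> (grid a b (Suc n) (Suc k)) - \<beta> (grid a b (Suc n) k)))
    \<longlonglongrightarrow> (p b * u b + q b * v b) - (p a * u a + q a * v a) - integral {a..b} (\<lambda>s. q s * F s)"
proof -
  have sub: "{a..b} \<subseteq> {0..T}" using ab by auto
  have pc: "continuous_on {a..b} p" and qc: "continuous_on {a..b} q"
    using p q by (auto intro!: continuous_at_imp_continuous_on DERIV_isCont)
  note c = continuous_on_subset[OF _ sub]
  have du: "(u has_real_derivative v s) (at s within {a..b})" if "s \<in> {a..b}" for s
  proof -
    have "((\<lambda>t. u0 + integral {0..t} v) has_real_derivative v s) (at s within {0..T})"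
      using integral_has_real_derivative[OF cont(2), of s] that sub by (auto intro!: derivative_eq_intros)
    then have "(u has_real_derivative v s) (at s within {0..T})"
      unfolding has_field_derivative_def
      by (rule has_derivative_transform[rotated 2]) (use that sub u in auto)
    then show ?thesis using sub by (rule DERIV_subset)
  qed
  have dw: "((\<lambda>t. v t - \<beta> t) has_real_derivative F s - l * u s) (at s within {a..b})" if "s \<in> {a..b}" for s
  proof -
    have "((\<lambda>t. v0 - \<beta> 0 + integral {0..t} (\<lambda>s. F s - l * u s)) has_real_derivative F s - l * u s) (at s within {0..T})"
      using integral_has_real_derivative[of 0 T "\<lambda>s. F s - l * u s" s] that sub cont
      by (auto intro!: derivative_eq_intros simp: continuous_on_diff continuous_on_mult_left)
    then have "((\<lambda>t. v t - \<beta> t) has_real_derivative F s - l * u s) (at s within {0..T})"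
      unfolding has_field_derivative_def
      by (rule has_derivative_transform[rotated 2]) (use that sub v in auto)
    then show ?thesis using sub by (rule DERIV_subset)
  qed
  \<comment> \<open>The pair \<open>(p, q)\<close> solves the adjoint of the oscillator equation. In
    the product rule the terms with \<open>u\<close> and with \<open>v\<close> therefore cancel, and
    only the noise and the forcing survive.\<close>
  have "((\<lambda>s. p s * \<beta> s + q s * F s) has_integral
      (p b * u b + q b * (v b - \<beta> b)) - (p a * u a + q a * (v a - \<beta> a))) {a..b}"
  proof (rule fundamental_theorem_of_calculus[OF ab(2)])
    fix s assume s: "s \<in> {a..b}"
    have "((\<lambda>s. p s * u s + q s * (v s - \<beta> s)) has_real_derivative
        (l * q s * u s + v s * p s) + (- p s * (v s - \<beta> s) + (F s - l * u s) * q s)) (at s within {a..b})"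
      by (intro DERIV_add DERIV_mult' DERIV_mult du dw s has_field_derivative_at_within[OF p] has_field_derivative_at_within[OF q])
    moreover have "(l * q s * u s + v s * p s) + (- p s * (v s - \<beta> s) + (F s - l * u s) * q s) = p s * \<beta> s + q s * F s"
      by (simp add: algebra_simps)
    ultimately show "((\<lambda>s. p s * u s + q s * (v s - \<beta> s)) has_vector_derivative p s * \<beta> s + q s * F s) (at s within {a..b})"
      by (simp add: has_real_derivative_iff_has_vector_derivative)
  qed
  moreover have "((\<lambda>s. p s * \<beta> s + q s * F s) has_integral
      integral {a..b} (\<lambda>s. p s * \<beta> s) + integral {a..b} (\<lambda>s. q s * F s)) {a..b}"
    by (intro has_integral_add integrable_integral integrable_continuous_real continuous_intros pc qc c cont)
  ultimately have "integral {a..b} (\<lambda>s. p s * \<beta> s) + integral {a..b} (\<lambda>s. q s * F s)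
      = (p b * u b + q b * (v b - \<beta> b)) - (p a * u a + q a * (v a - \<beta> a))"
    by (rule has_integral_unique[rotated])
  moreover have "integral {a..b} (\<lambda>s. \<beta> s * - p s) = - integral {a..b} (\<lambda>s. p s * \<beta> s)"
    by (simp add: mult.commute flip: integral_neg)
  ultimately have "q b * \<beta> b - q a * \<beta> a - integral {a..b} (\<lambda>s. \<beta> s * - p s)
      = (p b * u b + q b * v b) - (p a * u a + q a * v a) - integral {a..b} (\<lambda>s. q s * F s)"
    by (simp add: algebra_simps)
  moreover have "(\<lambda>n. \<Sum>k<Suc n. q (grid a b (Suc n) k) * (\<beta> (grid a b (Suc n) (Suc k)) - \<beta> (grid a b (Suc n) k)))
    \<longlonglongrightarrow> q b * \<beta> b - q a * \<beta> a - integral {a..b} (\<lambda>s. \<beta> s * - p s)"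
    by (intro riemann_stieltjes_left ab c cont continuous_intros pc has_field_derivative_at_within[OF q])
  ultimately show ?thesis by simp
qed

section \<open>The Ito isometry for deterministic step functions\<close>

lemma square_integrable_mult:
  fixes X Y :: "'w \<Rightarrow> real" and P :: "'w measure"
  assumes [measurable]: "X \<in> borel_measurable P" "Y \<in> borel_measurable P"
    and "integrable P (\<lambda>\<omega>. (X \<omega>)\<^sup>2)" "integrable P (\<lambda>\<omega>. (Y \<omega>)\<^sup>2)"
  shows "integrable P (\<lambda>\<omega>. X \<omega> * Y \<omega>)"
proof (rule Bochner_Integration.integrable_bound)
  show "integrable P (\<lambda>\<omega>. (X \<omega>)\<^sup>2 + (Y \<omega>)\<^sup>2)" using assms by simp
  have "\<bar>x * y\<bar> \<le> x\<^sup>2 + y\<^sup>2" for x y :: real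
    using sum_squares_bound[of "\<bar>x\<bar>" "\<bar>y\<bar>"] mult_nonneg_nonneg[OF abs_ge_zero[of x] abs_ge_zero[of y]]
    unfolding abs_mult mult.assoc power2_abs by linarith
  then show "AE \<omega> in P. norm (X \<omega> * Y \<omega>) \<le> norm ((X \<omega>)\<^sup>2 + (Y \<omega>)\<^sup>2)" by simp
qed measurable

locale Q_wiener =
  fixes P :: "'w measure" and F :: "real \<Rightarrow> 'w measure" and V :: "'u::real_inner set"
    and e :: "nat \<Rightarrow> 'u" and Q Qh :: "'u \<Rightarrow> 'u" and W :: "real \<Rightarrow> 'w \<Rightarrow> 'u"
  assumes filtered: "filtered_prob_space P F"
    and V_subspace: "subspace V"
    and e_basis: "orthonormal_basis V e"
    and Qh_sqrt: "is_operator_sqrt V Q Qh"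
    and wiener: "Q_wiener_process P F V Q W"
begin

sublocale prob_space P
  using filtered by (simp add: filtered_prob_space_def)

lemma F_subalgebra: "t \<ge> 0 \<Longrightarrow> subalgebra P (F t)"
  and F_mono: "0 \<le> s \<Longrightarrow> s \<le> t \<Longrightarrow> sets (F s) \<subseteq> sets (F t)"
  using filtered by (auto simp: filtered_prob_space_def)

lemma F_measurable_mono:
  assumes "X \<in> borel_measurable (F s)" "0 \<le> s" "s \<le> t"
  shows "X \<in> borel_measurable (F t)"
proof (rule measurable_from_subalg[OF _ assms(1)])
  show "subalgebra (F t) (F s)"
    using F_mono[OF assms(2,3)] F_subalgebra[OF assms(2)] F_subalgebra[OF order.trans[OF assms(2,3)]]
    by (simp add: subalgebra_def)
qed

lemma F_measurable_P: "X \<in> borel_measurable (F s) \<Longrightarrow> 0 \<le> s \<Longrightarrow> X \<in> borel_measurable P"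
  by (rule measurable_from_subalg[OF F_subalgebra])

lemma e_orthonormal: "inner (e i) (e j) = (if i = j then 1 else 0)"
  and e_in_V: "e i \<in> V"
  using e_basis by (auto simp: orthonormal_basis_def)

lemma Qh_in_V: "u \<in> V \<Longrightarrow> Qh u \<in> V"
  and Qh_add: "u \<in> V \<Longrightarrow> v \<in> V \<Longrightarrow> Qh (u + v) = Qh u + Qh v"
  and Qh_scale: "u \<in> V \<Longrightarrow> Qh (c *\<^sub>R u) = c *\<^sub>R Qh u"
  and Qh_sym: "u \<in> V \<Longrightarrow> v \<in> V \<Longrightarrow> inner (Qh u) v = inner u (Qh v)"
  using Qh_sqrt by (auto simp: is_operator_sqrt_def psd_operator_def bounded_operator_def)

lemma Q_inner:
  assumes "u \<in> V"
  shows "inner (Q u) u = (norm (Qh u))\<^sup>2"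
proof -
  have "Q u = Qh (Qh u)" using Qh_sqrt assms by (simp add: is_operator_sqrt_def)
  then show ?thesis using Qh_sym[OF Qh_in_V[OF assms] assms] by (simp add: power2_norm_eq_inner)
qed

lemma Qh_sum:
  assumes "finite I" "\<And>i. i \<in> I \<Longrightarrow> u i \<in> V"
  shows "Qh (\<Sum>i\<in>I. c i *\<^sub>R u i) = (\<Sum>i\<in>I. c i *\<^sub>R Qh (u i))"
  using assms
proof (induction I rule: finite_induct)
  case empty
  show ?case using Qh_scale[OF subspace_0[OF V_subspace], of 0] by simp
next
  case (insert i I)
  then show ?case
    using V_subspace by (simp add: Qh_add Qh_scale subspace_sum subspace_scale)
qed

lemma Qh_bounded: obtains K where "K \<ge> 0" "\<And>u. u \<in> V \<Longrightarrow> norm (Qh u) \<le> K * norm u"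
proof -
  obtain K where K: "\<forall>u\<in>V. norm (Qh u) \<le> K * norm u"
    using Qh_sqrt by (auto simp: is_operator_sqrt_def psd_operator_def bounded_operator_def)
  have "norm (Qh u) \<le> \<bar>K\<bar> * norm u" if "u \<in> V" for u
    using K that by (meson abs_ge_self mult_right_mono norm_ge_zero order.trans)
  then show ?thesis using that[of "\<bar>K\<bar>"] by simp
qed

lemma W_in_V: "t \<ge> 0 \<Longrightarrow> \<omega> \<in> space P \<Longrightarrow> W t \<omega> \<in> V"
  and W_adapted: "t \<ge> 0 \<Longrightarrow> W t \<in> borel_measurable (F t)"
  and W_continuous: "AE \<omega> in P. continuous_on {0..} (\<lambda>t. W t \<omega>)"
proof -
  have "\<forall>t\<ge>0. W t \<in> borel_measurable (F t) \<and> (\<forall>\<omega>\<in>space P. W t \<omega> \<in> V)"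
    using wiener unfolding Q_wiener_process_def by (elim conjE)
  then show "t \<ge> 0 \<Longrightarrow> \<omega> \<in> space P \<Longrightarrow> W t \<omega> \<in> V" "t \<ge> 0 \<Longrightarrow> W t \<in> borel_measurable (F t)"
    by auto
  show "AE \<omega> in P. continuous_on {0..} (\<lambda>t. W t \<omega>)"
    using wiener unfolding Q_wiener_process_def by (elim conjE)
qed

lemma W_diff_in_V: "s \<ge> 0 \<Longrightarrow> t \<ge> 0 \<Longrightarrow> \<omega> \<in> space P \<Longrightarrow> W t \<omega> - W s \<omega> \<in> V"
  by (intro subspace_diff V_subspace W_in_V)

lemma wiener_increments:
  assumes "0 \<le> s" "s \<le> t"
  shows "indep_set (sets (F s)) {(\<lambda>\<omega>. W t \<omega> - W s \<omega>) -` A \<inter> space P |A. A \<in> sets borel} \<and>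
        (\<forall>h\<in>V. centered_gaussian P (\<lambda>\<omega>. inner (W t \<omega> - W s \<omega>) h) ((t - s) * inner (Q h) h))"
proof -
  have "\<forall>s t. 0 \<le> s \<longrightarrow> s \<le> t \<longrightarrow>
      indep_set (sets (F s)) {(\<lambda>\<omega>. W t \<omega> - W s \<omega>) -` A \<inter> space P |A. A \<in> sets borel} \<and>
        (\<forall>h\<in>V. centered_gaussian P (\<lambda>\<omega>. inner (W t \<omega> - W s \<omega>) h) ((t - s) * inner (Q h) h))"
    using wiener unfolding Q_wiener_process_def by (elim conjE)
  from this[rule_format, OF assms] show ?thesis .
qed

definition incr :: "real \<Rightarrow> real \<Rightarrow> 'u \<Rightarrow> 'w \<Rightarrow> real" where
  "incr s t v \<omega> = inner (W t \<omega> - W s \<omega>) v"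

lemma inner_borel_measurable: "X \<in> borel_measurable M \<Longrightarrow> (\<lambda>\<omega>. inner (X \<omega>) v) \<in> borel_measurable M"
  by (rule measurable_compose[where g="\<lambda>x. inner x v"])
     (auto intro!: borel_measurable_continuous_onI continuous_intros)

lemma incr_adapted:
  assumes "0 \<le> s" "s \<le> t"
  shows "incr s t v \<in> borel_measurable (F t)"
  unfolding incr_def[abs_def] inner_diff_left using assms
  by (intro borel_measurable_diff inner_borel_measurable F_measurable_mono[of "W s" s t] W_adapted) auto

lemma incr_measurable: "0 \<le> s \<Longrightarrow> s \<le> t \<Longrightarrow> incr s t v \<in> borel_measurable P"
  using F_measurable_P[OF incr_adapted, of s t v] by simp

lemma incr_gaussian:
  assumes "0 \<le> s" "s \<le> t" "v \<in> V"
  shows "centered_gaussian P (incr s t v) ((t - s) * (norm (Qh v))\<^sup>2)"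
  unfolding incr_def[abs_def] Q_inner[OF assms(3), symmetric]
  by (rule bspec[OF conjunct2[OF wiener_increments[OF assms(1,2)]] assms(3)])

text \<open>Variance zero is separate: the variable then vanishes almost surely and has no
  density.\<close>

lemma centered_gaussian_moments:
  assumes "centered_gaussian P Z v"
  shows "integrable P Z" "expectation Z = 0" "integrable P (\<lambda>\<omega>. (Z \<omega>)\<^sup>2)" "expectation (\<lambda>\<omega>. (Z \<omega>)\<^sup>2) = v"
proof -
  have Z[measurable]: "Z \<in> borel_measurable P" using assms by (simp add: centered_gaussian_def)
  have "integrable P Z \<and> expectation Z = 0 \<and> integrable P (\<lambda>\<omega>. (Z \<omega>)\<^sup>2) \<and> expectation (\<lambda>\<omega>. (Z \<omega>)\<^sup>2) = v"
  proof (cases "v = 0")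
    case True
    then have z: "AE \<omega> in P. Z \<omega> = 0" using assms by (simp add: centered_gaussian_def)
    then have "AE \<omega> in P. (Z \<omega>)\<^sup>2 = 0" by eventually_elim simp
    with z show ?thesis
      by (simp add: True integrable_cong_AE[of Z P "\<lambda>_. 0"] integrable_cong_AE[of "\<lambda>\<omega>. (Z \<omega>)\<^sup>2" P "\<lambda>_. 0"]
        integral_cong_AE[of Z P "\<lambda>_. 0"] integral_cong_AE[of "\<lambda>\<omega>. (Z \<omega>)\<^sup>2" P "\<lambda>_. 0"])
  next
    case False
    then have v: "sqrt v > 0" "v > 0" and D: "distributed P lborel Z (normal_density 0 (sqrt v))"
      using assms by (auto simp: centered_gaussian_def)
    have "integrable lborel (\<lambda>x. normal_density 0 (sqrt v) x * x)"
      "integrable lborel (\<lambda>x. normal_density 0 (sqrt v) x * x\<^sup>2)"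
      using integrable_normal_moment[OF v(1), of 0 1] integrable_normal_moment[OF v(1), of 0 2] by simp_all
    moreover have "(\<integral>x. normal_density 0 (sqrt v) x * x \<partial>lborel) = 0"
      "(\<integral>x. normal_density 0 (sqrt v) x * x\<^sup>2 \<partial>lborel) = v"
      using integral_normal_moment_odd[OF v(1), of 0 0] integral_normal_moment_even[OF v(1), of 0 1] v(2)
      by (simp_all add: fact_numeral)
    ultimately show ?thesis
      using distributed_integrable[OF D, of "\<lambda>x. x"] distributed_integral[OF D, of "\<lambda>x. x"]
        distributed_integrable[OF D, of "\<lambda>x. x\<^sup>2"] distributed_integral[OF D, of "\<lambda>x. x\<^sup>2"]
      by simp
  qed
  then show "integrable P Z" "expectation Z = 0" "integrable P (\<lambda>\<omega>. (Z \<omega>)\<^sup>2)" "expectation (\<lambda>\<omega>. (Z \<omega>)\<^sup>2) = v"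
    by auto
qed

lemmas incr_moments = centered_gaussian_moments[OF incr_gaussian]

lemma incr_mult_integrable:
  assumes "0 \<le> s" "s \<le> t" "0 \<le> s'" "s' \<le> t'" "v \<in> V" "u \<in> V"
  shows "integrable P (\<lambda>\<omega>. incr s t v \<omega> * incr s' t' u \<omega>)"
  using assms by (intro square_integrable_mult incr_measurable incr_moments)

text \<open>The Wiener property speaks of preimages under the whole increment; those under its
  scalar product with \<open>v\<close> are among them. Independence factors the expectation, and the
  increment is centred.\<close>

lemma incr_indep:
  assumes "0 \<le> s" "s \<le> t" "v \<in> V" and X: "X \<in> borel_measurable (F s)" "integrable P X"
  shows "expectation (\<lambda>\<omega>. X \<omega> * incr s t v \<omega>) = 0"
proof -
  let ?Y = "incr s t v"
  let ?A = "{X -` A \<inter> space P |A. A \<in> sets borel}" and ?B = "{?Y -` A \<inter> space P |A. A \<in> sets borel}"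
  let ?C = "{(\<lambda>\<omega>. W t \<omega> - W s \<omega>) -` A \<inter> space P |A. A \<in> sets borel}"
  have ind: "indep_set (sets (F s)) ?C"
    using wiener_increments[OF assms(1,2)] by (rule conjunct1)
  have sp: "space (F s) = space P" using F_subalgebra[OF assms(1)] by (simp add: subalgebra_def)
  have A: "sigma_sets (space P) ?A \<subseteq> sets (F s)"
    using X(1) unfolding sp[symmetric] by (intro sets.sigma_sets_subset) (auto simp: measurable_sets)
  \<comment> \<open>Preimages of Borel sets already form a sigma-algebra, so generating one adds
    nothing.\<close>
  have sB: "sigma_sets (space P) ?B = ?B"
    using sigma_sets_vimage_commute[of ?Y "space P" UNIV "sets borel"] sets.sigma_sets_eq[of "borel :: real measure"]
    by simp
  have B: "?B \<subseteq> ?C"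
  proof
    fix S assume "S \<in> ?B"
    then obtain A where A: "S = ?Y -` A \<inter> space P" "A \<in> sets borel" by blast
    have "continuous_on UNIV (\<lambda>x. inner x v)" by (intro continuous_intros)
    then have "(\<lambda>x. inner x v) -` A \<in> sets borel"
      using measurable_sets[OF borel_measurable_continuous_onI A(2)] by simp
    moreover have "S = (\<lambda>\<omega>. W t \<omega> - W s \<omega>) -` ((\<lambda>x. inner x v) -` A) \<inter> space P"
      unfolding A(1) by (auto simp: incr_def)
    ultimately show "S \<in> ?C" by blast
  qed
  have iv: "indep_var borel X borel ?Y"
    unfolding indep_var_eq
  proof (intro conjI)
    show "indep_set (sigma_sets (space P) ?A) (sigma_sets (space P) ?B)"
      using ind unfolding sB indep_set_def
    proof (rule indep_sets_mono_sets)
      show "case_bool (sigma_sets (space P) ?A) ?B i \<subseteq> case_bool (sets (F s)) ?C i" for i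
        using A B by (cases i) (simp_all only: bool.case)
    qed
  qed (use F_measurable_P[OF X(1) assms(1)] incr_measurable[OF assms(1,2)] in auto)
  show ?thesis
    using indep_var_lebesgue_integral[OF iv X(2) incr_moments(1)[OF assms(1-3)]] incr_moments(2)[OF assms(1-3)] by simp
qed

lemma incr_split: "incr s t v \<omega> = incr s r v \<omega> + incr r t v \<omega>"
  by (simp add: incr_def inner_diff_left)

text \<open>Polarization: the Wiener property prescribes variances only, and the covariance is read
  off from the variance in direction \<open>v + u\<close>.\<close>

lemma incr_cov_same:
  assumes "0 \<le> s" "s \<le> t" "v \<in> V" "u \<in> V"
  shows "expectation (\<lambda>\<omega>. incr s t v \<omega> * incr s t u \<omega>) = (t - s) * inner (Qh v) (Qh u)"
proof -
  have vu: "v + u \<in> V" using assms V_subspace by (simp add: subspace_add)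
  note i = incr_moments(3,4)[OF assms(1,2)] and m = incr_mult_integrable[OF assms(1,2,1,2,3,4)]
  have "(t - s) * (norm (Qh (v + u)))\<^sup>2 = expectation (\<lambda>\<omega>. (incr s t (v + u) \<omega>)\<^sup>2)"
    using i[OF vu] by simp
  also have "\<dots> = expectation (\<lambda>\<omega>. ((incr s t v \<omega>)\<^sup>2 + (incr s t u \<omega>)\<^sup>2) + 2 * (incr s t v \<omega> * incr s t u \<omega>))"
    by (rule Bochner_Integration.integral_cong) (simp_all add: incr_def inner_add_right power2_sum)
  also have "\<dots> = (t - s) * (norm (Qh v))\<^sup>2 + (t - s) * (norm (Qh u))\<^sup>2 + 2 * expectation (\<lambda>\<omega>. incr s t v \<omega> * incr s t u \<omega>)"
    using i[OF assms(3)] i[OF assms(4)] m by simp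
  finally show ?thesis
    by (simp add: Qh_add assms power2_norm_eq_inner inner_add_left inner_add_right inner_commute algebra_simps)
qed

text \<open>The longer increment is cut at the end of the shorter one; the remainder lies in the
  future of the shorter increment and contributes nothing.\<close>

lemma incr_cov_base:
  assumes "0 \<le> a" "a \<le> s" "a \<le> t" "v \<in> V" "u \<in> V"
  shows "expectation (\<lambda>\<omega>. incr a t v \<omega> * incr a s u \<omega>) = (min s t - a) * inner (Qh v) (Qh u)"
proof -
  have *: "expectation (\<lambda>\<omega>. incr a t v \<omega> * incr a s u \<omega>) = (s - a) * inner (Qh v) (Qh u)"
    if "a \<le> s" "s \<le> t" "v \<in> V" "u \<in> V" for s t v u
  proof -
    have "expectation (\<lambda>\<omega>. incr a t v \<omega> * incr a s u \<omega>)
        = expectation (\<lambda>\<omega>. incr a s v \<omega> * incr a s u \<omega> + incr a s u \<omega> * incr s t v \<omega>)"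
      by (rule Bochner_Integration.integral_cong) (simp_all add: incr_split[of a t v _ s] algebra_simps)
    also have "\<dots> = expectation (\<lambda>\<omega>. incr a s v \<omega> * incr a s u \<omega>) + expectation (\<lambda>\<omega>. incr a s u \<omega> * incr s t v \<omega>)"
      using assms(1) that by (intro Bochner_Integration.integral_add incr_mult_integrable) auto
    also have "expectation (\<lambda>\<omega>. incr a s u \<omega> * incr s t v \<omega>) = 0"
      using assms(1) that by (intro incr_indep incr_adapted incr_moments(1)) auto
    finally show ?thesis using incr_cov_same[OF assms(1) that(1,3,4)] by simp
  qed
  show ?thesis
  proof (cases "s \<le> t")
    case True
    then show ?thesis using *[of s t v u] assms by (simp add: min_def)
  next
    case False
    then show ?thesis using *[of t s u v] assms by (simp add: min_def mult.commute inner_commute)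
  qed
qed

lemma integral_indicator_Ioc:
  fixes a s t :: real
  assumes "a \<le> s" "a \<le> t"
  shows "integrable lborel (\<lambda>r. indicator {a<..s} r * indicator {a<..t} r :: real)"
    and "(\<integral>r. indicator {a<..s} r * indicator {a<..t} r \<partial>lborel) = min s t - a"
proof -
  have *: "(\<lambda>r. indicator {a<..s} r * indicator {a<..t} r :: real) = indicator {a<..min s t}"
    by (auto simp: indicator_def)
  show "integrable lborel (\<lambda>r. indicator {a<..s} r * indicator {a<..t} r :: real)"
    unfolding * using assms by (intro integrable_real_indicator) simp_all
  show "(\<integral>r. indicator {a<..s} r * indicator {a<..t} r \<partial>lborel) = min s t - a"
    unfolding * using assms by simp
qed

lemma indicator_Ioc_diff:
  fixes a s t :: real
  shows "a \<le> s \<Longrightarrow> s \<le> t \<Longrightarrow> indicator {s<..t} r = (indicator {a<..t} r - indicator {a<..s} r :: real)"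
  by (auto simp: indicator_def)

text \<open>Both sides are bilinear in the intervals, so each interval is written as a difference of
  intervals starting at 0. The overlap length is kept as an integral of indicators, the form in
  which the double sum of the isometry can be interchanged with integration.\<close>

lemma incr_cov:
  assumes "0 \<le> s" "s \<le> t" "0 \<le> s'" "s' \<le> t'" "v \<in> V" "u \<in> V"
  shows "integrable lborel (\<lambda>r. indicator {s<..t} r * indicator {s'<..t'} r * inner (Qh v) (Qh u))"
    and "expectation (\<lambda>\<omega>. incr s t v \<omega> * incr s' t' u \<omega>)
      = (\<integral>r. indicator {s<..t} r * indicator {s'<..t'} r * inner (Qh v) (Qh u) \<partial>lborel)"
proof -
  let ?b = "\<lambda>t. indicator {0<..t} :: real \<Rightarrow> real"
  have ind: "indicator {s<..t} r * indicator {s'<..t'} r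
      = ?b t r * ?b t' r - ?b t r * ?b s' r - ?b s r * ?b t' r + ?b s r * ?b s' r" for r
    unfolding indicator_Ioc_diff[OF assms(1,2), of r] indicator_Ioc_diff[OF assms(3,4), of r]
    by (simp add: algebra_simps)
  note int = integral_indicator_Ioc[of 0]
  have t: "0 \<le> t" "0 \<le> t'" using assms by auto
  show "integrable lborel (\<lambda>r. indicator {s<..t} r * indicator {s'<..t'} r * inner (Qh v) (Qh u))"
    unfolding ind using assms t int by (intro integrable_mult_left Bochner_Integration.integrable_add Bochner_Integration.integrable_diff) auto
  have I: "(\<integral>r. indicator {s<..t} r * indicator {s'<..t'} r \<partial>lborel)
      = min t t' - min t s' - min s t' + min s s'"
    unfolding ind using assms t int by simp
  have sp: "incr s t v \<omega> = incr 0 t v \<omega> - incr 0 s v \<omega>" for s t v \<omega>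
    by (simp add: incr_def inner_diff_left)
  have "expectation (\<lambda>\<omega>. incr s t v \<omega> * incr s' t' u \<omega>)
     = expectation (\<lambda>\<omega>. incr 0 t v \<omega> * incr 0 t' u \<omega> - incr 0 t v \<omega> * incr 0 s' u \<omega>
        - incr 0 s v \<omega> * incr 0 t' u \<omega> + incr 0 s v \<omega> * incr 0 s' u \<omega>)"
    by (rule Bochner_Integration.integral_cong) (simp_all add: sp[of s] sp[of s'] algebra_simps)
  also have "\<dots> = (min t t' - min t s' - min s t' + min s s') * inner (Qh v) (Qh u)"
    using assms t
    by (simp add: incr_mult_integrable incr_cov_base min.commute inner_commute[of "Qh u"] algebra_simps)
  finally show "expectation (\<lambda>\<omega>. incr s t v \<omega> * incr s' t' u \<omega>)
      = (\<integral>r. indicator {s<..t} r * indicator {s'<..t'} r * inner (Qh v) (Qh u) \<partial>lborel)"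
    using I by simp
qed

text \<open>The intervals may overlap. This allows the difference of two step integrals over
  unrelated partitions to be treated as a single sum, without a common refinement.\<close>

lemma incr_isometry:
  assumes I: "finite I" "\<And>i. i \<in> I \<Longrightarrow> 0 \<le> s i \<and> s i \<le> t i" "\<And>i. i \<in> I \<Longrightarrow> v i \<in> V"
  shows "(\<integral>\<^sup>+\<omega>. ennreal ((\<Sum>i\<in>I. incr (s i) (t i) (v i) \<omega>)\<^sup>2) \<partial>P)
    = (\<integral>\<^sup>+r. ennreal ((norm (\<Sum>i\<in>I. indicator {s i<..t i} r *\<^sub>R Qh (v i)))\<^sup>2) \<partial>lborel)"
proof -
  have e1: "(\<Sum>i\<in>I. incr (s i) (t i) (v i) \<omega>)\<^sup>2 = (\<Sum>i\<in>I. \<Sum>j\<in>I. incr (s i) (t i) (v i) \<omega> * incr (s j) (t j) (v j) \<omega>)" for \<omega>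
    by (simp add: power2_eq_square sum_product)
  have e2: "(norm (\<Sum>i\<in>I. indicator {s i<..t i} r *\<^sub>R Qh (v i)))\<^sup>2
      = (\<Sum>i\<in>I. \<Sum>j\<in>I. indicator {s i<..t i} r * indicator {s j<..t j} r * inner (Qh (v i)) (Qh (v j)))" for r :: real
    unfolding power2_norm_eq_inner inner_sum_left unfolding inner_sum_right by (simp add: mult_ac)
  have m1: "integrable P (\<lambda>\<omega>. incr (s i) (t i) (v i) \<omega> * incr (s j) (t j) (v j) \<omega>)"
    and m2: "integrable lborel (\<lambda>r. indicator {s i<..t i} r * indicator {s j<..t j} r * inner (Qh (v i)) (Qh (v j)))"
    and m3: "expectation (\<lambda>\<omega>. incr (s i) (t i) (v i) \<omega> * incr (s j) (t j) (v j) \<omega>)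
      = (\<integral>r. indicator {s i<..t i} r * indicator {s j<..t j} r * inner (Qh (v i)) (Qh (v j)) \<partial>lborel)"
    if "i \<in> I" "j \<in> I" for i j
    using I(2)[OF that(1)] I(2)[OF that(2)] I(3)[OF that(1)] I(3)[OF that(2)]
    by (simp_all only: incr_mult_integrable incr_cov)
  have i1: "integrable P (\<lambda>\<omega>. (\<Sum>i\<in>I. incr (s i) (t i) (v i) \<omega>)\<^sup>2)"
    unfolding e1 by (intro Bochner_Integration.integrable_sum m1)
  have i2: "integrable lborel (\<lambda>r. (norm (\<Sum>i\<in>I. indicator {s i<..t i} r *\<^sub>R Qh (v i)))\<^sup>2)"
    unfolding e2 by (intro Bochner_Integration.integrable_sum m2)
  have "expectation (\<lambda>\<omega>. (\<Sum>i\<in>I. incr (s i) (t i) (v i) \<omega>)\<^sup>2)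
      = (\<Sum>i\<in>I. expectation (\<lambda>\<omega>. \<Sum>j\<in>I. incr (s i) (t i) (v i) \<omega> * incr (s j) (t j) (v j) \<omega>))"
    unfolding e1 by (intro Bochner_Integration.integral_sum Bochner_Integration.integrable_sum m1)
  also have "\<dots> = (\<Sum>i\<in>I. \<Sum>j\<in>I. expectation (\<lambda>\<omega>. incr (s i) (t i) (v i) \<omega> * incr (s j) (t j) (v j) \<omega>))"
    by (intro sum.cong refl Bochner_Integration.integral_sum m1)
  also have "\<dots> = (\<Sum>i\<in>I. \<Sum>j\<in>I. \<integral>r. indicator {s i<..t i} r * indicator {s j<..t j} r * inner (Qh (v i)) (Qh (v j)) \<partial>lborel)"
    by (intro sum.cong refl m3)
  also have "\<dots> = (\<Sum>i\<in>I. \<integral>r. (\<Sum>j\<in>I. indicator {s i<..t i} r * indicator {s j<..t j} r * inner (Qh (v i)) (Qh (v j))) \<partial>lborel)"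
    by (intro sum.cong refl Bochner_Integration.integral_sum[symmetric] m2)
  also have "\<dots> = (\<integral>r. (norm (\<Sum>i\<in>I. indicator {s i<..t i} r *\<^sub>R Qh (v i)))\<^sup>2 \<partial>lborel)"
    unfolding e2 by (intro Bochner_Integration.integral_sum[symmetric] Bochner_Integration.integrable_sum m2)
  finally show ?thesis
    using i1 i2 by (subst (1 2) nn_integral_eq_integral) auto
qed

end

section \<open>Orthonormal expansions and bounded functionals of the noise\<close>

lemma span_range_finite:
  assumes "y \<in> span (range (e :: nat \<Rightarrow> 'u::real_vector))"
  obtains m where "y \<in> span (e ` {..<m})"
proof -
  have "\<exists>m. y \<in> span (e ` {..<m})"
    using assms
  proof (induction rule: span_induct_alt)
    case base
    show ?case by (rule exI[of _ 0]) (simp add: span_zero)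
  next
    case (step c x y)
    then obtain k m where k: "x = e k" "y \<in> span (e ` {..<m})" by blast
    have "x \<in> span (e ` {..<max m (Suc k)})" unfolding k by (intro span_base) auto
    moreover have "y \<in> span (e ` {..<max m (Suc k)})"
      using k(2) by (rule subsetD[OF span_mono, rotated]) auto
    ultimately show ?case by (meson span_add span_scale)
  qed
  then show ?thesis using that by blast
qed

text \<open>By Pythagoras the partial sum approximates \<open>u\<close> at least as well as any
  element of the span of the first \<open>n\<close> basis vectors, and density provides one good
  element.\<close>

lemma orthonormal_expansion:
  fixes e :: "nat \<Rightarrow> 'u::real_inner"
  assumes onb: "orthonormal_basis V e" and u: "u \<in> V"
  shows "(\<lambda>n. \<Sum>i<n. inner u (e i) *\<^sub>R e i) \<longlonglongrightarrow> u"
proof (rule LIMSEQ_I)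
  fix r :: real assume "r > 0"
  have on: "inner (e i) (e j) = (if i = j then 1 else 0)" for i j
    using onb by (simp add: orthonormal_basis_def)
  have "u \<in> closure (span (range e))" using onb u by (auto simp: orthonormal_basis_def)
  then obtain y where y: "y \<in> span (range e)" "dist y u < r"
    using \<open>r > 0\<close> by (auto simp: closure_approachable)
  obtain m where m: "y \<in> span (e ` {..<m})" using y(1) by (rule span_range_finite)
  show "\<exists>no. \<forall>n\<ge>no. norm ((\<Sum>i<n. inner u (e i) *\<^sub>R e i) - u) < r"
  proof (intro exI[of _ m] allI impI)
    fix n assume "n \<ge> m"
    let ?z = "\<Sum>i<n. inner u (e i) *\<^sub>R e i"
    have yn: "y \<in> span (e ` {..<n})"
      using m by (rule subsetD[OF span_mono, rotated]) (use \<open>n \<ge> m\<close> in auto)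
    have zn: "?z \<in> span (e ` {..<n})" by (intro span_sum span_scale span_base) auto
    have "orthogonal (u - ?z) (?z - y)"
    proof (rule orthogonal_to_span)
      show "?z - y \<in> span (e ` {..<n})" by (intro span_diff zn yn)
      show "orthogonal (u - ?z) v" if "v \<in> e ` {..<n}" for v
        using that by (auto simp: orthogonal_def inner_diff_left inner_sum_left on if_distrib sum.delta cong: if_cong)
    qed
    then have "(norm ((u - ?z) + (?z - y)))\<^sup>2 = (norm (u - ?z))\<^sup>2 + (norm (?z - y))\<^sup>2"
      by (rule norm_add_Pythagorean)
    then have "(norm (u - ?z))\<^sup>2 \<le> (norm (u - y))\<^sup>2" by simp
    then have "norm (u - ?z) \<le> norm (u - y)" by (rule power2_le_imp_le) simp
    then show "norm (?z - u) < r" using y(2) by (simp add: dist_norm norm_minus_commute)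
  qed
qed

context Q_wiener
begin

abbreviation functional :: "('u \<Rightarrow> real) \<Rightarrow> bool" where
  "functional l \<equiv> bounded_operator V UNIV l"

definition trunc :: "('u \<Rightarrow> real) \<Rightarrow> nat \<Rightarrow> 'u" where
  "trunc l n = (\<Sum>i<n. l (e i) *\<^sub>R e i)"

lemma functional_bound:
  assumes "functional l"
  obtains K where "K \<ge> 0" "\<And>u. u \<in> V \<Longrightarrow> \<bar>l u\<bar> \<le> K * norm u"
proof -
  obtain K where K: "\<forall>u\<in>V. \<bar>l u\<bar> \<le> K * norm u"
    using assms by (auto simp: bounded_operator_def)
  have "\<bar>l u\<bar> \<le> \<bar>K\<bar> * norm u" if "u \<in> V" for u
    using bspec[OF K that] mult_right_mono[OF abs_ge_self[of K] norm_ge_zero[of u]] by linarith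
  then show ?thesis using that[of "\<bar>K\<bar>"] by simp
qed

lemma functional_add: "functional l \<Longrightarrow> u \<in> V \<Longrightarrow> v \<in> V \<Longrightarrow> l (u + v) = l u + l v"
  and functional_scale: "functional l \<Longrightarrow> u \<in> V \<Longrightarrow> l (c *\<^sub>R u) = c * l u"
  by (simp_all add: bounded_operator_def)

lemma functional_diff:
  assumes "functional l" "u \<in> V" "v \<in> V"
  shows "l (u - v) = l u - l v"
  using functional_add[OF assms(1,2) subspace_scale[OF V_subspace assms(3)], of "-1"]
    functional_scale[OF assms(1,3), of "-1"] by simp

lemma functional_sum:
  assumes "functional l" "finite I" "\<And>i. i \<in> I \<Longrightarrow> u i \<in> V"
  shows "l (\<Sum>i\<in>I. c i *\<^sub>R u i) = (\<Sum>i\<in>I. c i * l (u i))"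
  using assms(2,3)
proof (induction I rule: finite_induct)
  case empty
  show ?case using functional_scale[OF assms(1) subspace_0[OF V_subspace], of 0] by simp
next
  case (insert i I)
  have i: "c i *\<^sub>R u i \<in> V" "(\<Sum>i\<in>I. c i *\<^sub>R u i) \<in> V"
    using insert.prems V_subspace by (auto intro!: subspace_sum subspace_scale)
  show ?case
    using functional_add[OF assms(1) i] functional_scale[OF assms(1), of "u i" "c i"] insert by simp
qed

lemma functional_Qh:
  assumes "functional l"
  shows "functional (\<lambda>u. l (Qh u))"
proof -
  obtain K where K: "K \<ge> 0" "\<And>u. u \<in> V \<Longrightarrow> \<bar>l u\<bar> \<le> K * norm u"
    using functional_bound[OF assms] by blast
  obtain KQ where KQ: "KQ \<ge> 0" "\<And>u. u \<in> V \<Longrightarrow> norm (Qh u) \<le> KQ * norm u"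
    using Qh_bounded by blast
  have "norm (l (Qh u)) \<le> (K * KQ) * norm u" if "u \<in> V" for u
    using K(2)[OF Qh_in_V[OF that]] mult_left_mono[OF KQ(2)[OF that] K(1)] by (simp add: mult.assoc)
  moreover have "l (Qh (u + v)) = l (Qh u) + l (Qh v)" if "u \<in> V" "v \<in> V" for u v
    using functional_add[OF assms] that by (simp add: Qh_add Qh_in_V)
  moreover have "l (Qh (c *\<^sub>R u)) = c *\<^sub>R l (Qh u)" if "u \<in> V" for u c
    using functional_scale[OF assms Qh_in_V[OF that], of c] by (simp add: Qh_scale[OF that])
  ultimately show ?thesis unfolding bounded_operator_def by blast
qed

lemma functional_combination:
  assumes "finite I" "\<And>i. i \<in> I \<Longrightarrow> functional (l i)"
  shows "functional (\<lambda>u. \<Sum>i\<in>I. c i * l i u)"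
proof -
  have "\<forall>i\<in>I. \<exists>K. \<forall>u\<in>V. \<bar>l i u\<bar> \<le> K * norm u"
    using assms(2) by (auto simp: bounded_operator_def)
  then obtain K where K: "\<And>i u. i \<in> I \<Longrightarrow> u \<in> V \<Longrightarrow> \<bar>l i u\<bar> \<le> K i * norm u" by metis
  have "norm (\<Sum>i\<in>I. c i * l i u) \<le> (\<Sum>i\<in>I. \<bar>c i\<bar> * K i) * norm u" if "u \<in> V" for u
  proof -
    have "norm (\<Sum>i\<in>I. c i * l i u) \<le> (\<Sum>i\<in>I. \<bar>c i\<bar> * (K i * norm u))"
      by (rule order.trans[OF norm_sum]) (auto intro!: sum_mono mult_left_mono K that simp: abs_mult)
    then show ?thesis by (simp add: sum_distrib_right mult.assoc)
  qed
  moreover have "(\<Sum>i\<in>I. c i * l i (u + v)) = (\<Sum>i\<in>I. c i * l i u) + (\<Sum>i\<in>I. c i * l i v)" if "u \<in> V" "v \<in> V" for u v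
    unfolding sum.distrib[symmetric]
    by (intro sum.cong refl) (simp add: functional_add assms(2) that distrib_left)
  moreover have "(\<Sum>i\<in>I. c i * l i (r *\<^sub>R u)) = r *\<^sub>R (\<Sum>i\<in>I. c i * l i u)" if "u \<in> V" for u r
    unfolding scaleR_sum_right
    by (intro sum.cong refl) (simp add: functional_scale assms(2) that)
  ultimately show ?thesis unfolding bounded_operator_def by blast
qed

lemma trunc_in_V: "trunc l n \<in> V"
  unfolding trunc_def by (intro subspace_sum subspace_scale V_subspace e_in_V)

text \<open>Pairing \<open>u\<close> with the truncation is the same as applying \<open>l\<close> to
  the partial sum of the expansion of \<open>u\<close>, and \<open>l\<close> is bounded on
  \<open>V\<close>.\<close>

lemma trunc_limit:
  assumes "functional l" "u \<in> V"
  shows "(\<lambda>n. inner u (trunc l n)) \<longlonglongrightarrow> l u"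
proof -
  obtain K where K: "K \<ge> 0" "\<And>u. u \<in> V \<Longrightarrow> \<bar>l u\<bar> \<le> K * norm u"
    using functional_bound[OF assms(1)] by blast
  define z where "z n = (\<Sum>i<n. inner u (e i) *\<^sub>R e i)" for n
  have zV: "z n \<in> V" for n unfolding z_def by (intro subspace_sum subspace_scale V_subspace e_in_V)
  have eq: "inner u (trunc l n) = l (z n)" for n
    unfolding z_def by (subst functional_sum[OF assms(1)]) (auto simp: e_in_V trunc_def inner_sum_right mult.commute)
  have "(\<lambda>n. K * norm (z n - u)) \<longlonglongrightarrow> 0"
    using orthonormal_expansion[OF e_basis assms(2)] unfolding z_def[symmetric]
    by (intro tendsto_mult_right_zero tendsto_norm_zero) (simp add: LIM_zero)
  moreover have "norm (l (z n) - l u) \<le> K * norm (z n - u)" for n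
    using K(2)[of "z n - u"] functional_diff[OF assms(1) zV assms(2)] subspace_diff[OF V_subspace zV assms(2)] by simp
  ultimately have "(\<lambda>n. l (z n) - l u) \<longlonglongrightarrow> 0"
    by (intro Lim_null_comparison[of "\<lambda>n. l (z n) - l u"] always_eventually allI)
  then show ?thesis unfolding eq by (rule LIM_zero_cancel)
qed

lemma inner_sum_e: "inner (\<Sum>i<n. a i *\<^sub>R e i) (\<Sum>i<m. b i *\<^sub>R e i) = (\<Sum>i<min n m. a i * b i)"
proof -
  have "inner (\<Sum>i<n. a i *\<^sub>R e i) (\<Sum>i<m. b i *\<^sub>R e i) = (\<Sum>i<n. if i < m then a i * b i else 0)"
    unfolding inner_sum_left
    by (simp add: inner_sum_right e_orthonormal if_distrib sum.delta mult.commute cong: if_cong)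
  also have "\<dots> = (\<Sum>i\<in>{..<n} \<inter> {i. i < m}. a i * b i)"
    by (subst sum.inter_filter[symmetric]) (auto simp: Int_def)
  also have "{..<n} \<inter> {i. i < m} = {..<min n m}" by auto
  finally show ?thesis .
qed

lemma trunc_norm: "(norm (trunc l n))\<^sup>2 = (\<Sum>i<n. (l (e i))\<^sup>2)"
  unfolding power2_norm_eq_inner trunc_def inner_sum_e by (simp add: power2_eq_square)

text \<open>Evaluated at its own truncation, \<open>l\<close> gives the squared norm of the
  truncation; one factor cancels.\<close>

lemma trunc_bounded:
  assumes "functional l" "K \<ge> 0" "\<And>u. u \<in> V \<Longrightarrow> \<bar>l u\<bar> \<le> K * norm u"
  shows "norm (trunc l n) \<le> K"
proof -
  have "l (trunc l n) = (\<Sum>i<n. (l (e i))\<^sup>2)"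
    unfolding trunc_def by (subst functional_sum[OF assms(1)]) (auto simp: e_in_V power2_eq_square)
  then have "norm (trunc l n) * norm (trunc l n) \<le> K * norm (trunc l n)"
    using assms(3)[OF trunc_in_V[of l n]] trunc_norm[of l n] by (simp add: power2_eq_square)
  then show ?thesis using assms(2) by (cases "norm (trunc l n) = 0") auto
qed

text \<open>The previous bound makes the squared coefficients summable, and squared distances of
  truncations are differences of their partial sums.\<close>

lemma trunc_Cauchy:
  assumes "functional l"
  shows "Cauchy (trunc l)"
proof -
  obtain K where K: "K \<ge> 0" "\<And>u. u \<in> V \<Longrightarrow> \<bar>l u\<bar> \<le> K * norm u"
    using functional_bound[OF assms] by blast
  define S where "S n = (\<Sum>i<n. (l (e i))\<^sup>2)" for n
  have "summable (\<lambda>i. (l (e i))\<^sup>2)"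
  proof (rule bounded_imp_summable)
    show "(\<Sum>i\<le>n. (l (e i))\<^sup>2) \<le> K\<^sup>2" for n
      using power_mono[OF trunc_bounded[OF assms K] norm_ge_zero, of "Suc n" 2]
      by (simp add: trunc_norm lessThan_Suc_atMost)
  qed simp
  then have "Cauchy S"
    unfolding S_def by (intro LIMSEQ_imp_Cauchy) (rule summable_LIMSEQ)
  have d: "(norm (trunc l m - trunc l n))\<^sup>2 = \<bar>S m - S n\<bar>" for m n
  proof -
    have "(norm (trunc l m - trunc l n))\<^sup>2 = S m + S n - 2 * S (min m n)"
      unfolding power2_norm_eq_inner trunc_def inner_diff_left inner_diff_right inner_sum_e S_def
      by (simp add: power2_eq_square min.commute)
    moreover have "S m \<le> S n" if "m \<le> n" for m n
      unfolding S_def using that by (intro sum_mono2) auto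
    ultimately show ?thesis by (cases "m \<le> n") (auto simp: min_def)
  qed
  show ?thesis
  proof (rule CauchyI)
    fix r :: real assume "r > 0"
    then obtain M where M: "\<And>m n. m \<ge> M \<Longrightarrow> n \<ge> M \<Longrightarrow> \<bar>S m - S n\<bar> < r\<^sup>2"
      using CauchyD[OF \<open>Cauchy S\<close>, of "r\<^sup>2"] by auto
    show "\<exists>M. \<forall>m\<ge>M. \<forall>n\<ge>M. norm (trunc l m - trunc l n) < r"
      using M d \<open>r > 0\<close> by (intro exI[of _ M] allI impI power2_less_imp_less[of _ r]) auto
  qed
qed

text \<open>Cauchy-Schwarz for the truncations of the composed functional. The exact constant
  matters, because it becomes the right-hand side of the Ito estimate.\<close>

lemma functional_Qh_le:
  assumes l: "functional l" and sm: "summable (\<lambda>i. (l (Qh (e i)))\<^sup>2)" and u: "u \<in> V"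
  shows "\<bar>l (Qh u)\<bar> \<le> sqrt (\<Sum>i. (l (Qh (e i)))\<^sup>2) * norm u"
proof -
  let ?l = "\<lambda>u. l (Qh u)" and ?a = "\<Sum>i. (l (Qh (e i)))\<^sup>2"
  have a: "?a \<ge> 0" by (intro suminf_nonneg sm) simp
  have "\<bar>inner u (trunc ?l n)\<bar> \<le> sqrt ?a * norm u" for n
  proof -
    have "norm (trunc ?l n) \<le> sqrt ?a"
      unfolding real_le_rsqrt[OF eq_refl[OF trunc_norm]]
      by (rule real_le_rsqrt) (use sum_le_suminf[OF sm, of "{..<n}"] in \<open>simp add: trunc_norm\<close>)
    then have "norm u * norm (trunc ?l n) \<le> norm u * sqrt ?a" by (intro mult_left_mono) auto
    then show ?thesis using Cauchy_Schwarz_ineq2[of u "trunc ?l n"] by (simp add: mult.commute)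
  qed
  then show ?thesis
    using trunc_limit[OF functional_Qh[OF l] u] by (intro LIMSEQ_le_const2[OF tendsto_rabs]) auto
qed

text \<open>\<open>trunc l n\<close> approximates the Riesz representative of \<open>l\<close>, which need not exist in \<open>V\<close>
  since \<open>V\<close> is not known to be complete.\<close>

lemma Qh_trunc_limit:
  assumes l: "functional l"
  obtains r where "(\<lambda>n. norm (Qh (trunc l n))) \<longlonglongrightarrow> r"
    and "ennreal (r\<^sup>2) \<le> (\<Sum>i. ennreal ((l (Qh (e i)))\<^sup>2))"
proof -
  obtain K where K: "K \<ge> 0" "\<And>u. u \<in> V \<Longrightarrow> norm (Qh u) \<le> K * norm u"
    using Qh_bounded by blast
  define x where "x n = Qh (trunc l n)" for n
  have xV: "x n \<in> V" for n by (simp add: x_def Qh_in_V trunc_in_V)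
  have diff: "norm (x m - x n) \<le> K * norm (trunc l m - trunc l n)" for m n
  proof -
    have "x m - x n = Qh (trunc l m - trunc l n)"
      using Qh_add[OF trunc_in_V subspace_scale[OF V_subspace trunc_in_V], of l m "-1" l n] Qh_scale[OF trunc_in_V, of "-1" l n]
      by (simp add: x_def)
    then show ?thesis using K(2) subspace_diff[OF V_subspace trunc_in_V trunc_in_V] by simp
  qed
  have "Cauchy x"
  proof (rule CauchyI)
    fix r :: real assume "r > 0"
    then obtain M where M: "\<And>m n. m \<ge> M \<Longrightarrow> n \<ge> M \<Longrightarrow> norm (trunc l m - trunc l n) < r / (K + 1)"
      using CauchyD[OF trunc_Cauchy[OF l], of "r / (K + 1)"] K(1) by auto
    have "norm (x m - x n) < r" if "m \<ge> M" "n \<ge> M" for m n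
    proof -
      have "norm (x m - x n) \<le> (K + 1) * norm (trunc l m - trunc l n)"
        using diff[of m n] by (simp add: distrib_right add_increasing2)
      also have "\<dots> < r" using M[OF that] K(1) by (simp add: pos_less_divide_eq mult.commute)
      finally show ?thesis .
    qed
    then show "\<exists>M. \<forall>m\<ge>M. \<forall>n\<ge>M. norm (x m - x n) < r" by blast
  qed
  have "Cauchy (\<lambda>n. norm (x n))"
  proof (rule CauchyI)
    fix r :: real assume "r > 0"
    then obtain M where M: "\<And>m n. m \<ge> M \<Longrightarrow> n \<ge> M \<Longrightarrow> norm (x m - x n) < r"
      using CauchyD[OF \<open>Cauchy x\<close>] by blast
    have "norm (norm (x m) - norm (x n)) < r" if "m \<ge> M" "n \<ge> M" for m n
      using M[OF that] norm_triangle_ineq3[of "x m" "x n"] by simp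
    then show "\<exists>M. \<forall>m\<ge>M. \<forall>n\<ge>M. norm (norm (x m) - norm (x n)) < r" by blast
  qed
  then obtain r where r: "(\<lambda>n. norm (x n)) \<longlonglongrightarrow> r"
    using Cauchy_convergent convergent_def by blast
  have "ennreal (r\<^sup>2) \<le> (\<Sum>i. ennreal ((l (Qh (e i)))\<^sup>2))"
  proof (cases "summable (\<lambda>i. (l (Qh (e i)))\<^sup>2)")
    case False
    have "(\<Sum>i. ennreal ((l (Qh (e i)))\<^sup>2)) = top"
    proof (rule ccontr)
      assume "(\<Sum>i. ennreal ((l (Qh (e i)))\<^sup>2)) \<noteq> top"
      then have "summable (\<lambda>i. (l (Qh (e i)))\<^sup>2)" by (intro summable_suminf_not_top) simp
      with False show False by (rule notE)
    qed
    then show ?thesis by (simp only: top_greatest)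
  next
    case True
    define a where "a = (\<Sum>i. (l (Qh (e i)))\<^sup>2)"
    have a: "a \<ge> 0" unfolding a_def by (intro suminf_nonneg True) simp
    \<comment> \<open>Up to \<open>norm (x n) * \<epsilon>\<close>, the squared norm of
      \<open>x n\<close> is its product with a later \<open>x m\<close>. Symmetry of
      \<open>Qh\<close> moves this onto \<open>trunc l m\<close>, the limit in \<open>m\<close> is
      \<open>l (Qh (x n))\<close>, and one factor \<open>norm (x n)\<close> is divided out.\<close>
    have "r \<le> sqrt a"
    proof (rule field_le_epsilon)
      fix \<epsilon> :: real assume "\<epsilon> > 0"
      then obtain M where M: "\<And>m n. m \<ge> M \<Longrightarrow> n \<ge> M \<Longrightarrow> norm (x m - x n) < \<epsilon>"
        using CauchyD[OF \<open>Cauchy x\<close>] by blast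
      have "norm (x n) \<le> sqrt a + \<epsilon>" if n: "n \<ge> M" for n
      proof -
        have "(\<lambda>m. inner (Qh (x n)) (trunc l m) + norm (x n) * \<epsilon>) \<longlonglongrightarrow> l (Qh (x n)) + norm (x n) * \<epsilon>"
          by (intro tendsto_intros trunc_limit l Qh_in_V xV)
        moreover have "(norm (x n))\<^sup>2 \<le> inner (Qh (x n)) (trunc l m) + norm (x n) * \<epsilon>" if "m \<ge> M" for m
        proof -
          have "(norm (x n))\<^sup>2 = inner (x n) (x m) + inner (x n) (x n - x m)"
            by (simp add: power2_norm_eq_inner inner_diff_right)
          also have "inner (x n) (x m) = inner (Qh (x n)) (trunc l m)"
            using Qh_sym[OF xV[of n] trunc_in_V[of l m]] by (simp add: x_def)
          also have "inner (x n) (x n - x m) \<le> norm (x n) * \<epsilon>"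
            using norm_cauchy_schwarz[of "x n" "x n - x m"] mult_left_mono[OF less_imp_le[OF M[OF n that]] norm_ge_zero[of "x n"]]
            by linarith
          finally show ?thesis by simp
        qed
        ultimately have "(norm (x n))\<^sup>2 \<le> l (Qh (x n)) + norm (x n) * \<epsilon>"
          by (intro LIMSEQ_le_const) auto
        also have "\<dots> \<le> (sqrt a + \<epsilon>) * norm (x n)"
          using functional_Qh_le[OF l True xV, of n] unfolding a_def[symmetric] by (simp add: algebra_simps)
        finally have "norm (x n) * norm (x n) \<le> (sqrt a + \<epsilon>) * norm (x n)" by (simp add: power2_eq_square)
        then show ?thesis using a \<open>\<epsilon> > 0\<close> by (cases "norm (x n) = 0") auto
      qed
      then show "r \<le> sqrt a + \<epsilon>" by (intro LIMSEQ_le_const2[OF r]) auto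
    qed
    moreover have "r \<ge> 0" by (intro LIMSEQ_le_const[OF r]) auto
    ultimately have "r\<^sup>2 \<le> (sqrt a)\<^sup>2" by (rule power_mono)
    then have "ennreal (r\<^sup>2) \<le> ennreal a" using a by (simp add: ennreal_leI)
    also have "ennreal a = (\<Sum>i. ennreal ((l (Qh (e i)))\<^sup>2))"
      unfolding a_def by (intro suminf_ennreal2[symmetric] True) simp
    finally show ?thesis .
  qed
  with r show ?thesis unfolding x_def by (rule that)
qed

text \<open>\<open>l\<close> is bounded only on \<open>V\<close>, so Borel measurability on the
  whole type is not at hand; the truncations give a pointwise limit of measurable
  increments.\<close>

lemma functional_measurable:
  assumes "functional l" "0 \<le> s" "s \<le> t"
  shows "(\<lambda>\<omega>. l (W t \<omega> - W s \<omega>)) \<in> borel_measurable P"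
proof (rule borel_measurable_LIMSEQ_real)
  show "(\<lambda>n. incr s t (trunc l n) \<omega>) \<longlonglongrightarrow> l (W t \<omega> - W s \<omega>)" if "\<omega> \<in> space P" for \<omega>
    unfolding incr_def using assms that by (intro trunc_limit W_diff_in_V) auto
qed (use assms in \<open>intro incr_measurable\<close>)

text \<open>The isometry holds for the truncations. In the limit Fatou's lemma acts on the
  probability side and dominated convergence on the time side; an inequality in this direction is
  what the later convergence and uniqueness arguments use.\<close>

lemma functional_ito_inequality:
  assumes I: "finite I" and st: "\<And>i. i \<in> I \<Longrightarrow> 0 \<le> s i \<and> s i \<le> t i" and l: "\<And>i. i \<in> I \<Longrightarrow> functional (l i)"
  shows "(\<integral>\<^sup>+\<omega>. ennreal ((\<Sum>i\<in>I. l i (W (t i) \<omega> - W (s i) \<omega>))\<^sup>2) \<partial>P)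
    \<le> (\<integral>\<^sup>+r. (\<Sum>k. ennreal ((\<Sum>i\<in>I. indicator {s i<..t i} r * l i (Qh (e k)))\<^sup>2)) \<partial>lborel)"
proof -
  define u where "u n r = ennreal ((norm (\<Sum>i\<in>I. indicator {s i<..t i} r *\<^sub>R Qh (trunc (l i) n)))\<^sup>2)" for n and r :: real
  define X where "X n \<omega> = (\<Sum>i\<in>I. incr (s i) (t i) (trunc (l i) n) \<omega>)" for n \<omega>
  \<comment> \<open>At a fixed time the combination of truncations is the truncation of one combined
    functional, so the single-functional limit applies.\<close>
  have uq: "u n r = ennreal ((norm (Qh (trunc (\<lambda>v. \<Sum>i\<in>I. indicator {s i<..t i} r * l i v) n)))\<^sup>2)" for n r
  proof -
    have "trunc (\<lambda>v. \<Sum>i\<in>I. indicator {s i<..t i} r * l i v) n = (\<Sum>i\<in>I. indicator {s i<..t i} r *\<^sub>R trunc (l i) n)"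
      unfolding trunc_def scaleR_sum_right scaleR_sum_left by (subst sum.swap) simp
    then show ?thesis by (simp only: u_def Qh_sum[OF I trunc_in_V])
  qed
  obtain KQ where KQ: "KQ \<ge> 0" "\<And>u. u \<in> V \<Longrightarrow> norm (Qh u) \<le> KQ * norm u"
    using Qh_bounded by blast
  have "\<forall>i\<in>I. \<exists>K. \<forall>n. norm (trunc (l i) n) \<le> K"
  proof
    fix i assume "i \<in> I"
    from functional_bound[OF l[OF this]] obtain K
      where "K \<ge> 0" "\<And>u. u \<in> V \<Longrightarrow> \<bar>l i u\<bar> \<le> K * norm u" by blast
    from trunc_bounded[OF l[OF \<open>i \<in> I\<close>] this]
    show "\<exists>K. \<forall>n. norm (trunc (l i) n) \<le> K" by (intro exI allI)
  qed
  from bchoice[OF this] obtain K where K: "\<And>i n. i \<in> I \<Longrightarrow> norm (trunc (l i) n) \<le> K i" by blast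
  have um [measurable]: "u n \<in> borel_measurable borel" for n
  proof -
    show ?thesis
      unfolding u_def[abs_def] power2_norm_eq_inner inner_sum_left
      unfolding inner_sum_right inner_scaleR_left inner_scaleR_right by measurable
  qed
  \<comment> \<open>The sum of the nonnegative endpoints is a convenient common upper bound for all
    intervals.\<close>
  define b where "b = (\<Sum>i\<in>I. t i)"
  have b: "t i \<le> b" if "i \<in> I" for i
    unfolding b_def
  proof (rule member_le_sum[OF that _ I])
    show "0 \<le> t j" if "j \<in> I - {i}" for j using st[of j] that by simp
  qed
  define w where "w r = ennreal ((\<Sum>i\<in>I. KQ * K i)\<^sup>2) * indicator {0..b} r" for r :: real
  have bound: "u n r \<le> w r" for n r
  proof (cases "r \<in> {0..b}")
    case True
    have "norm (\<Sum>i\<in>I. indicator {s i<..t i} r *\<^sub>R Qh (trunc (l i) n)) \<le> (\<Sum>i\<in>I. KQ * K i)"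
    proof (rule order.trans[OF norm_sum sum_mono])
      fix i assume i: "i \<in> I"
      have "norm (Qh (trunc (l i) n)) \<le> KQ * K i"
        using KQ(2)[OF trunc_in_V[of "l i" n]] mult_left_mono[OF K[OF i] KQ(1)] by (rule order.trans)
      with order.trans[OF norm_ge_zero this]
      show "norm (indicator {s i<..t i} r *\<^sub>R Qh (trunc (l i) n)) \<le> KQ * K i"
        by (simp add: indicator_def)
    qed
    then show ?thesis using True by (simp add: u_def w_def ennreal_leI power_mono)
  next
    case False
    have "r \<notin> {s i<..t i}" if "i \<in> I" for i
      using False st[OF that] b[OF that] by auto
    then have "(\<Sum>i\<in>I. indicator {s i<..t i} r *\<^sub>R Qh (trunc (l i) n)) = 0"
      by (intro sum.neutral ballI) (simp add: indicator_def)
    then show ?thesis by (simp add: u_def)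
  qed
  have conv: "\<exists>c. (\<lambda>n. u n r) \<longlonglongrightarrow> c \<and> c \<le> (\<Sum>k. ennreal ((\<Sum>i\<in>I. indicator {s i<..t i} r * l i (Qh (e k)))\<^sup>2))" for r
  proof -
    let ?l = "\<lambda>v. \<Sum>i\<in>I. indicator {s i<..t i} r * l i v"
    have "functional ?l" by (intro functional_combination I l)
    then obtain c where c: "(\<lambda>n. norm (Qh (trunc ?l n))) \<longlonglongrightarrow> c" "ennreal (c\<^sup>2) \<le> (\<Sum>i. ennreal ((?l (Qh (e i)))\<^sup>2))"
      by (rule Qh_trunc_limit)
    have "(\<lambda>n. u n r) \<longlonglongrightarrow> ennreal (c\<^sup>2)"
      unfolding uq by (intro tendsto_ennrealI tendsto_power c)
    with c(2) show ?thesis by blast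
  qed
  \<comment> \<open>The limit exists at every \<open>r\<close>; taking it as a lower limit makes it
    visibly measurable.\<close>
  define u' where "u' r = liminf (\<lambda>n. u n r)" for r
  have u': "(\<lambda>n. u n r) \<longlonglongrightarrow> u' r" "u' r \<le> (\<Sum>k. ennreal ((\<Sum>i\<in>I. indicator {s i<..t i} r * l i (Qh (e k)))\<^sup>2))" for r
  proof -
    obtain c where c: "(\<lambda>n. u n r) \<longlonglongrightarrow> c"
      "c \<le> (\<Sum>k. ennreal ((\<Sum>i\<in>I. indicator {s i<..t i} r * l i (Qh (e k)))\<^sup>2))"
      using conv[of r] by blast
    have "u' r = c" unfolding u'_def by (rule lim_imp_Liminf[OF sequentially_bot c(1)])
    with c show "(\<lambda>n. u n r) \<longlonglongrightarrow> u' r"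
      "u' r \<le> (\<Sum>k. ennreal ((\<Sum>i\<in>I. indicator {s i<..t i} r * l i (Qh (e k)))\<^sup>2))" by simp_all
  qed
  have lim: "(\<lambda>n. \<integral>\<^sup>+r. u n r \<partial>lborel) \<longlonglongrightarrow> (\<integral>\<^sup>+r. u' r \<partial>lborel)"
  proof (rule nn_integral_dominated_convergence[where w=w])
    show "(\<integral>\<^sup>+r. w r \<partial>lborel) < \<infinity>"
      unfolding w_def by (simp add: nn_integral_cmult ennreal_mult_less_top emeasure_lborel_Icc_eq)
    show "u' \<in> borel_measurable lborel" "w \<in> borel_measurable lborel"
      unfolding u'_def[abs_def] w_def[abs_def] by measurable
  qed (use bound u'(1) in simp_all)
  have isom: "(\<integral>\<^sup>+\<omega>. ennreal ((X n \<omega>)\<^sup>2) \<partial>P) = (\<integral>\<^sup>+r. u n r \<partial>lborel)" for n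
    unfolding X_def u_def using st by (intro incr_isometry I trunc_in_V) auto
  have Xm [measurable]: "X n \<in> borel_measurable P" for n
    unfolding X_def[abs_def] using st by (intro borel_measurable_sum incr_measurable) auto
  have Xlim: "(\<lambda>n. X n \<omega>) \<longlonglongrightarrow> (\<Sum>i\<in>I. l i (W (t i) \<omega> - W (s i) \<omega>))" if "\<omega> \<in> space P" for \<omega>
    unfolding X_def incr_def
  proof (intro tendsto_sum trunc_limit l W_diff_in_V)
    fix i assume "i \<in> I"
    from st[OF this] show "0 \<le> s i" "0 \<le> t i" by simp_all
  qed (use that in simp_all)
  have "(\<integral>\<^sup>+\<omega>. ennreal ((\<Sum>i\<in>I. l i (W (t i) \<omega> - W (s i) \<omega>))\<^sup>2) \<partial>P)
      = (\<integral>\<^sup>+\<omega>. liminf (\<lambda>n. ennreal ((X n \<omega>)\<^sup>2)) \<partial>P)"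
    by (intro nn_integral_cong lim_imp_Liminf[OF sequentially_bot, symmetric] tendsto_ennrealI tendsto_power Xlim)
  also have "\<dots> \<le> liminf (\<lambda>n. \<integral>\<^sup>+\<omega>. ennreal ((X n \<omega>)\<^sup>2) \<partial>P)"
    by (rule nn_integral_liminf) measurable
  also have "\<dots> = (\<integral>\<^sup>+r. u' r \<partial>lborel)"
    unfolding isom by (rule lim_imp_Liminf[OF sequentially_bot lim])
  also have "\<dots> \<le> (\<integral>\<^sup>+r. (\<Sum>k. ennreal ((\<Sum>i\<in>I. indicator {s i<..t i} r * l i (Qh (e k)))\<^sup>2)) \<partial>lborel)"
    by (intro nn_integral_mono u')
  finally show ?thesis .
qed

end

section \<open>Existence and almost sure uniqueness of the stochastic integral\<close>

lemma has_stochastic_integral_stochastic_integral: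
  assumes "has_stochastic_integral P V H e Qh W G a b J"
  shows "has_stochastic_integral P V H e Qh W G a b (stochastic_integral P V H e Qh W G a b)"
  unfolding stochastic_integral_def by (rule someI[of "has_stochastic_integral P V H e Qh W G a b", OF assms])

text \<open>\<open>B\<close> plays the role of a finite orthonormal basis of \<open>H\<close>.
  Parseval's identity, stated as \<open>H_norm\<close>, reduces vector-valued estimates to finitely
  many scalar functionals.\<close>

locale Q_wiener_integral = Q_wiener P F V e Q Qh W
  for P :: "'w measure" and F and V :: "'u::real_inner set" and e Q Qh W +
  fixes H :: "'h::real_inner set" and B :: "'h set" and a b :: real and G :: "real \<Rightarrow> 'u \<Rightarrow> 'h"
  assumes ab: "0 \<le> a" "a \<le> b"
    and H_subspace: "subspace H" and B_finite: "finite B"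
    and H_norm: "\<And>x. x \<in> H \<Longrightarrow> (norm x)\<^sup>2 = (\<Sum>h\<in>B. (inner x h)\<^sup>2)"
    and G_H: "\<And>s u. u \<in> V \<Longrightarrow> G s u \<in> H"
    and G_measurable: "\<And>u h. u \<in> V \<Longrightarrow> (\<lambda>s. inner (G s u) h) \<in> borel_measurable borel"
begin

definition steps :: "nat \<Rightarrow> (nat \<Rightarrow> real) \<Rightarrow> (nat \<Rightarrow> 'u \<Rightarrow> 'h) \<Rightarrow> bool" where
  "steps n p L \<longleftrightarrow> p 0 = a \<and> p n = b \<and> (\<forall>k<n. p k \<le> p (Suc k) \<and> bounded_operator V H (L k))"

definition step_error :: "nat \<Rightarrow> (nat \<Rightarrow> real) \<Rightarrow> (nat \<Rightarrow> 'u \<Rightarrow> 'h) \<Rightarrow> ennreal" where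
  "step_error n p L = (\<integral>\<^sup>+s\<in>{a..b}. hs_norm_sq e (\<lambda>u. G s (Qh u) - step_integrand n p L s (Qh u)) \<partial>lborel)"

lemma steps_mono:
  assumes "steps n p L" "k \<le> m" "m \<le> n"
  shows "p k \<le> p m"
  using assms(2,3)
proof (induction m rule: dec_induct)
  case (step m)
  then have "p m \<le> p (Suc m)" using assms(1) by (simp add: steps_def)
  with step show ?case by simp
qed simp

lemma steps_bounds:
  assumes "steps n p L" "k \<le> n"
  shows "a \<le> p k" "p k \<le> b"
  using steps_mono[OF assms(1), of 0 k] steps_mono[OF assms(1), of k n] assms by (simp_all add: steps_def)

lemma steps_operator: "steps n p L \<Longrightarrow> k < n \<Longrightarrow> bounded_operator V H (L k)"
  by (simp add: steps_def)

lemma operator_H: "bounded_operator V H L \<Longrightarrow> u \<in> V \<Longrightarrow> L u \<in> H"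
  by (simp add: bounded_operator_def)

text \<open>The scalar \<open>c\<close> provides the sign when two step integrals are
  subtracted.\<close>

lemma operator_functional:
  assumes "bounded_operator V H L"
  shows "functional (\<lambda>u. c * inner (L u) h)"
proof -
  obtain K where K: "\<forall>u\<in>V. norm (L u) \<le> K * norm u"
    using assms by (auto simp: bounded_operator_def)
  have "norm (c * inner (L u) h) \<le> (\<bar>c\<bar> * K * norm h) * norm u" if "u \<in> V" for u
  proof -
    have "\<bar>inner (L u) h\<bar> \<le> norm (L u) * norm h" by (rule Cauchy_Schwarz_ineq2)
    also have "\<dots> \<le> (K * norm u) * norm h" by (intro mult_right_mono bspec[OF K that]) simp
    finally have "\<bar>c\<bar> * \<bar>inner (L u) h\<bar> \<le> \<bar>c\<bar> * ((K * norm u) * norm h)" by (rule mult_left_mono) simp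
    then show ?thesis by (simp add: abs_mult mult_ac)
  qed
  moreover have "L (u + v) = L u + L v" "L (r *\<^sub>R u) = r *\<^sub>R L u" if "u \<in> V" "v \<in> V" for u v r
    using assms that by (simp_all add: bounded_operator_def)
  ultimately show ?thesis
    unfolding bounded_operator_def by (auto simp: inner_add_left distrib_left)
qed

lemma step_integral_H:
  assumes "steps n p L" "\<omega> \<in> space P"
  shows "step_integral W n p L \<omega> \<in> H"
  unfolding step_integral_def
proof (intro subspace_sum[OF H_subspace] operator_H[OF steps_operator[OF assms(1)]] W_diff_in_V assms(2))
  fix k assume "k \<in> {..<n}"
  then show "0 \<le> p k" "0 \<le> p (Suc k)" "k < n"
    using steps_bounds[OF assms(1), of k] steps_bounds[OF assms(1), of "Suc k"] ab by auto
qed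

lemma step_integrand_H:
  assumes "steps n p L" "u \<in> V"
  shows "step_integrand n p L s u \<in> H"
  unfolding step_integrand_def
  by (intro subspace_sum[OF H_subspace] subspace_scale[OF H_subspace] operator_H[OF steps_operator[OF assms(1)]] assms(2)) simp

lemma step_integral_measurable:
  assumes "steps n p L"
  shows "(\<lambda>\<omega>. inner (step_integral W n p L \<omega>) h) \<in> borel_measurable P"
  unfolding step_integral_def inner_sum_left
proof (rule borel_measurable_sum)
  fix k assume k: "k \<in> {..<n}"
  then have "bounded_operator V H (L k)" using steps_operator[OF assms] by simp
  from operator_functional[OF this, of 1 h] have "functional (\<lambda>u. inner (L k u) h)" by simp
  from functional_measurable[OF this, of "p k" "p (Suc k)"]
  show "(\<lambda>\<omega>. inner (L k (W (p (Suc k)) \<omega> - W (p k) \<omega>)) h) \<in> borel_measurable P"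
    using steps_bounds(1)[OF assms, of k] steps_mono[OF assms, of k "Suc k"] ab k by simp
qed

text \<open>In a space without a countable base a difference of Borel maps need not be Borel; the
  finitely many coordinates along \<open>B\<close> decide instead.\<close>

lemma norm_diff_measurable:
  assumes "\<And>x. x \<in> space M \<Longrightarrow> X x \<in> H" "\<And>x. x \<in> space M \<Longrightarrow> Y x \<in> H"
    and "\<And>h. (\<lambda>x. inner (X x) h) \<in> borel_measurable M" "\<And>h. (\<lambda>x. inner (Y x) h) \<in> borel_measurable M"
  shows "(\<lambda>x. ennreal ((norm (X x - Y x))\<^sup>2)) \<in> borel_measurable M"
proof -
  have "(\<lambda>x. ennreal (\<Sum>h\<in>B. (inner (X x) h - inner (Y x) h)\<^sup>2)) \<in> borel_measurable M"
    using assms(3,4) by (intro measurable_compose[OF _ measurable_ennreal] borel_measurable_sum borel_measurable_power borel_measurable_diff)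
  moreover have "ennreal ((norm (X x - Y x))\<^sup>2) = ennreal (\<Sum>h\<in>B. (inner (X x) h - inner (Y x) h)\<^sup>2)" if "x \<in> space M" for x
    using H_norm[OF subspace_diff[OF H_subspace assms(1,2)[OF that]]] by (simp add: inner_diff_left)
  ultimately show ?thesis by (simp cong: measurable_cong)
qed

lemma step_integrand_measurable: "(\<lambda>s. inner (step_integrand n p L s u) h) \<in> borel_measurable borel"
  unfolding step_integrand_def inner_sum_left inner_scaleR_left by measurable

lemma norm_diff_square_le:
  fixes x y z :: "'v::real_normed_vector"
  shows "ennreal ((norm (x - y))\<^sup>2) \<le> 2 * ennreal ((norm (z - x))\<^sup>2) + 2 * ennreal ((norm (z - y))\<^sup>2)"
proof -
  have "norm (x - y) \<le> norm (z - x) + norm (z - y)"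
    using norm_triangle_ineq[of "x - z" "z - y"] by (simp add: norm_minus_commute)
  then have "(norm (x - y))\<^sup>2 \<le> (norm (z - x) + norm (z - y))\<^sup>2" by (rule power_mono) simp
  also have "\<dots> \<le> 2 * (norm (z - x))\<^sup>2 + 2 * (norm (z - y))\<^sup>2"
    using sum_squares_bound[of "norm (z - x)" "norm (z - y)"] by (simp add: power2_sum)
  finally have "ennreal ((norm (x - y))\<^sup>2) \<le> ennreal (2 * (norm (z - x))\<^sup>2 + 2 * (norm (z - y))\<^sup>2)"
    by (rule ennreal_leI)
  then show ?thesis by (simp add: ennreal_mult)
qed

text \<open>The two step integrals are merged over the disjoint union of their index sets, and the
  scalar Ito inequality is applied to each coordinate.\<close>

lemma step_ito_inequality:
  assumes S: "steps n p L" and S': "steps n' p' L'"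
  shows "(\<integral>\<^sup>+\<omega>. ennreal ((norm (step_integral W n p L \<omega> - step_integral W n' p' L' \<omega>))\<^sup>2) \<partial>P)
    \<le> (\<integral>\<^sup>+s\<in>{a..b}. hs_norm_sq e (\<lambda>u. step_integrand n p L s (Qh u) - step_integrand n' p' L' s (Qh u)) \<partial>lborel)"
proof -
  define I where "I = {..<n} <+> {..<n'}"
  define ss where "ss = case_sum p p'"
  define tt where "tt = case_sum (\<lambda>k. p (Suc k)) (\<lambda>k. p' (Suc k))"
  \<comment> \<open>The second family enters with a minus sign, so one sum represents the
    difference.\<close>
  define ll where "ll h = case_sum (\<lambda>k u. 1 * inner (L k u) h) (\<lambda>k u. - 1 * inner (L' k u) h)" for h
  have I: "finite I" by (simp add: I_def)
  have st: "0 \<le> ss i \<and> ss i \<le> tt i" "ss i \<ge> a" "tt i \<le> b" "functional (ll h i)" if "i \<in> I" for i h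
  proof -
    have "(0 \<le> ss i \<and> ss i \<le> tt i) \<and> ss i \<ge> a \<and> tt i \<le> b \<and> functional (ll h i)"
    proof (cases i)
      case (Inl k)
      then have k: "k < n" using that by (auto simp: I_def)
      show ?thesis
        using steps_bounds[OF S, of k] steps_bounds[OF S, of "Suc k"] steps_mono[OF S, of k "Suc k"] k ab
          operator_functional[OF steps_operator[OF S k], of 1 h]
        by (simp add: Inl ss_def tt_def ll_def)
    next
      case (Inr k)
      then have k: "k < n'" using that by (auto simp: I_def)
      show ?thesis
        using steps_bounds[OF S', of k] steps_bounds[OF S', of "Suc k"] steps_mono[OF S', of k "Suc k"] k ab
          operator_functional[OF steps_operator[OF S' k], of "-1" h]
        by (simp add: Inr ss_def tt_def ll_def)
    qed
    then show "0 \<le> ss i \<and> ss i \<le> tt i" "ss i \<ge> a" "tt i \<le> b" "functional (ll h i)" by simp_all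
  qed
  let ?D = "\<lambda>\<omega>. step_integral W n p L \<omega> - step_integral W n' p' L' \<omega>"
  let ?d = "\<lambda>r u. step_integrand n p L r u - step_integrand n' p' L' r u"
  have D: "inner (?D \<omega>) h = (\<Sum>i\<in>I. ll h i (W (tt i) \<omega> - W (ss i) \<omega>))" for \<omega> h
    unfolding I_def by (subst sum.Plus) (simp_all add: step_integral_def inner_diff_left inner_sum_left ll_def ss_def tt_def sum_negf)
  have d: "inner (?d r u) h = (\<Sum>i\<in>I. indicator {ss i<..tt i} r * ll h i u)" for r u h
    unfolding I_def by (subst sum.Plus) (simp_all add: step_integrand_def inner_diff_left inner_sum_left ll_def ss_def tt_def sum_negf)
  have DH: "?D \<omega> \<in> H" if "\<omega> \<in> space P" for \<omega>
    using step_integral_H[OF S that] step_integral_H[OF S' that] by (rule subspace_diff[OF H_subspace])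
  have dH: "?d r u \<in> H" if "u \<in> V" for r u
    using step_integrand_H[OF S that] step_integrand_H[OF S' that] by (rule subspace_diff[OF H_subspace])
  have Dm: "(\<lambda>\<omega>. inner (?D \<omega>) h) \<in> borel_measurable P" for h
    unfolding inner_diff_left by (intro borel_measurable_diff step_integral_measurable S S')
  have dm: "(\<lambda>r. inner (?d r u) h) \<in> borel_measurable borel" for u h
    unfolding inner_diff_left by (intro borel_measurable_diff step_integrand_measurable)
  have "(\<integral>\<^sup>+\<omega>. ennreal ((norm (?D \<omega>))\<^sup>2) \<partial>P) = (\<integral>\<^sup>+\<omega>. (\<Sum>h\<in>B. ennreal ((inner (?D \<omega>) h)\<^sup>2)) \<partial>P)"
    by (intro nn_integral_cong) (simp add: H_norm[OF DH])
  also have "\<dots> = (\<Sum>h\<in>B. \<integral>\<^sup>+\<omega>. ennreal ((inner (?D \<omega>) h)\<^sup>2) \<partial>P)"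
    by (rule nn_integral_sum) (intro measurable_compose[OF _ measurable_ennreal] borel_measurable_power Dm)
  also have "\<dots> \<le> (\<Sum>h\<in>B. \<integral>\<^sup>+r. (\<Sum>k. ennreal ((inner (?d r (Qh (e k))) h)\<^sup>2)) \<partial>lborel)"
    unfolding D d by (intro sum_mono functional_ito_inequality I st)
  also have "\<dots> = (\<integral>\<^sup>+r. (\<Sum>h\<in>B. \<Sum>k. ennreal ((inner (?d r (Qh (e k))) h)\<^sup>2)) \<partial>lborel)"
  proof (rule nn_integral_sum[symmetric])
    fix h
    have "(\<lambda>r. ennreal ((inner (?d r (Qh (e k))) h)\<^sup>2)) \<in> borel_measurable borel" for k
      by (intro measurable_compose[OF _ measurable_ennreal] borel_measurable_power dm)
    then show "(\<lambda>r. \<Sum>k. ennreal ((inner (?d r (Qh (e k))) h)\<^sup>2)) \<in> borel_measurable lborel"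
      by (simp add: borel_measurable_suminf_order)
  qed
  also have "\<dots> = (\<integral>\<^sup>+s\<in>{a..b}. hs_norm_sq e (\<lambda>u. ?d s (Qh u)) \<partial>lborel)"
  proof (rule nn_integral_cong)
    fix r :: real
    have "(\<Sum>h\<in>B. \<Sum>k. ennreal ((inner (?d r (Qh (e k))) h)\<^sup>2)) = (\<Sum>k. \<Sum>h\<in>B. ennreal ((inner (?d r (Qh (e k))) h)\<^sup>2))"
      by (rule suminf_sum[symmetric]) simp
    also have "\<dots> = (\<Sum>k. ennreal ((norm (?d r (Qh (e k))))\<^sup>2))"
      by (intro suminf_cong) (simp add: H_norm[OF dH[OF Qh_in_V[OF e_in_V]]])
    finally have eq: "(\<Sum>h\<in>B. \<Sum>k. ennreal ((inner (?d r (Qh (e k))) h)\<^sup>2)) = hs_norm_sq e (\<lambda>u. ?d r (Qh u))"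
      by (simp add: hs_norm_sq_def)
    show "(\<Sum>h\<in>B. \<Sum>k. ennreal ((inner (?d r (Qh (e k))) h)\<^sup>2)) = hs_norm_sq e (\<lambda>u. ?d r (Qh u)) * indicator {a..b} r"
    proof (cases "r \<in> {a..b}")
      case True
      then show ?thesis by (simp add: eq)
    next
      case False
      have "r \<notin> {ss i<..tt i}" if "i \<in> I" for i
        using st(2,3)[OF that] False by auto
      then have "inner (?d r u) h = 0" for u h
        unfolding d by (intro sum.neutral ballI) (simp add: indicator_def)
      then show ?thesis using False by simp
    qed
  qed
  finally show ?thesis .
qed

lemma hs_error_measurable:
  assumes "steps n p L"
  shows "(\<lambda>s. hs_norm_sq e (\<lambda>u. G s (Qh u) - step_integrand n p L s (Qh u))) \<in> borel_measurable borel"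
  unfolding hs_norm_sq_def
  by (intro borel_measurable_suminf_order norm_diff_measurable G_H step_integrand_H[OF assms] Qh_in_V e_in_V
      G_measurable step_integrand_measurable)

text \<open>Insert \<open>G\<close> between the two step integrands. Each approximation error then
  appears separately, hence approximations from different sequences can be compared.\<close>

lemma step_distance:
  assumes S: "steps n p L" and S': "steps n' p' L'"
  shows "(\<integral>\<^sup>+\<omega>. ennreal ((norm (step_integral W n p L \<omega> - step_integral W n' p' L' \<omega>))\<^sup>2) \<partial>P)
    \<le> 2 * step_error n p L + 2 * step_error n' p' L'"
proof -
  let ?h = "\<lambda>n p L s. hs_norm_sq e (\<lambda>u. G s (Qh u) - step_integrand n p L s (Qh u))"
  have le: "hs_norm_sq e (\<lambda>u. step_integrand n p L s (Qh u) - step_integrand n' p' L' s (Qh u)) \<le> 2 * ?h n p L s + 2 * ?h n' p' L' s" for s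
  proof -
    have "hs_norm_sq e (\<lambda>u. step_integrand n p L s (Qh u) - step_integrand n' p' L' s (Qh u))
      \<le> (\<Sum>i. 2 * ennreal ((norm (G s (Qh (e i)) - step_integrand n p L s (Qh (e i))))\<^sup>2)
          + 2 * ennreal ((norm (G s (Qh (e i)) - step_integrand n' p' L' s (Qh (e i))))\<^sup>2))"
      unfolding hs_norm_sq_def by (intro suminf_le norm_diff_square_le summableI)
    also have "\<dots> = 2 * ?h n p L s + 2 * ?h n' p' L' s"
      unfolding hs_norm_sq_def by (subst suminf_add[symmetric]) (simp_all add: ennreal_suminf_cmult)
    finally show ?thesis .
  qed
  note [measurable] = hs_error_measurable[OF S] hs_error_measurable[OF S']
  have "(\<integral>\<^sup>+\<omega>. ennreal ((norm (step_integral W n p L \<omega> - step_integral W n' p' L' \<omega>))\<^sup>2) \<partial>P)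
    \<le> (\<integral>\<^sup>+s. 2 * (?h n p L s * indicator {a..b} s) + 2 * (?h n' p' L' s * indicator {a..b} s) \<partial>lborel)"
    by (rule order.trans[OF step_ito_inequality[OF S S']], rule nn_integral_mono)
       (use le in \<open>simp add: indicator_def\<close>)
  also have "\<dots> = 2 * step_error n p L + 2 * step_error n' p' L'"
    unfolding step_error_def by (subst nn_integral_add) (simp_all add: nn_integral_cmult)
  finally show ?thesis .
qed

text \<open>If step integrals with vanishing error converge almost surely to \<open>J\<close>, then
  \<open>J\<close> is close to every step integral of small error, not only to those of the given
  sequence. With the given sequence this shows that \<open>J\<close> is a stochastic integral; with
  the sequence behind the chosen integral it shows that the two agree almost surely.\<close>

lemma stochastic_integral_limit:
  assumes J: "J \<in> borel_measurable P" "\<And>\<omega>. \<omega> \<in> space P \<Longrightarrow> J \<omega> \<in> H"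
    and S: "\<And>j. steps (n j) (p j) (L j)" and err: "(\<lambda>j. step_error (n j) (p j) (L j)) \<longlonglongrightarrow> 0"
    and lim: "AE \<omega> in P. (\<lambda>j. step_integral W (n j) (p j) (L j) \<omega>) \<longlonglongrightarrow> J \<omega>"
  shows "has_stochastic_integral P V H e Qh W G a b J"
    and "AE \<omega> in P. stochastic_integral P V H e Qh W G a b \<omega> = J \<omega>"
proof -
  have Jm: "(\<lambda>\<omega>. inner (J \<omega>) h) \<in> borel_measurable P" for h
    by (rule inner_borel_measurable[OF J(1)])
  \<comment> \<open>Fatou's lemma along the converging sequence, whose own errors disappear in the
    limit.\<close>
  have key: "(\<integral>\<^sup>+\<omega>. ennreal ((norm (J \<omega> - step_integral W n' p' L' \<omega>))\<^sup>2) \<partial>P) \<le> 2 * step_error n' p' L'"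
    if S': "steps n' p' L'" for n' p' L'
  proof -
    let ?S = "\<lambda>j. step_integral W (n j) (p j) (L j)" and ?S' = "step_integral W n' p' L'"
    have "(\<integral>\<^sup>+\<omega>. ennreal ((norm (J \<omega> - ?S' \<omega>))\<^sup>2) \<partial>P) = (\<integral>\<^sup>+\<omega>. liminf (\<lambda>j. ennreal ((norm (?S j \<omega> - ?S' \<omega>))\<^sup>2)) \<partial>P)"
      using lim
    proof (intro nn_integral_cong_AE, eventually_elim)
      case (elim \<omega>)
      then show ?case
        by (intro lim_imp_Liminf[OF sequentially_bot, symmetric] tendsto_ennrealI tendsto_power tendsto_norm tendsto_diff tendsto_const)
    qed
    also have "\<dots> \<le> liminf (\<lambda>j. \<integral>\<^sup>+\<omega>. ennreal ((norm (?S j \<omega> - ?S' \<omega>))\<^sup>2) \<partial>P)"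
      by (intro nn_integral_liminf norm_diff_measurable step_integral_H S S' step_integral_measurable)
    also have "\<dots> \<le> liminf (\<lambda>j. 2 * step_error (n j) (p j) (L j) + 2 * step_error n' p' L')"
      by (intro Liminf_mono always_eventually allI step_distance S S')
    also have "\<dots> = 2 * step_error n' p' L'"
    proof (rule lim_imp_Liminf[OF sequentially_bot])
      have "(\<lambda>j. 2 * step_error (n j) (p j) (L j) + 2 * step_error n' p' L') \<longlonglongrightarrow> 2 * 0 + 2 * step_error n' p' L'"
        by (intro tendsto_add ennreal_tendsto_cmult err tendsto_const) simp
      then show "(\<lambda>j. 2 * step_error (n j) (p j) (L j) + 2 * step_error n' p' L') \<longlonglongrightarrow> 2 * step_error n' p' L'" by simp
    qed
    finally show ?thesis .
  qed
  have conv: "(\<lambda>j. \<integral>\<^sup>+\<omega>. ennreal ((norm (J \<omega> - step_integral W (n j) (p j) (L j) \<omega>))\<^sup>2) \<partial>P) \<longlonglongrightarrow> 0"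
    if S: "\<And>j. steps (n j) (p j) (L j)" and err: "(\<lambda>j. step_error (n j) (p j) (L j)) \<longlonglongrightarrow> 0" for n p L
  proof (rule tendsto_sandwich[OF _ _ tendsto_const])
    have "(\<lambda>j. 2 * step_error (n j) (p j) (L j)) \<longlonglongrightarrow> 2 * 0"
      by (intro ennreal_tendsto_cmult err) simp
    then show "(\<lambda>j. 2 * step_error (n j) (p j) (L j)) \<longlonglongrightarrow> 0" by simp
    show "\<forall>\<^sub>F j in sequentially. (\<integral>\<^sup>+\<omega>. ennreal ((norm (J \<omega> - step_integral W (n j) (p j) (L j) \<omega>))\<^sup>2) \<partial>P)
        \<le> 2 * step_error (n j) (p j) (L j)"
      by (intro always_eventually allI key S)
  qed simp
  have "\<exists>n p L. (\<forall>j::nat. p j 0 = a \<and> p j (n j) = b \<and>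
           (\<forall>k<n j. p j k \<le> p j (Suc k) \<and> bounded_operator V H (L j k))) \<and>
        (\<lambda>j. step_error (n j) (p j) (L j)) \<longlonglongrightarrow> 0 \<and>
        (\<lambda>j. \<integral>\<^sup>+\<omega>. ennreal ((norm (J \<omega> - step_integral W (n j) (p j) (L j) \<omega>))\<^sup>2) \<partial>P) \<longlonglongrightarrow> 0"
    by (intro exI[of _ n] exI[of _ p] exI[of _ L] conjI allI S[unfolded steps_def] err conv S)
       (use S in \<open>simp_all add: steps_def\<close>)
  then show has: "has_stochastic_integral P V H e Qh W G a b J"
    unfolding has_stochastic_integral_def step_error_def using J by blast
  define I where "I = stochastic_integral P V H e Qh W G a b"
  have hasI: "has_stochastic_integral P V H e Qh W G a b I"
    unfolding I_def by (rule has_stochastic_integral_stochastic_integral[OF has])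
  have Im: "I \<in> borel_measurable P" and IH: "\<forall>\<omega>\<in>space P. I \<omega> \<in> H"
    and IS: "\<exists>n p L. (\<forall>j::nat. steps (n j) (p j) (L j)) \<and> (\<lambda>j. step_error (n j) (p j) (L j)) \<longlonglongrightarrow> 0 \<and>
        (\<lambda>j. \<integral>\<^sup>+\<omega>. ennreal ((norm (I \<omega> - step_integral W (n j) (p j) (L j) \<omega>))\<^sup>2) \<partial>P) \<longlonglongrightarrow> 0"
    using hasI unfolding has_stochastic_integral_def step_error_def[symmetric] steps_def[symmetric] by blast+
  from IS obtain n' p' L' where S': "\<And>j::nat. steps (n' j) (p' j) (L' j)"
    and err': "(\<lambda>j. step_error (n' j) (p' j) (L' j)) \<longlonglongrightarrow> 0"
    and I': "(\<lambda>j. \<integral>\<^sup>+\<omega>. ennreal ((norm (I \<omega> - step_integral W (n' j) (p' j) (L' j) \<omega>))\<^sup>2) \<partial>P) \<longlonglongrightarrow> 0"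
    by blast
  have Im': "(\<lambda>\<omega>. inner (I \<omega>) h) \<in> borel_measurable P" for h
    by (rule inner_borel_measurable[OF Im])
  let ?S = "\<lambda>j. step_integral W (n' j) (p' j) (L' j)"
  have IH': "\<omega> \<in> space P \<Longrightarrow> I \<omega> \<in> H" for \<omega> using IH by simp
  have meas: "(\<lambda>\<omega>. ennreal ((norm (?S j \<omega> - I \<omega>))\<^sup>2)) \<in> borel_measurable P"
    "(\<lambda>\<omega>. ennreal ((norm (?S j \<omega> - J \<omega>))\<^sup>2)) \<in> borel_measurable P" for j
    by (intro norm_diff_measurable IH' J(2) Im' Jm step_integral_H S' step_integral_measurable; assumption)+
  have measIJ: "(\<lambda>\<omega>. ennreal ((norm (I \<omega> - J \<omega>))\<^sup>2)) \<in> borel_measurable P"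
    by (intro norm_diff_measurable IH' J(2) Im' Jm)
  have "(\<integral>\<^sup>+\<omega>. ennreal ((norm (I \<omega> - J \<omega>))\<^sup>2) \<partial>P) \<le> 0"
  proof (rule LIMSEQ_le_const)
    have "(\<lambda>j. 2 * (\<integral>\<^sup>+\<omega>. ennreal ((norm (I \<omega> - ?S j \<omega>))\<^sup>2) \<partial>P) + 2 * (\<integral>\<^sup>+\<omega>. ennreal ((norm (J \<omega> - ?S j \<omega>))\<^sup>2) \<partial>P))
        \<longlonglongrightarrow> 2 * 0 + 2 * 0"
      by (intro tendsto_add ennreal_tendsto_cmult I' conv S' err') simp_all
    then show "(\<lambda>j. 2 * (\<integral>\<^sup>+\<omega>. ennreal ((norm (I \<omega> - ?S j \<omega>))\<^sup>2) \<partial>P) + 2 * (\<integral>\<^sup>+\<omega>. ennreal ((norm (J \<omega> - ?S j \<omega>))\<^sup>2) \<partial>P))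
        \<longlonglongrightarrow> 0" by simp
    show "\<exists>N. \<forall>j\<ge>N. (\<integral>\<^sup>+\<omega>. ennreal ((norm (I \<omega> - J \<omega>))\<^sup>2) \<partial>P)
       \<le> 2 * (\<integral>\<^sup>+\<omega>. ennreal ((norm (I \<omega> - ?S j \<omega>))\<^sup>2) \<partial>P) + 2 * (\<integral>\<^sup>+\<omega>. ennreal ((norm (J \<omega> - ?S j \<omega>))\<^sup>2) \<partial>P)"
    proof (intro exI allI impI)
      fix j
      have "(\<integral>\<^sup>+\<omega>. ennreal ((norm (I \<omega> - J \<omega>))\<^sup>2) \<partial>P)
          \<le> (\<integral>\<^sup>+\<omega>. 2 * ennreal ((norm (?S j \<omega> - I \<omega>))\<^sup>2) + 2 * ennreal ((norm (?S j \<omega> - J \<omega>))\<^sup>2) \<partial>P)"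
        by (intro nn_integral_mono norm_diff_square_le)
      also have "\<dots> = 2 * (\<integral>\<^sup>+\<omega>. ennreal ((norm (I \<omega> - ?S j \<omega>))\<^sup>2) \<partial>P) + 2 * (\<integral>\<^sup>+\<omega>. ennreal ((norm (J \<omega> - ?S j \<omega>))\<^sup>2) \<partial>P)"
        using meas[of j] by (subst nn_integral_add) (simp_all add: nn_integral_cmult norm_minus_commute)
      finally show "(\<integral>\<^sup>+\<omega>. ennreal ((norm (I \<omega> - J \<omega>))\<^sup>2) \<partial>P)
        \<le> 2 * (\<integral>\<^sup>+\<omega>. ennreal ((norm (I \<omega> - ?S j \<omega>))\<^sup>2) \<partial>P) + 2 * (\<integral>\<^sup>+\<omega>. ennreal ((norm (J \<omega> - ?S j \<omega>))\<^sup>2) \<partial>P)" .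
    qed
  qed
  then have "(\<integral>\<^sup>+\<omega>. ennreal ((norm (I \<omega> - J \<omega>))\<^sup>2) \<partial>P) = 0" by simp
  then have "AE \<omega> in P. ennreal ((norm (I \<omega> - J \<omega>))\<^sup>2) = 0"
    by (subst (asm) nn_integral_0_iff_AE[OF measIJ])
  then show "AE \<omega> in P. stochastic_integral P V H e Qh W G a b \<omega> = J \<omega>"
    unfolding I_def[symmetric] by eventually_elim simp
qed

end

section \<open>The stochastic convolution\<close>

lemma wave_sin_lipschitz:
  assumes "l \<ge> 0"
  shows "(wave_sin l x - wave_sin l y)\<^sup>2 \<le> (x - y)\<^sup>2"
proof -
  have "norm (wave_sin l x - wave_sin l y) \<le> 1 * norm (x - y)"
  proof (rule field_differentiable_bound[where S=UNIV and f="wave_sin l" and f'="wave_cos l"])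
    show "(wave_sin l has_field_derivative wave_cos l z) (at z within UNIV)" for z
      by (simp add: wave_sin_deriv[OF assms])
    show "norm (wave_cos l z) \<le> 1" for z by (simp add: wave_cos_def)
  qed simp_all
  then show ?thesis by (simp add: abs_le_square_iff)
qed

lemma wave_cos_lipschitz:
  assumes "l \<ge> 0"
  shows "(wave_cos l x - wave_cos l y)\<^sup>2 \<le> l * (x - y)\<^sup>2"
proof -
  have "norm (wave_cos l x - wave_cos l y) \<le> sqrt l * norm (x - y)"
  proof (rule field_differentiable_bound[where S=UNIV and f="wave_cos l" and f'="\<lambda>z. - sqrt l * sin (sqrt l * z)" and B="sqrt l"])
    show "(wave_cos l has_field_derivative - sqrt l * sin (sqrt l * z)) (at z within UNIV)" for z
      unfolding wave_cos_def[abs_def] by (auto intro!: derivative_eq_intros)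
    show "norm (- sqrt l * sin (sqrt l * z)) \<le> sqrt l" for z
      using mult_left_mono[OF abs_sin_le_one[of "sqrt l * z"], of "sqrt l"] assms by (simp add: abs_mult)
  qed simp_all
  from power_mono[OF this norm_ge_zero, of 2] show ?thesis
    using assms by (simp add: power_mult_distrib)
qed

context dirichlet_problem
begin

lemma pair_lincomb:
  assumes "x \<in> U_N \<phi> N \<times> U_N \<phi> N"
  shows "x = (lincomb N (\<lambda>i. inner (fst x) (\<phi> i)), lincomb N (\<lambda>i. inner (snd x) (\<phi> i)))"
  using assms U_N_lincomb[of "fst x" N] U_N_lincomb[of "snd x" N] by (simp add: mem_Times_iff prod_eq_iff)

lemma subspace_pair: "subspace (U_N \<phi> N \<times> U_N \<phi> N)"
  by (simp add: U_N_def subspace_Times)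

lemma pair_in: "(lincomb N c, lincomb N d) \<in> U_N \<phi> N \<times> U_N \<phi> N"
  by (simp add: lincomb_in_U_N)

definition pair_basis :: "nat \<Rightarrow> ('a L2 \<times> 'a L2) set" where
  "pair_basis N = (\<lambda>i. (\<phi> i, 0)) ` {..<N} \<union> (\<lambda>i. (0, \<phi> i)) ` {..<N}"

lemma phi_nonzero: "\<phi> i \<noteq> 0"
  using phi_orthonormal[of i i] by auto

lemma phi_inj: "\<phi> i = \<phi> j \<longleftrightarrow> i = j"
  using phi_orthonormal[of i j] phi_orthonormal[of i i] by (metis zero_neq_one)

lemma norm_lincomb: "(norm (lincomb N c))\<^sup>2 = (\<Sum>i<N. (c i)\<^sup>2)"
  unfolding power2_norm_eq_inner inner_lincomb_lincomb by (simp add: power2_eq_square)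

lemma norm_pair_lincomb: "(norm (lincomb N c, lincomb N d))\<^sup>2 = (\<Sum>i<N. (c i)\<^sup>2 + (d i)\<^sup>2)"
proof -
  have "(norm (lincomb N c, lincomb N d))\<^sup>2 = (norm (lincomb N c))\<^sup>2 + (norm (lincomb N d))\<^sup>2"
    by (simp add: norm_Pair)
  then show ?thesis by (simp add: norm_lincomb sum.distrib)
qed

lemma pair_basis_norm:
  assumes "x \<in> U_N \<phi> N \<times> U_N \<phi> N"
  shows "(norm x)\<^sup>2 = (\<Sum>h\<in>pair_basis N. (inner x h)\<^sup>2)"
proof -
  have "(\<Sum>h\<in>pair_basis N. (inner x h)\<^sup>2)
      = (\<Sum>h\<in>(\<lambda>i. (\<phi> i, 0)) ` {..<N}. (inner x h)\<^sup>2) + (\<Sum>h\<in>(\<lambda>i. (0, \<phi> i)) ` {..<N}. (inner x h)\<^sup>2)"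
    unfolding pair_basis_def by (rule sum.union_disjoint) (auto simp: phi_nonzero)
  also have "\<dots> = (\<Sum>i<N. (inner (fst x) (\<phi> i))\<^sup>2) + (\<Sum>i<N. (inner (snd x) (\<phi> i))\<^sup>2)"
    by (subst (1 2) sum.reindex) (auto simp: inj_on_def phi_inj inner_prod_def)
  also have "\<dots> = (norm x)\<^sup>2"
    by (subst (3) pair_lincomb[OF assms]) (simp add: norm_pair_lincomb sum.distrib)
  finally show ?thesis by simp
qed

lemma B_N_lincomb: "B_N \<phi> N w = (lincomb N (\<lambda>i. 0), lincomb N (\<lambda>i. inner w (\<phi> i)))"
  by (simp add: B_N_def P_N_lincomb) (simp add: lincomb_def)

definition noise_op :: "nat \<Rightarrow> real \<Rightarrow> 'a L2 \<Rightarrow> 'a L2 \<times> 'a L2" where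
  "noise_op N t w = E_N lam \<phi> N t (B_N \<phi> N w)"

lemma noise_op_lincomb:
  "noise_op N t w = (lincomb N (\<lambda>i. wave_sin (lam i) t * inner w (\<phi> i)),
     lincomb N (\<lambda>i. wave_cos (lam i) t * inner w (\<phi> i)))"
  unfolding noise_op_def B_N_lincomb E_N_lincomb by simp

lemma noise_op_in: "noise_op N t w \<in> U_N \<phi> N \<times> U_N \<phi> N"
  unfolding noise_op_lincomb by (rule pair_in)

lemma inner_noise_op:
  "inner (noise_op N t w) h
    = (\<Sum>i<N. wave_sin (lam i) t * inner w (\<phi> i) * inner (\<phi> i) (fst h)
        + wave_cos (lam i) t * inner w (\<phi> i) * inner (\<phi> i) (snd h))"
  unfolding noise_op_lincomb by (simp add: inner_prod_def lincomb_def inner_sum_left sum.distrib)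

lemma bessel: "(\<Sum>i<n. (inner u (\<phi> i))\<^sup>2) \<le> (norm u)\<^sup>2"
proof -
  let ?z = "lincomb n (\<lambda>i. inner u (\<phi> i))"
  have "inner u ?z = (\<Sum>i<n. (inner u (\<phi> i))\<^sup>2)"
    by (simp add: lincomb_def inner_sum_right power2_eq_square)
  moreover have "inner ?z ?z = (\<Sum>i<n. (inner u (\<phi> i))\<^sup>2)"
    unfolding inner_lincomb_lincomb by (simp add: power2_eq_square)
  moreover have "0 \<le> inner (u - ?z) (u - ?z)" by simp
  ultimately show ?thesis
    by (simp add: inner_diff_left inner_diff_right inner_commute[of ?z u] power2_norm_eq_inner)
qed

text \<open>Lipschitz continuity in time, from the Lipschitz bounds of sine and cosine of each mode.
  The constant depends on \<open>N\<close>, but serves only to make step errors vanish.\<close>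

lemma noise_op_diff:
  "(norm (noise_op N t w - noise_op N t' w))\<^sup>2 \<le> (1 + (\<Sum>i<N. lam i)) * (t - t')\<^sup>2 * (\<Sum>i<N. (inner w (\<phi> i))\<^sup>2)"
proof -
  let ?K = "1 + (\<Sum>i<N. lam i)"
  have "(norm (noise_op N t w - noise_op N t' w))\<^sup>2
      = (\<Sum>i<N. ((wave_sin (lam i) t - wave_sin (lam i) t')\<^sup>2 + (wave_cos (lam i) t - wave_cos (lam i) t')\<^sup>2) * (inner w (\<phi> i))\<^sup>2)"
    unfolding noise_op_lincomb diff_Pair lincomb_diff norm_pair_lincomb
    by (intro sum.cong refl) (simp add: left_diff_distrib[symmetric] power_mult_distrib distrib_right)
  also have "\<dots> \<le> (\<Sum>i<N. (?K * (t - t')\<^sup>2) * (inner w (\<phi> i))\<^sup>2)"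
  proof (intro sum_mono mult_right_mono)
    fix i assume "i \<in> {..<N}"
    then have "lam i \<le> (\<Sum>i<N. lam i)" by (intro member_le_sum lam_nonneg) auto
    then have "(1 + lam i) * (t - t')\<^sup>2 \<le> ?K * (t - t')\<^sup>2" by (intro mult_right_mono) auto
    then show "(wave_sin (lam i) t - wave_sin (lam i) t')\<^sup>2 + (wave_cos (lam i) t - wave_cos (lam i) t')\<^sup>2 \<le> ?K * (t - t')\<^sup>2"
      using wave_sin_lipschitz[OF lam_nonneg, of i t t'] wave_cos_lipschitz[OF lam_nonneg, of i t t']
      by (simp add: distrib_right)
  qed simp
  finally show ?thesis by (simp add: sum_distrib_left)
qed

lemma noise_op_bounded: "bounded_operator (L2_on D) (U_N \<phi> N \<times> U_N \<phi> N) (noise_op N t)"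
proof -
  have "norm (noise_op N t u) \<le> (\<Sum>i<N. \<bar>wave_sin (lam i) t\<bar> + \<bar>wave_cos (lam i) t\<bar>) * norm u" for u
  proof -
    have n1: "norm (\<phi> i) = 1" for i using phi_orthonormal[of i i] by (simp add: norm_eq_sqrt_inner)
    have l: "norm (lincomb N (\<lambda>i. c i * inner u (\<phi> i))) \<le> (\<Sum>i<N. \<bar>c i\<bar> * norm u)" for c
      unfolding lincomb_def
    proof (rule order.trans[OF norm_sum sum_mono])
      fix i
      have "\<bar>inner u (\<phi> i)\<bar> \<le> norm u" using Cauchy_Schwarz_ineq2[of u "\<phi> i"] by (simp add: n1)
      then show "norm ((c i * inner u (\<phi> i)) *\<^sub>R \<phi> i) \<le> \<bar>c i\<bar> * norm u"
        by (simp add: n1 abs_mult mult_left_mono)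
    qed
    have "norm (noise_op N t u) \<le> (\<Sum>i<N. \<bar>wave_sin (lam i) t\<bar> * norm u) + (\<Sum>i<N. \<bar>wave_cos (lam i) t\<bar> * norm u)"
      unfolding noise_op_lincomb by (rule order.trans[OF norm_Pair_le add_mono[OF l l]])
    then show ?thesis by (simp add: sum.distrib sum_distrib_right distrib_right)
  qed
  moreover have "noise_op N t (u + v) = noise_op N t u + noise_op N t v" "noise_op N t (c *\<^sub>R u) = c *\<^sub>R noise_op N t u" for u v c
    unfolding noise_op_lincomb by (simp_all add: lincomb_add lincomb_scaleR inner_add_left distrib_left mult_ac)
  ultimately show ?thesis unfolding bounded_operator_def using noise_op_in by blast
qed

end

lemma grid_interval:
  assumes "a < s" "s \<le> b"
  obtains k where "k < Suc j" "grid a b (Suc j) k < s" "s \<le> grid a b (Suc j) (Suc k)"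
proof -
  define m where "m = (LEAST m. s \<le> grid a b (Suc j) m)"
  have ex: "s \<le> grid a b (Suc j) (Suc j)" using assms by (simp add: grid_n)
  have m: "s \<le> grid a b (Suc j) m" unfolding m_def by (rule LeastI[of "\<lambda>m. s \<le> grid a b (Suc j) m", OF ex])
  have "m \<le> Suc j" unfolding m_def by (rule Least_le[of "\<lambda>m. s \<le> grid a b (Suc j) m", OF ex])
  have "m \<noteq> 0" using m assms by (auto simp: grid_0 intro: ccontr)
  then obtain k where k: "m = Suc k" by (cases m) auto
  have "\<not> s \<le> grid a b (Suc j) k"
    using not_less_Least[of k "\<lambda>m. s \<le> grid a b (Suc j) m"] k by (simp add: m_def)
  then show ?thesis using that[of k] m k \<open>m \<le> Suc j\<close> by simp
qed

lemma grid_step_integrand: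
  assumes ab: "a \<le> b" and k: "k < Suc j" "grid a b (Suc j) k < s" "s \<le> grid a b (Suc j) (Suc k)"
  shows "step_integrand (Suc j) (grid a b (Suc j)) L s u = L k u"
proof -
  have "s \<notin> {grid a b (Suc j) i<..grid a b (Suc j) (Suc i)}" if "i \<noteq> k" for i
  proof (cases "i < k")
    case True
    then show ?thesis using grid_mono[OF ab, of "Suc i" k "Suc j"] k by auto
  next
    case False
    then show ?thesis using that grid_mono[OF ab, of "Suc k" i "Suc j"] k by auto
  qed
  then have "step_integrand (Suc j) (grid a b (Suc j)) L s u = (\<Sum>i\<in>{k}. indicator {grid a b (Suc j) i<..grid a b (Suc j) (Suc i)} s *\<^sub>R L i u)"
    unfolding step_integrand_def using k(1) by (intro sum.mono_neutral_right) (auto simp: indicator_def)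
  then show ?thesis using k by (simp add: indicator_def)
qed

locale wave_noise = dirichlet_problem D lam \<phi>
  for D :: "'a::euclidean_space set" and lam \<phi> +
  fixes P :: "'w measure" and F :: "real \<Rightarrow> 'w measure" and Q Qh :: "'a L2 \<Rightarrow> 'a L2"
    and W :: "real \<Rightarrow> 'w \<Rightarrow> 'a L2"
  assumes filtered: "filtered_prob_space P F"
    and covariance: "covariance_A2 D lam \<phi> Q Qh"
    and wiener: "Q_wiener_process P F (L2_on D) Q W"
begin

sublocale noise: Q_wiener P F "L2_on D" \<phi> Q Qh W
proof
  show "orthonormal_basis (L2_on D) \<phi>" using eigenpairs by (simp add: dirichlet_eigenpairs_def)
  show "is_operator_sqrt (L2_on D) Q Qh" using covariance by (simp add: covariance_A2_def)
qed (fact filtered wiener subspace_L2_on)+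

lemma noise_integral_locale:
  assumes "0 \<le> a" "a \<le> b"
  shows "Q_wiener_integral P F (L2_on D) \<phi> Q Qh W (U_N \<phi> N \<times> U_N \<phi> N) (pair_basis N) a b (\<lambda>s. noise_op N (b - s))"
proof
  show "finite (pair_basis N)" by (simp add: pair_basis_def)
  show "(\<lambda>s. inner (noise_op N (b - s) u) h) \<in> borel_measurable borel" for u h
  proof -
    have "continuous_on UNIV (wave_sin l)" "continuous_on UNIV (wave_cos l)" if "l \<ge> 0" for l
      using wave_sin_deriv[OF that] wave_cos_deriv[OF that]
      by (auto intro!: continuous_at_imp_continuous_on DERIV_isCont)
    then have "continuous_on UNIV (\<lambda>s. wave_sin (lam i) (b - s))" "continuous_on UNIV (\<lambda>s. wave_cos (lam i) (b - s))" for i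
      using lam_nonneg by (auto intro!: continuous_on_compose2[of UNIV _ UNIV "\<lambda>s. b - s"] continuous_intros)
    then have "continuous_on UNIV (\<lambda>s. inner (noise_op N (b - s) u) h)"
      unfolding inner_noise_op by (intro continuous_intros) auto
    then show ?thesis by (rule borel_measurable_continuous_onI)
  qed
qed (use assms in \<open>simp_all add: subspace_pair pair_basis_norm noise_op_in\<close>)

text \<open>Self-adjointness exchanges the two indices; Bessel's inequality then bounds the double
  sum by the squared norms of \<open>Qh (\<phi> i)\<close> for \<open>i < N\<close>.\<close>

lemma Qh_hs_finite: "(\<Sum>l. ennreal (\<Sum>i<N. (inner (Qh (\<phi> l)) (\<phi> i))\<^sup>2)) < \<infinity>"
proof -
  have "(\<Sum>l. ennreal (\<Sum>i<N. (inner (Qh (\<phi> l)) (\<phi> i))\<^sup>2)) = (\<Sum>l. \<Sum>i<N. ennreal ((inner (Qh (\<phi> i)) (\<phi> l))\<^sup>2))"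
  proof (rule suminf_cong)
    fix l
    have "inner (Qh (\<phi> l)) (\<phi> i) = inner (Qh (\<phi> i)) (\<phi> l)" for i
      using noise.Qh_sym[OF phi_L2_on phi_L2_on, of l i] by (simp add: inner_commute)
    then show "ennreal (\<Sum>i<N. (inner (Qh (\<phi> l)) (\<phi> i))\<^sup>2) = (\<Sum>i<N. ennreal ((inner (Qh (\<phi> i)) (\<phi> l))\<^sup>2))"
      by simp
  qed
  also have "\<dots> = (\<Sum>i<N. \<Sum>l. ennreal ((inner (Qh (\<phi> i)) (\<phi> l))\<^sup>2))"
    by (rule suminf_sum) simp
  also have "\<dots> \<le> (\<Sum>i<N. ennreal ((norm (Qh (\<phi> i)))\<^sup>2))"
    by (intro sum_mono suminf_le_const summableI) (simp add: bessel ennreal_leI)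
  also have "\<dots> < \<infinity>" by simp
  finally show ?thesis .
qed

definition grid_op :: "nat \<Rightarrow> real \<Rightarrow> real \<Rightarrow> nat \<Rightarrow> nat \<Rightarrow> 'a L2 \<Rightarrow> 'a L2 \<times> 'a L2" where
  "grid_op N a b j k = noise_op N (b - grid a b (Suc j) k)"

lemma grid_steps:
  assumes "0 \<le> a" "a \<le> b"
  shows "Q_wiener_integral.steps (L2_on D) (U_N \<phi> N \<times> U_N \<phi> N) a b (Suc j) (grid a b (Suc j)) (grid_op N a b j)"
proof -
  interpret S: Q_wiener_integral P F "L2_on D" \<phi> Q Qh W "U_N \<phi> N \<times> U_N \<phi> N" "pair_basis N" a b "\<lambda>s. noise_op N (b - s)"
    by (rule noise_integral_locale[OF assms])
  show ?thesis
    unfolding S.steps_def grid_op_def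
    using assms by (simp add: grid_0 grid_n grid_mono noise_op_bounded)
qed

text \<open>Freezing the integrand at the left end of a cell shifts time by at most the mesh size,
  so the squared Hilbert-Schmidt error is of second order in the mesh.\<close>

lemma grid_step_error:
  assumes "0 \<le> a" "a \<le> b"
  shows "(\<lambda>j. Q_wiener_integral.step_error \<phi> Qh a b (\<lambda>s. noise_op N (b - s)) (Suc j) (grid a b (Suc j)) (grid_op N a b j)) \<longlonglongrightarrow> 0"
proof -
  interpret S: Q_wiener_integral P F "L2_on D" \<phi> Q Qh W "U_N \<phi> N \<times> U_N \<phi> N" "pair_basis N" a b "\<lambda>s. noise_op N (b - s)"
    by (rule noise_integral_locale[OF assms])
  define K where "K = 1 + (\<Sum>i<N. lam i)"
  have K: "K \<ge> 0" unfolding K_def by (intro add_nonneg_nonneg sum_nonneg lam_nonneg) auto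
  define A where "A = enn2real (\<Sum>l. ennreal (\<Sum>i<N. (inner (Qh (\<phi> l)) (\<phi> i))\<^sup>2))"
  have A: "(\<Sum>l. ennreal (\<Sum>i<N. (inner (Qh (\<phi> l)) (\<phi> i))\<^sup>2)) = ennreal A"
    unfolding A_def using Qh_hs_finite[of N] by simp
  define h where "h j = (b - a) / real (Suc j)" for j
  let ?hs = "\<lambda>j s. hs_norm_sq \<phi> (\<lambda>u. noise_op N (b - s) (Qh u) - step_integrand (Suc j) (grid a b (Suc j)) (grid_op N a b j) s (Qh u))"
  have hs: "?hs j s \<le> ennreal (K * (h j)\<^sup>2 * A)" if s: "a < s" "s \<le> b" for j s
  proof -
    obtain k where k: "k < Suc j" "grid a b (Suc j) k < s" "s \<le> grid a b (Suc j) (Suc k)"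
      using grid_interval[OF s] by blast
    have "(b - s - (b - grid a b (Suc j) k))\<^sup>2 \<le> (h j)\<^sup>2"
      using k(2,3) unfolding grid_Suc h_def by (intro power2_le_iff_abs_le[THEN iffD2]) (auto simp: assms)
    then have "(norm (noise_op N (b - s) w - grid_op N a b j k w))\<^sup>2 \<le> (K * (h j)\<^sup>2) * (\<Sum>i<N. (inner w (\<phi> i))\<^sup>2)" for w
      unfolding grid_op_def K_def[symmetric] using K
      by (intro order.trans[OF noise_op_diff[of N "b - s" w, folded K_def]] mult_right_mono mult_left_mono sum_nonneg) auto
    then have "?hs j s \<le> (\<Sum>l. ennreal (K * (h j)\<^sup>2) * ennreal (\<Sum>i<N. (inner (Qh (\<phi> l)) (\<phi> i))\<^sup>2))"
      unfolding hs_norm_sq_def grid_step_integrand[OF assms(2) k] using K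
      by (intro suminf_le summableI) (simp add: ennreal_mult[symmetric] sum_nonneg ennreal_leI)
    also have "\<dots> = ennreal (K * (h j)\<^sup>2) * ennreal A"
      by (simp only: ennreal_suminf_cmult A)
    finally show ?thesis using K by (simp add: ennreal_mult A_def)
  qed
  have "S.step_error (Suc j) (grid a b (Suc j)) (grid_op N a b j) \<le> ennreal (K * (h j)\<^sup>2 * A * (b - a))" for j
  proof -
    have "S.step_error (Suc j) (grid a b (Suc j)) (grid_op N a b j) \<le> (\<integral>\<^sup>+s\<in>{a..b}. ennreal (K * (h j)\<^sup>2 * A) \<partial>lborel)"
      unfolding S.step_error_def
    proof (rule nn_integral_mono_AE)
      \<comment> \<open>The cells are open on the left, so the step integrand vanishes at
        \<open>a\<close>; this single point is a null set.\<close>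
      show "AE s in lborel. ?hs j s * indicator {a..b} s \<le> ennreal (K * (h j)\<^sup>2 * A) * indicator {a..b} s"
        using AE_lborel_singleton[of a]
      proof eventually_elim
        case (elim s)
        then show ?case using hs[of s j] by (cases "s \<in> {a..b}") simp_all
      qed
    qed
    also have "\<dots> = ennreal (K * (h j)\<^sup>2 * A * (b - a))"
      using assms K by (simp add: nn_integral_cmult ennreal_mult A_def)
    finally show ?thesis .
  qed
  note le = this
  have "(\<lambda>j. ennreal (K * (h j)\<^sup>2 * A * (b - a))) \<longlonglongrightarrow> ennreal (K * 0\<^sup>2 * A * (b - a))"
    unfolding h_def by (intro tendsto_ennrealI tendsto_intros LIMSEQ_Suc[OF lim_const_over_n])
  then have "(\<lambda>j. ennreal (K * (h j)\<^sup>2 * A * (b - a))) \<longlonglongrightarrow> 0" by simp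
  then show ?thesis
    by (rule tendsto_sandwich[rotated 3, OF _ always_eventually always_eventually tendsto_const])
      (simp_all only: le zero_le simp_thms)
qed

end

section \<open>Galerkin solution and local remainders in spectral coordinates\<close>

context dirichlet_problem
begin

lemma integral_pair_lincomb:
  fixes s t :: real
  assumes "\<And>i. i < N \<Longrightarrow> continuous_on {s..t} (\<lambda>r. c r i)" "\<And>i. i < N \<Longrightarrow> continuous_on {s..t} (\<lambda>r. d r i)"
  shows "integral {s..t} (\<lambda>r. (lincomb N (c r), lincomb N (d r)))
    = (lincomb N (\<lambda>i. integral {s..t} (\<lambda>r. c r i)), lincomb N (\<lambda>i. integral {s..t} (\<lambda>r. d r i)))"
proof -
  have eq: "(lincomb N c, lincomb N d) = (\<Sum>i<N. c i *\<^sub>R (\<phi> i, 0) + d i *\<^sub>R (0, \<phi> i))" for c d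
    by (simp add: prod_eq_iff fst_sum snd_sum lincomb_def)
  have ints: "(\<lambda>r. c r i) integrable_on {s..t}" "(\<lambda>r. d r i) integrable_on {s..t}" if "i \<in> {..<N}" for i
    using that by (auto intro!: integrable_continuous_real assms)
  have "((\<lambda>r. \<Sum>i<N. c r i *\<^sub>R (\<phi> i, 0) + d r i *\<^sub>R (0, \<phi> i)) has_integral
    (\<Sum>i<N. integral {s..t} (\<lambda>r. c r i) *\<^sub>R (\<phi> i, 0) + integral {s..t} (\<lambda>r. d r i) *\<^sub>R (0, \<phi> i))) {s..t}"
    by (intro has_integral_sum has_integral_add has_integral_scaleR_left integrable_integral ints) simp_all
  then show ?thesis unfolding eq by (rule integral_unique)
qed

end

context dirichlet_nonlinearity
begin

definition f_coeff :: "nat \<Rightarrow> (nat \<Rightarrow> real) \<Rightarrow> nat \<Rightarrow> real" where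
  "f_coeff N c i = inner (nemytskii D f (lincomb N c)) (\<phi> i)"

lemma f_coeff_continuous: "continuous_on UNIV (\<lambda>c. f_coeff N c i)"
  unfolding f_coeff_def by (rule nemytskii_continuous)

lemma f_coeff_cong: "(\<And>j. j < N \<Longrightarrow> c j = d j) \<Longrightarrow> f_coeff N c = f_coeff N d"
  unfolding f_coeff_def lincomb_def by simp

lemma FF_N_lincomb: "FF_N D f \<phi> N (x, lincomb N c) = (lincomb N (\<lambda>i. 0), lincomb N (f_coeff N c))"
  by (simp add: FF_N_def P_N_lincomb f_coeff_def[abs_def]) (simp add: lincomb_def)

lemma f_coeff_one_sided_lipschitz:
  "(\<Sum>i<N. (f_coeff N c i - f_coeff N d i) * (c i - d i)) \<le> max 0 C1 * (\<Sum>i<N. (c i - d i)\<^sup>2)"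
proof -
  have "(\<Sum>i<N. (f_coeff N c i - f_coeff N d i) * (c i - d i))
      = inner (nemytskii D f (lincomb N c) - nemytskii D f (lincomb N d)) (lincomb N c - lincomb N d)"
    unfolding lincomb_diff by (subst (3) lincomb_def) (simp add: inner_sum_right f_coeff_def inner_diff_left mult.commute)
  also have "\<dots> \<le> max 0 C1 * (norm (lincomb N c - lincomb N d))\<^sup>2"
    by (rule nemytskii_one_sided_lipschitz[OF lincomb_in_U_N lincomb_in_U_N])
  finally show ?thesis by (simp add: lincomb_diff norm_lincomb)
qed

text \<open>Nothing is assumed about the coefficients from \<open>N\<close> on, so they are set to 0
  before the sequence is viewed as a Borel map.\<close>

lemma measurable_f_coeff:
  assumes "\<And>j. j < N \<Longrightarrow> (\<lambda>\<omega>. c \<omega> j) \<in> borel_measurable M"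
  shows "(\<lambda>\<omega>. f_coeff N (c \<omega>) i) \<in> borel_measurable M"
proof -
  have "(\<lambda>\<omega> j. if j < N then c \<omega> j else 0) \<in> borel_measurable M"
  proof (rule measurable_coordinatewise_then_product)
    show "(\<lambda>\<omega>. if j < N then c \<omega> j else 0) \<in> borel_measurable M" for j
      by (cases "j < N") (simp_all add: assms)
  qed
  from measurable_compose[OF this borel_measurable_continuous_onI[OF f_coeff_continuous]]
  have "(\<lambda>\<omega>. f_coeff N (\<lambda>j. if j < N then c \<omega> j else 0) i) \<in> borel_measurable M" .
  moreover have "f_coeff N (\<lambda>j. if j < N then c \<omega> j else 0) = f_coeff N (c \<omega>)" for \<omega>
    by (rule f_coeff_cong) simp
  ultimately show ?thesis by simp
qed

lemma continuous_f_coeff: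
  assumes "\<And>j. j < N \<Longrightarrow> continuous_on S (\<lambda>s. c s j)"
  shows "continuous_on S (\<lambda>s. f_coeff N (c s) i)"
proof -
  have "continuous_on S (\<lambda>s j. if j < N then c s j else 0)"
  proof (rule continuous_on_coordinatewise_then_product)
    show "continuous_on S (\<lambda>s. if j < N then c s j else 0)" for j
      using assms by (cases "j < N") simp_all
  qed
  from continuous_on_compose2[OF f_coeff_continuous this subset_UNIV]
  have "continuous_on S (\<lambda>s. f_coeff N (\<lambda>j. if j < N then c s j else 0) i)" .
  moreover have "f_coeff N (\<lambda>j. if j < N then c s j else 0) = f_coeff N (c s)" for s
    by (rule f_coeff_cong) simp
  ultimately show ?thesis by simp
qed

text \<open>The one-sided Lipschitz condition makes the solution operator of the implicit equation
  Lipschitz continuous on its domain, which need not be known to be the whole space.\<close>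

lemma implicit_lipschitz:
  assumes \<tau>: "\<tau> \<ge> 0" "max 0 C1 * \<tau> \<le> 1 / 2"
    and y: "\<And>i. i < N \<Longrightarrow> y i = z i + \<tau> * f_coeff N y i" "\<And>i. i < N \<Longrightarrow> y' i = z' i + \<tau> * f_coeff N y' i"
    and k: "k < N"
  shows "\<bar>y k - y' k\<bar> \<le> 2 * sqrt (\<Sum>i<N. (z i - z' i)\<^sup>2)"
proof -
  define A where "A = (\<Sum>i<N. (y i - y' i)\<^sup>2)"
  define B where "B = (\<Sum>i<N. (z i - z' i)\<^sup>2)"
  have nn: "A \<ge> 0" "B \<ge> 0" by (simp_all add: A_def B_def sum_nonneg)
  have "A = (\<Sum>i<N. (z i - z' i) * (y i - y' i) + \<tau> * ((f_coeff N y i - f_coeff N y' i) * (y i - y' i)))"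
    unfolding A_def
  proof (rule sum.cong)
    fix i assume "i \<in> {..<N}"
    then have "y i - y' i = (z i - z' i) + \<tau> * (f_coeff N y i - f_coeff N y' i)"
      using y[of i] by (simp add: algebra_simps)
    then have "(y i - y' i) * (y i - y' i) = ((z i - z' i) + \<tau> * (f_coeff N y i - f_coeff N y' i)) * (y i - y' i)"
      by (rule arg_cong)
    then show "(y i - y' i)\<^sup>2 = (z i - z' i) * (y i - y' i) + \<tau> * ((f_coeff N y i - f_coeff N y' i) * (y i - y' i))"
      unfolding power2_eq_square distrib_right mult.assoc .
  qed simp
  also have "\<dots> = (\<Sum>i<N. (z i - z' i) * (y i - y' i)) + \<tau> * (\<Sum>i<N. (f_coeff N y i - f_coeff N y' i) * (y i - y' i))"
    by (simp add: sum.distrib sum_distrib_left)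
  also have "\<tau> * (\<Sum>i<N. (f_coeff N y i - f_coeff N y' i) * (y i - y' i)) \<le> \<tau> * (max 0 C1 * A)"
    unfolding A_def by (intro mult_left_mono f_coeff_one_sided_lipschitz \<tau>)
  \<comment> \<open>Half of \<open>A\<close> is absorbed on the left, whence the factor 2 of the
    Lipschitz bound.\<close>
  also have "\<tau> * (max 0 C1 * A) \<le> 1 / 2 * A"
    using mult_right_mono[OF \<tau>(2) nn(1)] by (simp add: mult_ac)
  also have "(\<Sum>i<N. (z i - z' i) * (y i - y' i)) \<le> sqrt B * sqrt A"
  proof -
    have "(\<Sum>i<N. (z i - z' i) * (y i - y' i))\<^sup>2 \<le> B * A"
      unfolding A_def B_def by (rule Cauchy_Schwarz_ineq_sum)
    from real_sqrt_le_mono[OF this] show ?thesis by (simp add: real_sqrt_mult)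
  qed
  finally have "sqrt A * sqrt A \<le> (2 * sqrt B) * sqrt A" using nn by simp
  then have "sqrt A \<le> 2 * sqrt B"
    using nn mult_right_le_imp_le[of "sqrt A" "sqrt A" "2 * sqrt B"] by (cases "A = 0") simp_all
  moreover have "\<bar>y k - y' k\<bar> \<le> sqrt A"
    using member_le_sum[of k "{..<N}" "\<lambda>i. (y i - y' i)\<^sup>2"] k
    by (intro real_le_rsqrt) (simp add: A_def)
  ultimately show ?thesis by (simp add: B_def)
qed

text \<open>A solution map \<open>g\<close> is chosen on the set \<open>S\<close> of solvable data.
  It is continuous there by the Lipschitz bound, and the trace Borel structure on \<open>S\<close>
  allows composition with the data without knowing \<open>S\<close> to be measurable.\<close>

lemma implicit_measurable:
  assumes \<tau>: "\<tau> \<ge> 0" "max 0 C1 * \<tau> \<le> 1 / 2"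
    and y: "\<And>\<omega> i. \<omega> \<in> space M \<Longrightarrow> i < N \<Longrightarrow> y \<omega> i = z \<omega> i + \<tau> * f_coeff N (y \<omega>) i"
    and z: "\<And>i. i < N \<Longrightarrow> (\<lambda>\<omega>. z \<omega> i) \<in> borel_measurable M"
    and k: "k < N"
  shows "(\<lambda>\<omega>. y \<omega> k) \<in> borel_measurable M"
proof -
  define S where "S = {z :: nat \<Rightarrow> real. \<exists>y. \<forall>i<N. y i = z i + \<tau> * f_coeff N y i}"
  define g where "g z = (SOME y. \<forall>i<N. y i = z i + \<tau> * f_coeff N y i)" for z :: "nat \<Rightarrow> real"
  have g: "\<forall>i<N. g z i = z i + \<tau> * f_coeff N (g z) i" if "z \<in> S" for z
    using that unfolding S_def g_def mem_Collect_eq by (rule someI_ex)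
  have lip: "\<bar>g z' k - g z k\<bar> \<le> 2 * sqrt (\<Sum>i<N. (z' i - z i)\<^sup>2)" if "z \<in> S" "z' \<in> S" for z z'
    using g[OF that(1)] g[OF that(2)] by (intro implicit_lipschitz[OF \<tau>] k) simp_all
  have "continuous_on S (\<lambda>z. g z k)"
    unfolding continuous_on_def
  proof
    fix z assume z: "z \<in> S"
    have "continuous_on UNIV (\<lambda>z'. 2 * sqrt (\<Sum>i<N. (z' i - z i)\<^sup>2))"
      by (intro continuous_intros continuous_on_product_coordinates)
    then have "((\<lambda>z'. 2 * sqrt (\<Sum>i<N. (z' i - z i)\<^sup>2)) \<longlongrightarrow> 2 * sqrt (\<Sum>i<N. (z i - z i)\<^sup>2)) (at z within S)"
      by (meson UNIV_I continuous_on_def subset_UNIV tendsto_within_subset)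
    then have l0: "((\<lambda>z'. 2 * sqrt (\<Sum>i<N. (z' i - z i)\<^sup>2)) \<longlongrightarrow> 0) (at z within S)" by simp
    have "((\<lambda>z'. g z' k - g z k) \<longlongrightarrow> 0) (at z within S)"
    proof (rule Lim_null_comparison[OF _ l0])
      show "\<forall>\<^sub>F z' in at z within S. norm (g z' k - g z k) \<le> 2 * sqrt (\<Sum>i<N. (z' i - z i)\<^sup>2)"
        unfolding eventually_at_filter by (intro always_eventually allI impI) (simp add: lip[OF z])
    qed
    then show "((\<lambda>z. g z k) \<longlongrightarrow> g z k) (at z within S)" by (rule LIM_zero_cancel)
  qed
  then have gm: "(\<lambda>z. g z k) \<in> borel_measurable (restrict_space borel S)"
    by (rule borel_measurable_continuous_on_restrict)
  define z0 where "z0 \<omega> i = (if i < N then z \<omega> i else 0)" for \<omega> i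
  have zS: "z0 \<omega> \<in> S" if "\<omega> \<in> space M" for \<omega>
    unfolding S_def mem_Collect_eq z0_def using y[OF that] by (intro exI[of _ "y \<omega>"]) simp
  have "z0 \<in> borel_measurable M"
  proof (rule measurable_coordinatewise_then_product)
    show "(\<lambda>\<omega>. z0 \<omega> i) \<in> borel_measurable M" for i
      unfolding z0_def by (cases "i < N") (simp_all add: z)
  qed
  then have "z0 \<in> measurable M (restrict_space borel S)"
    by (intro measurable_restrict_space2) (use zS in auto)
  from measurable_compose[OF this gm] have m: "(\<lambda>\<omega>. g (z0 \<omega>) k) \<in> borel_measurable M" .
  \<comment> \<open>The Lipschitz bound for equal data is uniqueness, which identifies the chosen
    solution with the given one.\<close>
  have "g (z0 \<omega>) k = y \<omega> k" if \<omega>: "\<omega> \<in> space M" for \<omega>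
  proof -
    have "\<bar>g (z0 \<omega>) k - y \<omega> k\<bar> \<le> 2 * sqrt (\<Sum>i<N. (z0 \<omega> i - z0 \<omega> i)\<^sup>2)"
    proof (rule implicit_lipschitz[OF \<tau> _ _ k])
      show "g (z0 \<omega>) i = z0 \<omega> i + \<tau> * f_coeff N (g (z0 \<omega>)) i" if "i < N" for i
        using g[OF zS[OF \<omega>]] that by blast
      show "y \<omega> i = z0 \<omega> i + \<tau> * f_coeff N (y \<omega>) i" if "i < N" for i
        using y[OF \<omega> that] that by (simp add: z0_def)
    qed
    then show ?thesis by simp
  qed
  then show ?thesis using m by (simp cong: measurable_cong)
qed

end

text \<open>The Stieltjes sums with the identity as integrator are Riemann sums, and their pointwise
  limit is measurable.\<close>

lemma measurable_integral_continuous: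
  fixes h :: "real \<Rightarrow> 'w \<Rightarrow> real"
  assumes ab: "a \<le> b" and m: "\<And>s. s \<in> {a..b} \<Longrightarrow> h s \<in> borel_measurable M"
    and c: "\<And>\<omega>. \<omega> \<in> space M \<Longrightarrow> continuous_on {a..b} (\<lambda>s. h s \<omega>)"
  shows "(\<lambda>\<omega>. integral {a..b} (\<lambda>s. h s \<omega>)) \<in> borel_measurable M"
proof (rule borel_measurable_LIMSEQ_real)
  let ?S = "\<lambda>n \<omega>. \<Sum>k<Suc n. h (grid a b (Suc n) (Suc k)) \<omega> * (grid a b (Suc n) (Suc k) - grid a b (Suc n) k)"
  show "(\<lambda>n. ?S n \<omega>) \<longlonglongrightarrow> integral {a..b} (\<lambda>s. h s \<omega>)" if "\<omega> \<in> space M" for \<omega>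
    using riemann_stieltjes_right[OF ab c[OF that], of "\<lambda>_. 1" "\<lambda>s. s"] by (simp add: DERIV_ident)
  show "?S n \<in> borel_measurable M" for n
  proof (intro borel_measurable_sum borel_measurable_times borel_measurable_const m)
    fix k assume "k \<in> {..<Suc n}"
    then show "grid a b (Suc n) (Suc k) \<in> {a..b}" by (intro grid_in ab) auto
  qed
qed

locale galerkin_scheme = dirichlet_nonlinearity D lam \<phi> f C0 C1 C2 C3 \<gamma> + wave_noise D lam \<phi> P F Q Qh W
  for D :: "'a::euclidean_space set" and lam \<phi> f C0 C1 C2 C3 \<gamma>
    and P :: "'w measure" and F Q Qh W +
  fixes X0 :: "'w \<Rightarrow> 'a L2 \<times> 'a L2" and T :: real and N M :: nat
    and X :: "real \<Rightarrow> 'w \<Rightarrow> 'a L2 \<times> 'a L2" and Y :: "nat \<Rightarrow> 'w \<Rightarrow> 'a L2 \<times> 'a L2"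
    and \<tau> :: real
  assumes T_pos: "T > 0" and M_pos: "M \<ge> 1" and tau_def: "\<tau> = T / real M"
    and step_restriction: "C1 > 0 \<longrightarrow> \<tau> \<le> 1 / (6 * max 0 C1)"
    and solution: "galerkin_solution D lam \<phi> f P F W X0 T N X"
    and scheme: "time_scheme D lam \<phi> f P W N X \<tau> M Y"
begin

lemma tau_pos: "\<tau> > 0"
  using T_pos M_pos by (simp add: tau_def)

lemma tau_C1: "max 0 C1 * \<tau> \<le> 1 / 6"
proof (cases "C1 > 0")
  case True
  then have "\<tau> * (6 * C1) \<le> 1" using step_restriction by (simp add: pos_le_divide_eq)
  then show ?thesis using True by (simp add: mult_ac)
qed simp

definition tm :: "nat \<Rightarrow> real" where "tm m = real m * \<tau>"

lemma tm_nonneg: "0 \<le> tm m" using tau_pos by (simp add: tm_def)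

lemma tm_Suc: "tm (Suc m) = tm m + \<tau>" by (simp add: tm_def distrib_right)

lemma tm_le_Suc: "tm m \<le> tm (Suc m)" using tau_pos by (simp add: tm_Suc)

lemma tm_le_T: "m \<le> M \<Longrightarrow> tm m \<le> T"
proof -
  assume "m \<le> M"
  then have "tm m \<le> real M * \<tau>" unfolding tm_def using tau_pos by (intro mult_right_mono) auto
  then show ?thesis using M_pos by (simp add: tau_def)
qed

definition u :: "nat \<Rightarrow> real \<Rightarrow> 'w \<Rightarrow> real" where "u i t \<omega> = inner (fst (X t \<omega>)) (\<phi> i)"
definition v :: "nat \<Rightarrow> real \<Rightarrow> 'w \<Rightarrow> real" where "v i t \<omega> = inner (snd (X t \<omega>)) (\<phi> i)"
definition \<beta> :: "nat \<Rightarrow> real \<Rightarrow> 'w \<Rightarrow> real" where "\<beta> i t \<omega> = inner (W t \<omega>) (\<phi> i)"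
definition Fc :: "nat \<Rightarrow> real \<Rightarrow> 'w \<Rightarrow> real" where "Fc i t \<omega> = f_coeff N (\<lambda>j. v j t \<omega>) i"

lemma X_adapted: "t \<in> {0..T} \<Longrightarrow> X t \<in> borel_measurable (F t)"
  and X_in: "\<omega> \<in> space P \<Longrightarrow> t \<in> {0..T} \<Longrightarrow> X t \<omega> \<in> U_N \<phi> N \<times> U_N \<phi> N"
  and X_continuous: "\<omega> \<in> space P \<Longrightarrow> continuous_on {0..T} (\<lambda>t. X t \<omega>)"
  and X_equation: "AE \<omega> in P. \<forall>t\<in>{0..T}. X t \<omega> =
        (P_N \<phi> N (fst (X0 \<omega>)), P_N \<phi> N (snd (X0 \<omega>)))
        + integral {0..t} (\<lambda>s. A_N lam \<phi> N (X s \<omega>) + FF_N D f \<phi> N (X s \<omega>))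
        + B_N \<phi> N (W t \<omega> - W 0 \<omega>)"
proof -
  have 1: "\<forall>t\<in>{0..T}. X t \<in> borel_measurable (F t)"
    using solution unfolding galerkin_solution_def by (elim conjE)
  have 2: "\<forall>\<omega>\<in>space P. (\<forall>t\<in>{0..T}. X t \<omega> \<in> U_N \<phi> N \<times> U_N \<phi> N) \<and> continuous_on {0..T} (\<lambda>t. X t \<omega>)"
    using solution unfolding galerkin_solution_def by (elim conjE)
  show "AE \<omega> in P. \<forall>t\<in>{0..T}. X t \<omega> =
        (P_N \<phi> N (fst (X0 \<omega>)), P_N \<phi> N (snd (X0 \<omega>)))
        + integral {0..t} (\<lambda>s. A_N lam \<phi> N (X s \<omega>) + FF_N D f \<phi> N (X s \<omega>))
        + B_N \<phi> N (W t \<omega> - W 0 \<omega>)"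
    using solution unfolding galerkin_solution_def by (elim conjE)
  show "t \<in> {0..T} \<Longrightarrow> X t \<in> borel_measurable (F t)" using 1 by (rule bspec)
  show "\<omega> \<in> space P \<Longrightarrow> t \<in> {0..T} \<Longrightarrow> X t \<omega> \<in> U_N \<phi> N \<times> U_N \<phi> N"
    using bspec[OF conjunct1[OF bspec[OF 2, of \<omega>]], of t] .
  show "\<omega> \<in> space P \<Longrightarrow> continuous_on {0..T} (\<lambda>t. X t \<omega>)"
    using bspec[OF 2, of \<omega>] by (rule conjunct2)
qed

lemma X_lincomb:
  "\<omega> \<in> space P \<Longrightarrow> t \<in> {0..T} \<Longrightarrow> X t \<omega> = (lincomb N (\<lambda>i. u i t \<omega>), lincomb N (\<lambda>i. v i t \<omega>))"
  using pair_lincomb[OF X_in] by (simp add: u_def v_def)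

lemma coordinates_measurable:
  assumes "Z \<in> borel_measurable G"
  shows "(\<lambda>\<omega>. inner (fst (Z \<omega>)) w) \<in> borel_measurable G" "(\<lambda>\<omega>. inner (snd (Z \<omega>)) w) \<in> borel_measurable G"
  using assms
  by (rule measurable_compose[OF _ borel_measurable_continuous_onI]; intro continuous_intros)+

lemma u_adapted: "t \<in> {0..T} \<Longrightarrow> u i t \<in> borel_measurable (F t)"
  and v_adapted: "t \<in> {0..T} \<Longrightarrow> v i t \<in> borel_measurable (F t)"
  unfolding u_def[abs_def] v_def[abs_def] by (intro coordinates_measurable X_adapted; assumption)+

lemma beta_adapted: "0 \<le> t \<Longrightarrow> \<beta> i t \<in> borel_measurable (F t)"
  unfolding \<beta>_def[abs_def] by (intro noise.inner_borel_measurable noise.W_adapted)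

lemma Fc_adapted: "t \<in> {0..T} \<Longrightarrow> Fc i t \<in> borel_measurable (F t)"
  unfolding Fc_def[abs_def] by (intro measurable_f_coeff v_adapted)

lemma u_continuous: "\<omega> \<in> space P \<Longrightarrow> continuous_on {0..T} (\<lambda>t. u i t \<omega>)"
  and v_continuous: "\<omega> \<in> space P \<Longrightarrow> continuous_on {0..T} (\<lambda>t. v i t \<omega>)"
  unfolding u_def v_def by (intro continuous_intros X_continuous; assumption)+

lemma Fc_continuous: "\<omega> \<in> space P \<Longrightarrow> continuous_on {0..T} (\<lambda>t. Fc i t \<omega>)"
  unfolding Fc_def by (intro continuous_f_coeff v_continuous)

lemma FF_X: "\<omega> \<in> space P \<Longrightarrow> t \<in> {0..T} \<Longrightarrow> FF_N D f \<phi> N (X t \<omega>) = (lincomb N (\<lambda>i. 0), lincomb N (\<lambda>i. Fc i t \<omega>))"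
  by (subst X_lincomb) (simp_all add: FF_N_lincomb Fc_def)

text \<open>The equation splits into scalar oscillators, coupled only through \<open>Fc\<close>.
  Continuity of the driving paths is bundled in because it too holds only almost surely.\<close>

lemma coordinate_equations:
  "AE \<omega> in P. \<forall>i<N. continuous_on {0..T} (\<lambda>t. \<beta> i t \<omega>) \<and>
     (\<forall>t\<in>{0..T}. u i t \<omega> = inner (fst (X0 \<omega>)) (\<phi> i) + integral {0..t} (\<lambda>s. v i s \<omega>) \<and>
       v i t \<omega> = inner (snd (X0 \<omega>)) (\<phi> i) + integral {0..t} (\<lambda>s. Fc i s \<omega> - lam i * u i s \<omega>) + (\<beta> i t \<omega> - \<beta> i 0 \<omega>))"
  using X_equation noise.W_continuous AE_space
proof eventually_elim
  case (elim \<omega>)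
  have eq: "u i t \<omega> = inner (fst (X0 \<omega>)) (\<phi> i) + integral {0..t} (\<lambda>s. v i s \<omega>) \<and>
       v i t \<omega> = inner (snd (X0 \<omega>)) (\<phi> i) + integral {0..t} (\<lambda>s. Fc i s \<omega> - lam i * u i s \<omega>) + (\<beta> i t \<omega> - \<beta> i 0 \<omega>)"
    if t: "t \<in> {0..T}" and i: "i < N" for t i
  proof -
    have sub: "{0..t} \<subseteq> {0..T}" using t by auto
    have drift: "A_N lam \<phi> N (X s \<omega>) + FF_N D f \<phi> N (X s \<omega>)
        = (lincomb N (\<lambda>i. v i s \<omega>), lincomb N (\<lambda>i. Fc i s \<omega> - lam i * u i s \<omega>))" if "s \<in> {0..t}" for s
    proof -
      have s: "s \<in> {0..T}" using that sub by auto
      have "A_N lam \<phi> N (X s \<omega>) = (lincomb N (\<lambda>i. v i s \<omega>), lincomb N (\<lambda>i. - (lam i * u i s \<omega>)))"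
        unfolding X_lincomb[OF elim(3) s]
        using A_N_lincomb[of 1 N "\<lambda>i. u i s \<omega>" "\<lambda>i. v i s \<omega>"] by (simp add: wave_step_def)
      then show ?thesis by (simp add: FF_X[OF elim(3) s] lincomb_add)
    qed
    have "integral {0..t} (\<lambda>s. A_N lam \<phi> N (X s \<omega>) + FF_N D f \<phi> N (X s \<omega>))
        = integral {0..t} (\<lambda>s. (lincomb N (\<lambda>i. v i s \<omega>), lincomb N (\<lambda>i. Fc i s \<omega> - lam i * u i s \<omega>)))"
      by (rule Henstock_Kurzweil_Integration.integral_cong) (rule drift)
    also have "\<dots> = (lincomb N (\<lambda>i. integral {0..t} (\<lambda>s. v i s \<omega>)), lincomb N (\<lambda>i. integral {0..t} (\<lambda>s. Fc i s \<omega> - lam i * u i s \<omega>)))"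
      by (rule integral_pair_lincomb)
         (intro continuous_intros continuous_on_subset[OF _ sub] u_continuous v_continuous Fc_continuous elim(3))+
    finally have "X t \<omega> = (lincomb N (\<lambda>i. inner (fst (X0 \<omega>)) (\<phi> i) + integral {0..t} (\<lambda>s. v i s \<omega>)),
        lincomb N (\<lambda>i. inner (snd (X0 \<omega>)) (\<phi> i) + integral {0..t} (\<lambda>s. Fc i s \<omega> - lam i * u i s \<omega>) + (\<beta> i t \<omega> - \<beta> i 0 \<omega>)))"
      using bspec[OF elim(1) t] by (simp add: P_N_lincomb B_N_lincomb lincomb_add \<beta>_def inner_diff_left)
    then show ?thesis using i by (simp add: u_def v_def inner_lincomb)
  qed
  have "continuous_on {0..T} (\<lambda>t. \<beta> i t \<omega>)" for i
    unfolding \<beta>_def by (intro continuous_intros continuous_on_subset[OF elim(2)]) auto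
  then show ?case using eq by simp
qed

end

section \<open>The error recursion\<close>

text \<open>No integrability is assumed: \<open>real_cond_exp\<close> is meaningless for a non-integrable \<open>r\<close>, but then
  the right-hand side is infinite (or \<open>w = 0\<close>).\<close>

lemma (in prob_space) second_moment_split:
  fixes g r :: "'a \<Rightarrow> real"
  assumes sub: "subalgebra M G" and g: "g \<in> borel_measurable G" and r [measurable]: "r \<in> borel_measurable M"
    and w: "w \<ge> 0" and \<tau>: "\<tau> > 0"
  shows "(\<integral>\<^sup>+\<omega>. ennreal (w * (g \<omega> + r \<omega>)\<^sup>2) \<partial>M)
    \<le> ennreal (1 + \<tau>) * (\<integral>\<^sup>+\<omega>. ennreal (w * (g \<omega>)\<^sup>2) \<partial>M) + (\<integral>\<^sup>+\<omega>. ennreal (w * (r \<omega>)\<^sup>2) \<partial>M)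
      + ennreal (1 / \<tau>) * (\<integral>\<^sup>+\<omega>. ennreal (w * (real_cond_exp M G r \<omega>)\<^sup>2) \<partial>M)" (is "?L \<le> ?R")
proof (cases "w = 0")
  case False
  then have w0: "w > 0" using w by simp
  interpret finite_measure_subalgebra M G
    by unfold_locales (rule sub)
  have [measurable]: "g \<in> borel_measurable M" by (rule measurable_from_subalg[OF sub g])
  let ?c = "real_cond_exp M G r"
  show ?thesis
  proof (cases "?R = \<infinity>")
    case True
    show ?thesis unfolding True by (simp only: infinity_ennreal_def top_greatest)
  next
    case finite: False
    have fin: "(\<integral>\<^sup>+\<omega>. ennreal (w * (g \<omega>)\<^sup>2) \<partial>M) < \<infinity>" "(\<integral>\<^sup>+\<omega>. ennreal (w * (r \<omega>)\<^sup>2) \<partial>M) < \<infinity>"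
      "(\<integral>\<^sup>+\<omega>. ennreal (w * (?c \<omega>)\<^sup>2) \<partial>M) < \<infinity>"
      using finite \<tau> by (auto simp: less_top ennreal_mult_eq_top_iff)
    have ints: "integrable M (\<lambda>\<omega>. (h \<omega>)\<^sup>2)"
      if "(\<integral>\<^sup>+\<omega>. ennreal (w * (h \<omega>)\<^sup>2) \<partial>M) < \<infinity>" and [measurable]: "h \<in> borel_measurable M" for h
    proof -
      have "integrable M (\<lambda>\<omega>. w * (h \<omega>)\<^sup>2)"
        by (rule integrableI_bounded) (use that(1) w in simp_all)
      then show ?thesis using w0 by simp
    qed
    have ig: "integrable M (\<lambda>\<omega>. (g \<omega>)\<^sup>2)" by (rule ints[OF fin(1)]) simp
    have ir: "integrable M (\<lambda>\<omega>. (r \<omega>)\<^sup>2)" by (rule ints[OF fin(2)]) simp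
    have ic: "integrable M (\<lambda>\<omega>. (?c \<omega>)\<^sup>2)" by (rule ints[OF fin(3)]) simp
    have igr: "integrable M (\<lambda>\<omega>. g \<omega> * r \<omega>)"
      by (intro square_integrable_mult ig ir) measurable
    \<comment> \<open>Since \<open>g\<close> is measurable for the smaller sigma-algebra,
      \<open>r\<close> may be exchanged for its conditional expectation inside the mixed
      term.\<close>
    note c = real_cond_exp_intg[OF igr g r]
    have "2 * (\<integral>\<omega>. g \<omega> * ?c \<omega> \<partial>M) = (\<integral>\<omega>. 2 * (g \<omega> * ?c \<omega>) \<partial>M)" by simp
    also have "\<dots> \<le> (\<integral>\<omega>. \<tau> * (g \<omega>)\<^sup>2 + 1 / \<tau> * (?c \<omega>)\<^sup>2 \<partial>M)"
    proof (rule integral_mono)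
      fix \<omega>
      \<comment> \<open>Young's inequality with weight \<open>\<tau>\<close>: the part on
        \<open>g\<close> adds only \<open>\<tau>\<close> per step, the other part pays
        \<open>1 / \<tau>\<close>.\<close>
      have "0 \<le> (sqrt \<tau> * g \<omega> - ?c \<omega> / sqrt \<tau>)\<^sup>2" by simp
      also have "\<dots> = \<tau> * (g \<omega>)\<^sup>2 + 1 / \<tau> * (?c \<omega>)\<^sup>2 - 2 * (g \<omega> * ?c \<omega>)"
        using \<tau> by (simp add: power2_diff power_mult_distrib power_divide)
      finally show "2 * (g \<omega> * ?c \<omega>) \<le> \<tau> * (g \<omega>)\<^sup>2 + 1 / \<tau> * (?c \<omega>)\<^sup>2" by simp
    qed (use c(1) ig ic in simp_all)
    also have "\<dots> = \<tau> * (\<integral>\<omega>. (g \<omega>)\<^sup>2 \<partial>M) + 1 / \<tau> * (\<integral>\<omega>. (?c \<omega>)\<^sup>2 \<partial>M)"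
      using ig ic by simp
    finally have cross: "2 * (\<integral>\<omega>. g \<omega> * r \<omega> \<partial>M) \<le> \<tau> * (\<integral>\<omega>. (g \<omega>)\<^sup>2 \<partial>M) + 1 / \<tau> * (\<integral>\<omega>. (?c \<omega>)\<^sup>2 \<partial>M)"
      using c(2) by simp
    have sq: "(g \<omega> + r \<omega>)\<^sup>2 = (g \<omega>)\<^sup>2 + (r \<omega>)\<^sup>2 + 2 * (g \<omega> * r \<omega>)" for \<omega>
      by (simp add: power2_sum)
    have igr2: "integrable M (\<lambda>\<omega>. (g \<omega> + r \<omega>)\<^sup>2)" unfolding sq using ig ir igr by simp
    have "(\<integral>\<omega>. (g \<omega> + r \<omega>)\<^sup>2 \<partial>M) = (\<integral>\<omega>. (g \<omega>)\<^sup>2 \<partial>M) + (\<integral>\<omega>. (r \<omega>)\<^sup>2 \<partial>M) + 2 * (\<integral>\<omega>. g \<omega> * r \<omega> \<partial>M)"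
      unfolding sq using ig ir igr by simp
    then have main: "(\<integral>\<omega>. (g \<omega> + r \<omega>)\<^sup>2 \<partial>M) \<le> (1 + \<tau>) * (\<integral>\<omega>. (g \<omega>)\<^sup>2 \<partial>M) + (\<integral>\<omega>. (r \<omega>)\<^sup>2 \<partial>M) + 1 / \<tau> * (\<integral>\<omega>. (?c \<omega>)\<^sup>2 \<partial>M)"
      using cross by (simp add: distrib_right)
    have conv: "(\<integral>\<^sup>+\<omega>. ennreal (w * (h \<omega>)\<^sup>2) \<partial>M) = ennreal (w * (\<integral>\<omega>. (h \<omega>)\<^sup>2 \<partial>M))" if "integrable M (\<lambda>\<omega>. (h \<omega>)\<^sup>2)" for h
      using that w by (subst nn_integral_eq_integral) simp_all
    have "?L = ennreal (w * (\<integral>\<omega>. (g \<omega> + r \<omega>)\<^sup>2 \<partial>M))" by (rule conv[OF igr2])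
    also have "\<dots> \<le> ennreal (w * ((1 + \<tau>) * (\<integral>\<omega>. (g \<omega>)\<^sup>2 \<partial>M) + (\<integral>\<omega>. (r \<omega>)\<^sup>2 \<partial>M) + 1 / \<tau> * (\<integral>\<omega>. (?c \<omega>)\<^sup>2 \<partial>M)))"
      by (intro ennreal_leI mult_left_mono main w)
    also have "\<dots> = ennreal ((1 + \<tau>) * (w * (\<integral>\<omega>. (g \<omega>)\<^sup>2 \<partial>M)) + w * (\<integral>\<omega>. (r \<omega>)\<^sup>2 \<partial>M) + 1 / \<tau> * (w * (\<integral>\<omega>. (?c \<omega>)\<^sup>2 \<partial>M)))"
      by (rule arg_cong[of _ _ ennreal]) (simp add: algebra_simps)
    also have "\<dots> = ?R"
      unfolding conv[OF ig] conv[OF ir] conv[OF ic]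
    proof -
      have p: "0 \<le> 1 + \<tau>" "0 \<le> 1 / \<tau>" using \<tau> by simp_all
      have "ennreal ((1 + \<tau>) * A + B + 1 / \<tau> * C) = ennreal (1 + \<tau>) * ennreal A + ennreal B + ennreal (1 / \<tau>) * ennreal C"
        if "A \<ge> 0" "B \<ge> 0" "C \<ge> 0" for A B C
        by (simp only: ennreal_mult[symmetric] ennreal_plus[symmetric] p that mult_nonneg_nonneg add_nonneg_nonneg)
      then show "ennreal ((1 + \<tau>) * (w * (\<integral>\<omega>. (g \<omega>)\<^sup>2 \<partial>M)) + w * (\<integral>\<omega>. (r \<omega>)\<^sup>2 \<partial>M) + 1 / \<tau> * (w * (\<integral>\<omega>. (?c \<omega>)\<^sup>2 \<partial>M)))
        = ennreal (1 + \<tau>) * ennreal (w * (\<integral>\<omega>. (g \<omega>)\<^sup>2 \<partial>M)) + ennreal (w * (\<integral>\<omega>. (r \<omega>)\<^sup>2 \<partial>M))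
          + ennreal (1 / \<tau>) * ennreal (w * (\<integral>\<omega>. (?c \<omega>)\<^sup>2 \<partial>M))"
        using w by simp
    qed
    finally show ?thesis .
  qed
qed simp

text \<open>The velocity part is solved for the explicit data,
  \<open>h i + s i = b' i - \<tau> * d i\<close>, and squared; the mixed term is then controlled by
  the one-sided Lipschitz hypothesis on \<open>d\<close>.\<close>

lemma energy_step:
  fixes lam a' b' g h r s d :: "nat \<Rightarrow> real"
  assumes lam: "\<And>i. lam i \<ge> 0" and K: "K \<ge> 0" "\<tau> \<ge> 0" "K * \<tau> \<le> 1 / 6"
    and a': "\<And>i. i < N \<Longrightarrow> a' i = g i + r i" and b': "\<And>i. i < N \<Longrightarrow> b' i = h i + s i + \<tau> * d i"
    and d: "(\<Sum>i<N. d i * b' i) \<le> K * (\<Sum>i<N. (b' i)\<^sup>2)"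
  shows "(\<Sum>i<N. lam i * (a' i)\<^sup>2 + (b' i)\<^sup>2) \<le> (1 + 3 * (K * \<tau>)) * (\<Sum>i<N. lam i * (g i + r i)\<^sup>2 + (h i + s i)\<^sup>2)"
proof -
  define x where "x = K * \<tau>"
  have x: "0 \<le> x" "x \<le> 1 / 6" using K by (simp_all add: x_def)
  let ?E = "\<Sum>i<N. lam i * (a' i)\<^sup>2 + (b' i)\<^sup>2" and ?Z = "\<Sum>i<N. lam i * (g i + r i)\<^sup>2 + (h i + s i)\<^sup>2"
  have E0: "?E \<ge> 0" by (intro sum_nonneg add_nonneg_nonneg mult_nonneg_nonneg lam) simp_all
  have B: "(\<Sum>i<N. (b' i)\<^sup>2) \<le> ?E"
    using lam by (intro sum_mono) simp
  have "?E - 2 * \<tau> * (\<Sum>i<N. d i * b' i) = (\<Sum>i<N. lam i * (a' i)\<^sup>2 + (b' i)\<^sup>2 - 2 * \<tau> * (d i * b' i))"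
    by (simp add: sum_subtractf sum_distrib_left)
  also have "\<dots> \<le> ?Z"
  proof (rule sum_mono)
    fix i assume "i \<in> {..<N}"
    then have i: "i < N" by simp
    have hs: "h i + s i = b' i - \<tau> * d i" using b'[OF i] by simp
    \<comment> \<open>Only the nonnegative square of \<open>\<tau> * d i\<close> is dropped.\<close>
    have "(b' i)\<^sup>2 - 2 * \<tau> * (d i * b' i) \<le> (b' i - \<tau> * d i)\<^sup>2"
      by (simp add: power2_diff mult_ac)
    then show "lam i * (a' i)\<^sup>2 + (b' i)\<^sup>2 - 2 * \<tau> * (d i * b' i) \<le> lam i * (g i + r i)\<^sup>2 + (h i + s i)\<^sup>2"
      unfolding hs a'[OF i] by simp
  qed
  finally have 1: "?E - 2 * \<tau> * (\<Sum>i<N. d i * b' i) \<le> ?Z" .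
  have "\<tau> * (\<Sum>i<N. d i * b' i) \<le> \<tau> * (K * ?E)"
    using d mult_left_mono[OF B K(1)] by (intro mult_left_mono K) linarith
  then have 2: "(1 - 2 * x) * ?E \<le> ?Z" using 1 by (simp add: x_def algebra_simps)
  \<comment> \<open>Origin of the step restriction:
    \<open>(1 + 3 * x) * (1 - 2 * x) = 1 + x * (1 - 6 * x)\<close>, which is at least 1 exactly when
    \<open>x \<le> 1 / 6\<close> for positive \<open>x\<close>.\<close>
  have "x * (6 * x) \<le> x * 1" using x by (intro mult_left_mono) auto
  then have "1 \<le> (1 + 3 * x) * (1 - 2 * x)" by (simp add: algebra_simps)
  then have "1 * ?E \<le> ((1 + 3 * x) * (1 - 2 * x)) * ?E" by (rule mult_right_mono) (rule E0)
  also have "\<dots> \<le> (1 + 3 * x) * ?Z"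
    unfolding mult.assoc using 2 x by (intro mult_left_mono) auto
  finally show ?thesis by (simp add: x_def)
qed

text \<open>Each \<open>b i\<close> is charged the full power \<open>q ^ m\<close> instead of its
  own smaller one, which \<open>q \<ge> 1\<close> permits.\<close>

lemma discrete_gronwall_ennreal:
  fixes a b :: "nat \<Rightarrow> ennreal"
  assumes "a 0 = 0" "\<And>m. m < M \<Longrightarrow> a (Suc m) \<le> ennreal q * a m + b m" "q \<ge> 1" "m \<le> M"
  shows "a m \<le> ennreal (q ^ m) * (\<Sum>i<m. b i)"
  using assms(4)
proof (induction m)
  case (Suc m)
  have "a (Suc m) \<le> ennreal q * (ennreal (q ^ m) * (\<Sum>i<m. b i)) + 1 * b m"
    using Suc by (intro order.trans[OF assms(2)] add_mono mult_left_mono) auto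
  also have "\<dots> \<le> ennreal (q ^ Suc m) * (\<Sum>i<m. b i) + ennreal (q ^ Suc m) * b m"
  proof (intro add_mono mult_right_mono)
    show "ennreal q * (ennreal (q ^ m) * (\<Sum>i<m. b i)) \<le> ennreal (q ^ Suc m) * (\<Sum>i<m. b i)"
      using assms(3) by (simp add: ennreal_mult mult.assoc)
    show "1 \<le> ennreal (q ^ Suc m)"
      using ennreal_leI[OF one_le_power[OF assms(3), of "Suc m"]] by simp
  qed simp
  finally show ?case by (simp add: distrib_left)
qed (simp add: assms(1))

context dirichlet_problem
begin

lemma lincomb_sum: "(\<Sum>k\<in>K. lincomb N (c k)) = lincomb N (\<lambda>i. \<Sum>k\<in>K. c k i)"
  unfolding lincomb_def scaleR_sum_left by (rule sum.swap)

text \<open>All coefficients are collected in a single map into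
  \<open>bool \<times> nat \<Rightarrow> real\<close>, followed by a continuous map into the pair
  space; this avoids pairing two Borel maps in a space without a countable base.\<close>

lemma lincomb_pair_measurable:
  assumes "\<And>i. i < N \<Longrightarrow> (\<lambda>\<omega>. c \<omega> i) \<in> borel_measurable M" "\<And>i. i < N \<Longrightarrow> (\<lambda>\<omega>. d \<omega> i) \<in> borel_measurable M"
  shows "(\<lambda>\<omega>. (lincomb N (c \<omega>), lincomb N (d \<omega>))) \<in> borel_measurable M"
proof -
  define z where "z \<omega> k = (if snd k < N then if fst k then c \<omega> (snd k) else d \<omega> (snd k) else 0)" for \<omega> and k :: "bool \<times> nat"
  have z: "z \<in> borel_measurable M"
  proof (rule measurable_coordinatewise_then_product)
    show "(\<lambda>\<omega>. z \<omega> k) \<in> borel_measurable M" for k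
      unfolding z_def by (cases "snd k < N"; cases "fst k") (simp_all add: assms)
  qed
  have "continuous_on UNIV (\<lambda>z :: bool \<times> nat \<Rightarrow> real. (lincomb N (\<lambda>i. z (True, i)), lincomb N (\<lambda>i. z (False, i))))"
    unfolding lincomb_def by (intro continuous_intros continuous_on_product_coordinates)
  from measurable_compose[OF z borel_measurable_continuous_onI[OF this]]
  have "(\<lambda>\<omega>. (lincomb N (\<lambda>i. z \<omega> (True, i)), lincomb N (\<lambda>i. z \<omega> (False, i)))) \<in> borel_measurable M" .
  moreover have "lincomb N (\<lambda>i. z \<omega> (True, i)) = lincomb N (c \<omega>)" "lincomb N (\<lambda>i. z \<omega> (False, i)) = lincomb N (d \<omega>)" for \<omega>
    by (simp_all add: lincomb_def z_def)
  ultimately show ?thesis by simp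
qed

lemma norm_H1_pair:
  assumes "x \<in> U_N \<phi> N \<times> U_N \<phi> N"
  shows "(norm_H1 lam \<phi> x)\<^sup>2 = (\<Sum>i<N. lam i * (inner (fst x) (\<phi> i))\<^sup>2 + (inner (snd x) (\<phi> i))\<^sup>2)"
  by (subst pair_lincomb[OF assms]) (rule norm_H1_lincomb)

end

section \<open>The stochastic convolution and the local remainders\<close>

context galerkin_scheme
begin

definition drift_sin :: "nat \<Rightarrow> nat \<Rightarrow> 'w \<Rightarrow> real" where
  "drift_sin m i \<omega> = integral {tm m..tm (Suc m)} (\<lambda>s. wave_sin (lam i) (tm (Suc m) - s) * Fc i s \<omega>)"

definition drift_cos :: "nat \<Rightarrow> nat \<Rightarrow> 'w \<Rightarrow> real" where
  "drift_cos m i \<omega> = integral {tm m..tm (Suc m)} (\<lambda>s. wave_cos (lam i) (tm (Suc m) - s) * Fc i s \<omega>)"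

text \<open>The variation of constants formula solved for its noise term. Expressed through the
  solution alone, it is measurable and lies in the Galerkin space at every
  \<open>\<omega>\<close>.\<close>

definition pathwise_convolution :: "nat \<Rightarrow> 'w \<Rightarrow> 'a L2 \<times> 'a L2" where
  "pathwise_convolution m \<omega> =
    (lincomb N (\<lambda>i. u i (tm (Suc m)) \<omega> - (wave_cos (lam i) \<tau> * u i (tm m) \<omega> + wave_sin (lam i) \<tau> * v i (tm m) \<omega>)
       - drift_sin m i \<omega>),
     lincomb N (\<lambda>i. v i (tm (Suc m)) \<omega> - (- lam i * wave_sin (lam i) \<tau> * u i (tm m) \<omega> + wave_cos (lam i) \<tau> * v i (tm m) \<omega>)
       - drift_cos m i \<omega>))"

definition stochastic_convolution :: "nat \<Rightarrow> 'w \<Rightarrow> 'a L2 \<times> 'a L2" where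
  "stochastic_convolution m = stochastic_integral P (L2_on D) (U_N \<phi> N \<times> U_N \<phi> N) \<phi> Qh W
     (\<lambda>s. noise_op N (tm (Suc m) - s)) (tm m) (tm (Suc m))"

definition R :: "nat \<Rightarrow> 'w \<Rightarrow> 'a L2 \<times> 'a L2" where
  "R = local_remainder D lam \<phi> f P Qh W N X \<tau>"

lemma tm_in: "m \<le> M \<Longrightarrow> tm m \<in> {0..T}"
  using tm_nonneg tm_le_T by simp

lemma tm_interval: "m < M \<Longrightarrow> {tm m..tm (Suc m)} \<subseteq> {0..T}"
  using tm_nonneg[of m] tm_le_T[of "Suc m"] by auto

lemma u_measurable: "t \<in> {0..T} \<Longrightarrow> u i t \<in> borel_measurable P"
  and v_measurable: "t \<in> {0..T} \<Longrightarrow> v i t \<in> borel_measurable P"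
  and Fc_measurable: "t \<in> {0..T} \<Longrightarrow> Fc i t \<in> borel_measurable P"
  and beta_measurable: "0 \<le> t \<Longrightarrow> \<beta> i t \<in> borel_measurable P"
  by (rule noise.F_measurable_P[OF u_adapted] noise.F_measurable_P[OF v_adapted]
        noise.F_measurable_P[OF Fc_adapted] noise.F_measurable_P[OF beta_adapted]; simp)+

lemma wave_continuous: "continuous_on S (\<lambda>s. wave_sin (lam i) (b - s))" "continuous_on S (\<lambda>s. wave_cos (lam i) (b - s))"
proof -
  have c: "continuous_on UNIV (wave_sin (lam i))" "continuous_on UNIV (wave_cos (lam i))"
    using wave_sin_deriv[OF lam_nonneg] wave_cos_deriv[OF lam_nonneg]
    by (auto intro!: continuous_at_imp_continuous_on DERIV_isCont)
  show "continuous_on S (\<lambda>s. wave_sin (lam i) (b - s))" "continuous_on S (\<lambda>s. wave_cos (lam i) (b - s))"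
    by (rule continuous_on_compose2[OF c(1)] continuous_on_compose2[OF c(2)]; auto intro!: continuous_intros)+
qed

lemma drift_measurable:
  assumes "m < M"
  shows "drift_sin m i \<in> borel_measurable P" "drift_cos m i \<in> borel_measurable P"
  unfolding drift_sin_def[abs_def] drift_cos_def[abs_def]
  by (rule measurable_integral_continuous[OF tm_le_Suc];
      use tm_interval[OF assms] in \<open>auto intro!: borel_measurable_times Fc_measurable continuous_on_mult wave_continuous
        continuous_on_subset[OF Fc_continuous]\<close>)+

lemma pathwise_convolution_in: "pathwise_convolution m \<omega> \<in> U_N \<phi> N \<times> U_N \<phi> N"
  unfolding pathwise_convolution_def by (rule pair_in)

lemma pathwise_convolution_measurable:
  assumes "m < M"
  shows "pathwise_convolution m \<in> borel_measurable P"
  unfolding pathwise_convolution_def[abs_def] using assms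
  by (intro lincomb_pair_measurable borel_measurable_diff borel_measurable_add borel_measurable_times
      borel_measurable_const u_measurable v_measurable drift_measurable tm_in) auto

lemma step_integral_lincomb:
  "step_integral W (Suc j) (grid a b (Suc j)) (grid_op N a b j) \<omega>
    = (lincomb N (\<lambda>i. \<Sum>k<Suc j. wave_sin (lam i) (b - grid a b (Suc j) k) * (\<beta> i (grid a b (Suc j) (Suc k)) \<omega> - \<beta> i (grid a b (Suc j) k) \<omega>)),
       lincomb N (\<lambda>i. \<Sum>k<Suc j. wave_cos (lam i) (b - grid a b (Suc j) k) * (\<beta> i (grid a b (Suc j) (Suc k)) \<omega> - \<beta> i (grid a b (Suc j) k) \<omega>)))"
  unfolding step_integral_def grid_op_def noise_op_lincomb sum_prod lincomb_sum
  by (simp only: \<beta>_def inner_diff_left)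

text \<open>For each mode the scalar variation of constants formula is used twice, with weights
  taken from the two rows of the wave group at time \<open>b - s\<close>: cosine and sine for the
  position, \<open>- lam i\<close> times sine and cosine for the velocity. At \<open>s = b\<close>
  they reduce to 1 and 0, or 0 and 1.\<close>

lemma step_integral_limit:
  assumes m: "m < M"
  shows "AE \<omega> in P. (\<lambda>j. step_integral W (Suc j) (grid (tm m) (tm (Suc m)) (Suc j)) (grid_op N (tm m) (tm (Suc m)) j) \<omega>)
    \<longlonglongrightarrow> pathwise_convolution m \<omega>"
  using coordinate_equations AE_space
proof eventually_elim
  case (elim \<omega>)
  let ?a = "tm m" and ?b = "tm (Suc m)"
  have ab: "0 \<le> ?a" "?a \<le> ?b" "?b \<le> T"
    using tm_nonneg tm_le_Suc tm_le_T[of "Suc m"] m by simp_all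
  have d: "?b - ?a = \<tau>" by (simp add: tm_Suc)
  have lim: "(\<lambda>n. \<Sum>k<Suc n. q (grid ?a ?b (Suc n) k) * (\<beta> i (grid ?a ?b (Suc n) (Suc k)) \<omega> - \<beta> i (grid ?a ?b (Suc n) k) \<omega>))
    \<longlonglongrightarrow> (p ?b * u i ?b \<omega> + q ?b * v i ?b \<omega>) - (p ?a * u i ?a \<omega> + q ?a * v i ?a \<omega>) - integral {?a..?b} (\<lambda>s. q s * Fc i s \<omega>)"
    if i: "i < N" and pq: "\<And>s. (p has_real_derivative lam i * q s) (at s)" "\<And>s. (q has_real_derivative - p s) (at s)" for i p q
    using elim(1) i
    by (intro wave_variation_of_constants[OF ab u_continuous[OF elim(2)] v_continuous[OF elim(2)] _ Fc_continuous[OF elim(2)] _ _ pq,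
          where ?u0.0="inner (fst (X0 \<omega>)) (\<phi> i)" and ?v0.0="inner (snd (X0 \<omega>)) (\<phi> i)"]) simp_all
  have db: "((\<lambda>s. ?b - s) has_real_derivative - 1) (at s)" for s
    by (auto intro!: derivative_eq_intros)
  have ds: "((\<lambda>s. wave_sin (lam i) (?b - s)) has_real_derivative - wave_cos (lam i) (?b - s)) (at s)" for i s
    using DERIV_chain2[where f="wave_sin (lam i)" and g="\<lambda>s. ?b - s" and x=s, OF wave_sin_deriv[OF lam_nonneg] db] by simp
  have dc: "((\<lambda>s. wave_cos (lam i) (?b - s)) has_real_derivative lam i * wave_sin (lam i) (?b - s)) (at s)" for i s
    using DERIV_chain2[where f="wave_cos (lam i)" and g="\<lambda>s. ?b - s" and x=s, OF wave_cos_deriv[OF lam_nonneg] db] by simp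
  have dls: "((\<lambda>s. - lam i * wave_sin (lam i) (?b - s)) has_real_derivative lam i * wave_cos (lam i) (?b - s)) (at s)" for i s
    using DERIV_cmult[OF ds[of i s], of "- lam i"] by simp
  have dc': "((\<lambda>s. wave_cos (lam i) (?b - s)) has_real_derivative - (- lam i * wave_sin (lam i) (?b - s))) (at s)" for i s
    using dc[of i s] by simp
  have "(\<lambda>n. (lincomb N (\<lambda>i. \<Sum>k<Suc n. wave_sin (lam i) (?b - grid ?a ?b (Suc n) k) * (\<beta> i (grid ?a ?b (Suc n) (Suc k)) \<omega> - \<beta> i (grid ?a ?b (Suc n) k) \<omega>)),
       lincomb N (\<lambda>i. \<Sum>k<Suc n. wave_cos (lam i) (?b - grid ?a ?b (Suc n) k) * (\<beta> i (grid ?a ?b (Suc n) (Suc k)) \<omega> - \<beta> i (grid ?a ?b (Suc n) k) \<omega>))))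
    \<longlonglongrightarrow> pathwise_convolution m \<omega>"
    unfolding pathwise_convolution_def lincomb_def
  proof (intro tendsto_Pair tendsto_sum tendsto_scaleR tendsto_const)
    fix i assume "i \<in> {..<N}"
    then have i: "i < N" by simp
    show "(\<lambda>n. \<Sum>k<Suc n. wave_sin (lam i) (?b - grid ?a ?b (Suc n) k) * (\<beta> i (grid ?a ?b (Suc n) (Suc k)) \<omega> - \<beta> i (grid ?a ?b (Suc n) k) \<omega>))
      \<longlonglongrightarrow> u i ?b \<omega> - (wave_cos (lam i) \<tau> * u i ?a \<omega> + wave_sin (lam i) \<tau> * v i ?a \<omega>) - drift_sin m i \<omega>"
      using lim[OF i dc ds] by (simp add: d drift_sin_def)
    show "(\<lambda>n. \<Sum>k<Suc n. wave_cos (lam i) (?b - grid ?a ?b (Suc n) k) * (\<beta> i (grid ?a ?b (Suc n) (Suc k)) \<omega> - \<beta> i (grid ?a ?b (Suc n) k) \<omega>))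
      \<longlonglongrightarrow> v i ?b \<omega> - (- lam i * wave_sin (lam i) \<tau> * u i ?a \<omega> + wave_cos (lam i) \<tau> * v i ?a \<omega>) - drift_cos m i \<omega>"
      using lim[OF i dls dc'] by (simp add: d drift_cos_def)
  qed
  then show ?case unfolding step_integral_lincomb .
qed

text \<open>The pathwise limit shows that some integral exists, so the chosen one has the defining
  properties; measurability and range come from there, at every \<open>\<omega>\<close>.\<close>

lemma stochastic_convolution:
  assumes m: "m < M"
  shows "AE \<omega> in P. stochastic_convolution m \<omega> = pathwise_convolution m \<omega>" "stochastic_convolution m \<in> borel_measurable P"
    "\<And>\<omega>. \<omega> \<in> space P \<Longrightarrow> stochastic_convolution m \<omega> \<in> U_N \<phi> N \<times> U_N \<phi> N"
proof -
  interpret S: Q_wiener_integral P F "L2_on D" \<phi> Q Qh W "U_N \<phi> N \<times> U_N \<phi> N" "pair_basis N"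
    "tm m" "tm (Suc m)" "\<lambda>s. noise_op N (tm (Suc m) - s)"
    by (rule noise_integral_locale[OF tm_nonneg tm_le_Suc])
  note lim = S.stochastic_integral_limit[OF pathwise_convolution_measurable[OF m] pathwise_convolution_in grid_steps[OF tm_nonneg tm_le_Suc]
      grid_step_error[OF tm_nonneg tm_le_Suc] step_integral_limit[OF m]]
  show "AE \<omega> in P. stochastic_convolution m \<omega> = pathwise_convolution m \<omega>" unfolding stochastic_convolution_def by (rule lim(2))
  have "has_stochastic_integral P (L2_on D) (U_N \<phi> N \<times> U_N \<phi> N) \<phi> Qh W (\<lambda>s. noise_op N (tm (Suc m) - s)) (tm m) (tm (Suc m)) (stochastic_convolution m)"
    unfolding stochastic_convolution_def by (rule has_stochastic_integral_stochastic_integral[OF lim(1)])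
  note has = this[unfolded has_stochastic_integral_def]
  show "stochastic_convolution m \<in> borel_measurable P" using has by (rule conjunct1)
  show "\<omega> \<in> space P \<Longrightarrow> stochastic_convolution m \<omega> \<in> U_N \<phi> N \<times> U_N \<phi> N" for \<omega>
    by (rule bspec[OF conjunct1[OF conjunct2[OF has]]])
qed

definition d\<beta> :: "nat \<Rightarrow> nat \<Rightarrow> 'w \<Rightarrow> real" where
  "d\<beta> m i \<omega> = \<beta> i (tm (Suc m)) \<omega> - \<beta> i (tm m) \<omega>"

definition ra :: "nat \<Rightarrow> nat \<Rightarrow> 'w \<Rightarrow> real" where "ra m i \<omega> = inner (fst (R m \<omega>)) (\<phi> i)"
definition rb :: "nat \<Rightarrow> nat \<Rightarrow> 'w \<Rightarrow> real" where "rb m i \<omega> = inner (snd (R m \<omega>)) (\<phi> i)"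

text \<open>Valid at every \<open>\<omega>\<close>, since the chosen stochastic integral is kept as
  it is; exchanging it for the pathwise expression costs a null set and is postponed.\<close>

lemma remainder_formula:
  assumes m: "m < M" and \<omega>: "\<omega> \<in> space P"
  shows "R m \<omega> = (lincomb N (\<lambda>i. drift_sin m i \<omega> + inner (fst (stochastic_convolution m \<omega>)) (\<phi> i) - wave_sin (lam i) \<tau> * d\<beta> m i \<omega>),
    lincomb N (\<lambda>i. drift_cos m i \<omega> - \<tau> * Fc i (tm (Suc m)) \<omega> + inner (snd (stochastic_convolution m \<omega>)) (\<phi> i) - wave_cos (lam i) \<tau> * d\<beta> m i \<omega>))"
proof -
  let ?a = "tm m" and ?b = "tm (Suc m)"
  note sub = tm_interval[OF m]
  have b: "?b \<in> {0..T}" using m by (intro tm_in) simp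
  have "integral {?a..?b} (\<lambda>s. E_N lam \<phi> N (?b - s) (FF_N D f \<phi> N (X s \<omega>)) - FF_N D f \<phi> N (X ?b \<omega>))
     = integral {?a..?b} (\<lambda>s. (lincomb N (\<lambda>i. wave_sin (lam i) (?b - s) * Fc i s \<omega>), lincomb N (\<lambda>i. wave_cos (lam i) (?b - s) * Fc i s \<omega> - Fc i ?b \<omega>)))"
  proof (rule Henstock_Kurzweil_Integration.integral_cong)
    fix s assume "s \<in> {?a..?b}"
    then have s: "s \<in> {0..T}" using sub by auto
    show "E_N lam \<phi> N (?b - s) (FF_N D f \<phi> N (X s \<omega>)) - FF_N D f \<phi> N (X ?b \<omega>)
        = (lincomb N (\<lambda>i. wave_sin (lam i) (?b - s) * Fc i s \<omega>), lincomb N (\<lambda>i. wave_cos (lam i) (?b - s) * Fc i s \<omega> - Fc i ?b \<omega>))"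
      unfolding FF_X[OF \<omega> s] FF_X[OF \<omega> b] E_N_lincomb diff_Pair lincomb_diff by simp
  qed
  also have "\<dots> = (lincomb N (\<lambda>i. drift_sin m i \<omega>), lincomb N (\<lambda>i. integral {?a..?b} (\<lambda>s. wave_cos (lam i) (?b - s) * Fc i s \<omega> - Fc i ?b \<omega>)))"
    unfolding drift_sin_def
    by (rule integral_pair_lincomb)
       (intro continuous_intros wave_continuous continuous_on_subset[OF Fc_continuous[OF \<omega>] sub])+
  also have "(\<lambda>i. integral {?a..?b} (\<lambda>s. wave_cos (lam i) (?b - s) * Fc i s \<omega> - Fc i ?b \<omega>)) = (\<lambda>i. drift_cos m i \<omega> - \<tau> * Fc i ?b \<omega>)"
  proof
    fix i
    have "integral {?a..?b} (\<lambda>s. wave_cos (lam i) (?b - s) * Fc i s \<omega> - Fc i ?b \<omega>)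
        = drift_cos m i \<omega> - integral {?a..?b} (\<lambda>s. Fc i ?b \<omega>)"
      unfolding drift_cos_def
      by (intro Henstock_Kurzweil_Integration.integral_diff integrable_continuous_real continuous_intros wave_continuous
          continuous_on_subset[OF Fc_continuous[OF \<omega>] sub])
    also have "integral {?a..?b} (\<lambda>s. Fc i ?b \<omega>) = \<tau> * Fc i ?b \<omega>"
      using tm_le_Suc[of m] by (simp add: tm_Suc)
    finally show "integral {?a..?b} (\<lambda>s. wave_cos (lam i) (?b - s) * Fc i s \<omega> - Fc i ?b \<omega>) = drift_cos m i \<omega> - \<tau> * Fc i ?b \<omega>" .
  qed
  finally have I: "integral {?a..?b} (\<lambda>s. E_N lam \<phi> N (?b - s) (FF_N D f \<phi> N (X s \<omega>)) - FF_N D f \<phi> N (X ?b \<omega>))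
      = (lincomb N (\<lambda>i. drift_sin m i \<omega>), lincomb N (\<lambda>i. drift_cos m i \<omega> - \<tau> * Fc i ?b \<omega>))" .
  have N: "noise_op N \<tau> (W ?b \<omega> - W ?a \<omega>) = (lincomb N (\<lambda>i. wave_sin (lam i) \<tau> * d\<beta> m i \<omega>), lincomb N (\<lambda>i. wave_cos (lam i) \<tau> * d\<beta> m i \<omega>))"
    unfolding noise_op_lincomb d\<beta>_def \<beta>_def inner_diff_left ..
  have op: "(\<lambda>s w. E_N lam \<phi> N (?b - s) (B_N \<phi> N w)) = (\<lambda>s. noise_op N (?b - s))"
    by (simp add: noise_op_def fun_eq_iff)
  have "R m \<omega> = integral {?a..?b} (\<lambda>s. E_N lam \<phi> N (?b - s) (FF_N D f \<phi> N (X s \<omega>)) - FF_N D f \<phi> N (X ?b \<omega>))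
      + stochastic_convolution m \<omega> - noise_op N \<tau> (W ?b \<omega> - W ?a \<omega>)"
    unfolding R_def local_remainder_def Let_def tm_def[symmetric] stochastic_convolution_def noise_op_def[symmetric] op ..
  then show ?thesis
    unfolding I N by (subst (asm) pair_lincomb[OF stochastic_convolution(3)[OF m \<omega>]]) (simp add: lincomb_add lincomb_diff)
qed

lemma R_in: "m < M \<Longrightarrow> \<omega> \<in> space P \<Longrightarrow> R m \<omega> \<in> U_N \<phi> N \<times> U_N \<phi> N"
  using remainder_formula pair_in by simp

lemma remainder_coordinates:
  assumes m: "m < M" and \<omega>: "\<omega> \<in> space P" and i: "i < N"
  shows "ra m i \<omega> = drift_sin m i \<omega> + inner (fst (stochastic_convolution m \<omega>)) (\<phi> i) - wave_sin (lam i) \<tau> * d\<beta> m i \<omega>"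
    "rb m i \<omega> = drift_cos m i \<omega> - \<tau> * Fc i (tm (Suc m)) \<omega> + inner (snd (stochastic_convolution m \<omega>)) (\<phi> i) - wave_cos (lam i) \<tau> * d\<beta> m i \<omega>"
  using i by (simp_all add: ra_def rb_def remainder_formula[OF m \<omega>] inner_lincomb)

lemma dbeta_measurable: "d\<beta> m i \<in> borel_measurable (F (tm (Suc m)))"
  unfolding d\<beta>_def[abs_def]
  by (intro borel_measurable_diff beta_adapted tm_nonneg noise.F_measurable_mono[OF beta_adapted[OF tm_nonneg] tm_nonneg tm_le_Suc])

lemma remainder_measurable:
  assumes m: "m < M" and i: "i < N"
  shows "ra m i \<in> borel_measurable P" "rb m i \<in> borel_measurable P"
proof -
  have b: "tm (Suc m) \<in> {0..T}" using m by (intro tm_in) simp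
  have "(\<lambda>\<omega>. drift_sin m i \<omega> + inner (fst (stochastic_convolution m \<omega>)) (\<phi> i) - wave_sin (lam i) \<tau> * d\<beta> m i \<omega>) \<in> borel_measurable P"
    "(\<lambda>\<omega>. drift_cos m i \<omega> - \<tau> * Fc i (tm (Suc m)) \<omega> + inner (snd (stochastic_convolution m \<omega>)) (\<phi> i) - wave_cos (lam i) \<tau> * d\<beta> m i \<omega>) \<in> borel_measurable P"
    by (intro borel_measurable_diff borel_measurable_add borel_measurable_times borel_measurable_const
        drift_measurable m coordinates_measurable stochastic_convolution Fc_measurable b
        noise.F_measurable_P[OF dbeta_measurable tm_nonneg])+
  then show "ra m i \<in> borel_measurable P" "rb m i \<in> borel_measurable P"
    using remainder_coordinates[OF m _ i] by (simp_all cong: measurable_cong)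
qed

text \<open>With the pathwise value inserted, the drift integrals in the remainder cancel and the
  one-step identity for the exact solution is left.\<close>

lemma remainder_identity:
  assumes m: "m < M"
  shows "AE \<omega> in P. \<forall>i<N.
    u i (tm (Suc m)) \<omega> = wave_cos (lam i) \<tau> * u i (tm m) \<omega> + wave_sin (lam i) \<tau> * v i (tm m) \<omega>
      + wave_sin (lam i) \<tau> * d\<beta> m i \<omega> + ra m i \<omega> \<and>
    v i (tm (Suc m)) \<omega> = - lam i * wave_sin (lam i) \<tau> * u i (tm m) \<omega> + wave_cos (lam i) \<tau> * v i (tm m) \<omega>
      + \<tau> * Fc i (tm (Suc m)) \<omega> + wave_cos (lam i) \<tau> * d\<beta> m i \<omega> + rb m i \<omega>"
  using stochastic_convolution(1)[OF m] AE_space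
proof eventually_elim
  case (elim \<omega>)
  have "u i (tm (Suc m)) \<omega> = wave_cos (lam i) \<tau> * u i (tm m) \<omega> + wave_sin (lam i) \<tau> * v i (tm m) \<omega>
      + wave_sin (lam i) \<tau> * d\<beta> m i \<omega> + ra m i \<omega> \<and>
    v i (tm (Suc m)) \<omega> = - lam i * wave_sin (lam i) \<tau> * u i (tm m) \<omega> + wave_cos (lam i) \<tau> * v i (tm m) \<omega>
      + \<tau> * Fc i (tm (Suc m)) \<omega> + wave_cos (lam i) \<tau> * d\<beta> m i \<omega> + rb m i \<omega>" if i: "i < N" for i
    unfolding remainder_coordinates[OF m elim(2) i] elim(1) using i by (simp add: pathwise_convolution_def inner_lincomb)
  then show ?case by blast
qed

section \<open>The numerical solution in spectral coordinates\<close>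

definition yu :: "nat \<Rightarrow> nat \<Rightarrow> 'w \<Rightarrow> real" where "yu m i \<omega> = inner (fst (Y m \<omega>)) (\<phi> i)"
definition yv :: "nat \<Rightarrow> nat \<Rightarrow> 'w \<Rightarrow> real" where "yv m i \<omega> = inner (snd (Y m \<omega>)) (\<phi> i)"

lemma scheme_0: "\<omega> \<in> space P \<Longrightarrow> Y 0 \<omega> = X 0 \<omega>"
  and scheme_in: "\<omega> \<in> space P \<Longrightarrow> m < M \<Longrightarrow> Y (Suc m) \<omega> \<in> U_N \<phi> N \<times> U_N \<phi> N"
  and scheme_step: "\<omega> \<in> space P \<Longrightarrow> m < M \<Longrightarrow> Y (Suc m) \<omega> = E_N lam \<phi> N \<tau> (Y m \<omega>) + \<tau> *\<^sub>R FF_N D f \<phi> N (Y (Suc m) \<omega>)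
             + noise_op N \<tau> (W (tm (Suc m)) \<omega> - W (tm m) \<omega>)"
  using scheme unfolding time_scheme_def tm_def noise_op_def by simp_all

lemma Y_in:
  assumes "\<omega> \<in> space P" "m \<le> M"
  shows "Y m \<omega> \<in> U_N \<phi> N \<times> U_N \<phi> N"
proof (cases m)
  case 0
  have "0 \<in> {0..T}" using T_pos by simp
  then show ?thesis using X_in[OF assms(1)] by (simp only: 0 scheme_0[OF assms(1)])
next
  case (Suc k)
  then show ?thesis using scheme_in[OF assms(1), of k] assms(2) by simp
qed

lemma Y_lincomb: "\<omega> \<in> space P \<Longrightarrow> m \<le> M \<Longrightarrow> Y m \<omega> = (lincomb N (\<lambda>i. yu m i \<omega>), lincomb N (\<lambda>i. yv m i \<omega>))"
  using pair_lincomb[OF Y_in] by (simp add: yu_def yv_def)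

lemma scheme_coordinates:
  assumes \<omega>: "\<omega> \<in> space P" and m: "m < M" and i: "i < N"
  shows "yu (Suc m) i \<omega> = wave_cos (lam i) \<tau> * yu m i \<omega> + wave_sin (lam i) \<tau> * yv m i \<omega> + wave_sin (lam i) \<tau> * d\<beta> m i \<omega>"
    "yv (Suc m) i \<omega> = (- lam i * wave_sin (lam i) \<tau> * yu m i \<omega> + wave_cos (lam i) \<tau> * yv m i \<omega> + wave_cos (lam i) \<tau> * d\<beta> m i \<omega>)
      + \<tau> * f_coeff N (\<lambda>j. yv (Suc m) j \<omega>) i"
proof -
  have E: "E_N lam \<phi> N \<tau> (Y m \<omega>) = (lincomb N (\<lambda>i. wave_cos (lam i) \<tau> * yu m i \<omega> + wave_sin (lam i) \<tau> * yv m i \<omega>),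
      lincomb N (\<lambda>i. - lam i * wave_sin (lam i) \<tau> * yu m i \<omega> + wave_cos (lam i) \<tau> * yv m i \<omega>))"
    unfolding Y_lincomb[OF \<omega> less_imp_le[OF m]] E_N_lincomb ..
  have FY: "FF_N D f \<phi> N (Y (Suc m) \<omega>) = (lincomb N (\<lambda>i. 0), lincomb N (f_coeff N (\<lambda>j. yv (Suc m) j \<omega>)))"
    unfolding Y_lincomb[OF \<omega> Suc_leI[OF m]] FF_N_lincomb ..
  have "Y (Suc m) \<omega> = (lincomb N (\<lambda>i. wave_cos (lam i) \<tau> * yu m i \<omega> + wave_sin (lam i) \<tau> * yv m i \<omega> + \<tau> * 0 + wave_sin (lam i) \<tau> * d\<beta> m i \<omega>),
     lincomb N (\<lambda>i. (- lam i * wave_sin (lam i) \<tau> * yu m i \<omega> + wave_cos (lam i) \<tau> * yv m i \<omega>) + \<tau> * f_coeff N (\<lambda>j. yv (Suc m) j \<omega>) i + wave_cos (lam i) \<tau> * d\<beta> m i \<omega>))"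
    using scheme_step[OF \<omega> m]
    unfolding E FY noise_op_lincomb scaleR_Pair lincomb_scaleR add_Pair lincomb_add d\<beta>_def \<beta>_def inner_diff_left .
  from arg_cong[OF this, of "\<lambda>x. inner (fst x) (\<phi> i)"] arg_cong[OF this, of "\<lambda>x. inner (snd x) (\<phi> i)"]
  show "yu (Suc m) i \<omega> = wave_cos (lam i) \<tau> * yu m i \<omega> + wave_sin (lam i) \<tau> * yv m i \<omega> + wave_sin (lam i) \<tau> * d\<beta> m i \<omega>"
    "yv (Suc m) i \<omega> = (- lam i * wave_sin (lam i) \<tau> * yu m i \<omega> + wave_cos (lam i) \<tau> * yv m i \<omega> + wave_cos (lam i) \<tau> * d\<beta> m i \<omega>)
      + \<tau> * f_coeff N (\<lambda>j. yv (Suc m) j \<omega>) i"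
    using i unfolding fst_conv snd_conv inner_lincomb yu_def[symmetric] yv_def[symmetric] by simp_all
qed

lemma F_measurable_cong:
  assumes "0 \<le> t" "\<And>\<omega>. \<omega> \<in> space P \<Longrightarrow> g \<omega> = h \<omega>"
  shows "g \<in> borel_measurable (F t) \<longleftrightarrow> h \<in> borel_measurable (F t)"
  using noise.F_subalgebra[OF assms(1)] assms(2) by (intro measurable_cong) (simp add: subalgebra_def)

text \<open>Induction over the steps. The new position coefficients are explicit in the old data and
  the increment; the velocity coefficients solve the implicit system, whose solution map is used
  over the space \<open>F (tm (Suc m))\<close>.\<close>

lemma Y_adapted:
  assumes "m \<le> M" "i < N"
  shows "yu m i \<in> borel_measurable (F (tm m))" "yv m i \<in> borel_measurable (F (tm m))"
proof -
  have "\<forall>i<N. yu m i \<in> borel_measurable (F (tm m)) \<and> yv m i \<in> borel_measurable (F (tm m))"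
    using assms(1)
  proof (induction m)
    case 0
    have t: "tm 0 = 0" by (simp add: tm_def)
    have 0: "0 \<in> {0..T}" using T_pos by simp
    have "yu 0 i \<in> borel_measurable (F 0) \<longleftrightarrow> u i 0 \<in> borel_measurable (F 0)"
      "yv 0 i \<in> borel_measurable (F 0) \<longleftrightarrow> v i 0 \<in> borel_measurable (F 0)" for i
      by (rule F_measurable_cong; simp add: yu_def yv_def u_def v_def scheme_0)+
    then show ?case using u_adapted[OF 0] v_adapted[OF 0] by (simp add: t)
  next
    case (Suc m)
    then have m: "m < M" by simp
    have IH: "yu m i \<in> borel_measurable (F (tm (Suc m)))" "yv m i \<in> borel_measurable (F (tm (Suc m)))" if "i < N" for i
      using Suc that by (auto intro: noise.F_measurable_mono[OF _ tm_nonneg tm_le_Suc])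
    have sp: "space (F (tm (Suc m))) = space P"
      using noise.F_subalgebra[OF tm_nonneg[of "Suc m"]] by (simp add: subalgebra_def)
    show ?case
    proof (intro allI impI conjI)
      fix i assume i: "i < N"
      have "(\<lambda>\<omega>. wave_cos (lam i) \<tau> * yu m i \<omega> + wave_sin (lam i) \<tau> * yv m i \<omega> + wave_sin (lam i) \<tau> * d\<beta> m i \<omega>)
          \<in> borel_measurable (F (tm (Suc m)))"
        by (intro borel_measurable_add borel_measurable_times borel_measurable_const IH i dbeta_measurable)
      then show "yu (Suc m) i \<in> borel_measurable (F (tm (Suc m)))"
        by (rule F_measurable_cong[OF tm_nonneg, THEN iffD1, rotated]) (simp add: scheme_coordinates(1)[OF _ m i])
      have "(\<lambda>\<omega>. yv (Suc m) i \<omega>) \<in> borel_measurable (F (tm (Suc m)))"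
      proof (rule implicit_measurable[where \<tau>=\<tau> and N=N and y="\<lambda>\<omega> j. yv (Suc m) j \<omega>" and
            z="\<lambda>\<omega> i. - lam i * wave_sin (lam i) \<tau> * yu m i \<omega> + wave_cos (lam i) \<tau> * yv m i \<omega> + wave_cos (lam i) \<tau> * d\<beta> m i \<omega>"])
        show "\<tau> \<ge> 0" "max 0 C1 * \<tau> \<le> 1 / 2" using tau_pos tau_C1 by simp_all
        show "yv (Suc m) i \<omega> = - lam i * wave_sin (lam i) \<tau> * yu m i \<omega> + wave_cos (lam i) \<tau> * yv m i \<omega> + wave_cos (lam i) \<tau> * d\<beta> m i \<omega>
            + \<tau> * f_coeff N (\<lambda>j. yv (Suc m) j \<omega>) i" if "\<omega> \<in> space (F (tm (Suc m)))" "i < N" for \<omega> i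
          using that by (intro scheme_coordinates(2) m) (simp_all add: sp)
        show "(\<lambda>\<omega>. - lam i * wave_sin (lam i) \<tau> * yu m i \<omega> + wave_cos (lam i) \<tau> * yv m i \<omega> + wave_cos (lam i) \<tau> * d\<beta> m i \<omega>)
            \<in> borel_measurable (F (tm (Suc m)))" if "i < N" for i
          by (intro borel_measurable_add borel_measurable_times borel_measurable_const IH that dbeta_measurable)
      qed (rule i)
      then show "yv (Suc m) i \<in> borel_measurable (F (tm (Suc m)))" .
    qed
  qed
  then show "yu m i \<in> borel_measurable (F (tm m))" "yv m i \<in> borel_measurable (F (tm m))"
    using assms(2) by simp_all
qed

end

lemma wave_step_energy:
  assumes "l \<ge> 0"
  shows "l * (wave_cos l t * a + wave_sin l t * b)\<^sup>2 + (- l * wave_sin l t * a + wave_cos l t * b)\<^sup>2 = l * a\<^sup>2 + b\<^sup>2"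
proof -
  have "l * (wave_cos l t * a + wave_sin l t * b)\<^sup>2 + (- l * wave_sin l t * a + wave_cos l t * b)\<^sup>2
      = ((wave_cos l t)\<^sup>2 + l * (wave_sin l t)\<^sup>2) * (l * a\<^sup>2 + b\<^sup>2)"
    by (simp add: power2_eq_square algebra_simps)
  then show ?thesis by (simp only: wave_energy[OF assms] mult_1_left)
qed

section \<open>Energy of the error and the final estimate\<close>

context galerkin_scheme
begin

definition eu :: "nat \<Rightarrow> nat \<Rightarrow> 'w \<Rightarrow> real" where "eu m i \<omega> = u i (tm m) \<omega> - yu m i \<omega>"
definition ev :: "nat \<Rightarrow> nat \<Rightarrow> 'w \<Rightarrow> real" where "ev m i \<omega> = v i (tm m) \<omega> - yv m i \<omega>"

definition ga :: "nat \<Rightarrow> nat \<Rightarrow> 'w \<Rightarrow> real" where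
  "ga m i \<omega> = wave_cos (lam i) \<tau> * eu m i \<omega> + wave_sin (lam i) \<tau> * ev m i \<omega>"

definition gb :: "nat \<Rightarrow> nat \<Rightarrow> 'w \<Rightarrow> real" where
  "gb m i \<omega> = - lam i * wave_sin (lam i) \<tau> * eu m i \<omega> + wave_cos (lam i) \<tau> * ev m i \<omega>"

definition energy :: "(nat \<Rightarrow> 'w \<Rightarrow> real) \<Rightarrow> (nat \<Rightarrow> 'w \<Rightarrow> real) \<Rightarrow> ennreal" where
  "energy x y = (\<integral>\<^sup>+\<omega>. ennreal (\<Sum>i<N. lam i * (x i \<omega>)\<^sup>2 + (y i \<omega>)\<^sup>2) \<partial>P)"

text \<open>The conditional expectation estimate is scalar, so the energy is split into modes with
  weights \<open>lam i\<close> and 1; the factor \<open>1 *\<close> matches the weighted form of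
  that estimate.\<close>

lemma energy_split:
  assumes "\<And>i. i < N \<Longrightarrow> x i \<in> borel_measurable P" "\<And>i. i < N \<Longrightarrow> y i \<in> borel_measurable P"
  shows "energy x y = (\<Sum>i<N. (\<integral>\<^sup>+\<omega>. ennreal (lam i * (x i \<omega>)\<^sup>2) \<partial>P) + (\<integral>\<^sup>+\<omega>. ennreal (1 * (y i \<omega>)\<^sup>2) \<partial>P))"
proof -
  have m: "(\<lambda>\<omega>. ennreal (c * (x i \<omega>)\<^sup>2)) \<in> borel_measurable P" "(\<lambda>\<omega>. ennreal (c * (y i \<omega>)\<^sup>2)) \<in> borel_measurable P" if "i < N" for i c
    by (intro measurable_compose[OF _ measurable_ennreal] borel_measurable_times borel_measurable_const borel_measurable_power assms that)+
  have "energy x y = (\<integral>\<^sup>+\<omega>. (\<Sum>i<N. ennreal (lam i * (x i \<omega>)\<^sup>2) + ennreal (1 * (y i \<omega>)\<^sup>2)) \<partial>P)"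
    unfolding energy_def using lam_nonneg by (intro nn_integral_cong) (simp flip: ennreal_plus)
  also have "\<dots> = (\<Sum>i<N. \<integral>\<^sup>+\<omega>. ennreal (lam i * (x i \<omega>)\<^sup>2) + ennreal (1 * (y i \<omega>)\<^sup>2) \<partial>P)"
    by (intro nn_integral_sum borel_measurable_add m) simp_all
  also have "\<dots> = (\<Sum>i<N. (\<integral>\<^sup>+\<omega>. ennreal (lam i * (x i \<omega>)\<^sup>2) \<partial>P) + (\<integral>\<^sup>+\<omega>. ennreal (1 * (y i \<omega>)\<^sup>2) \<partial>P))"
    by (intro sum.cong refl nn_integral_add m) simp_all
  finally show ?thesis .
qed

lemma mean_sq_error:
  assumes "m \<le> M"
  shows "mean_sq_H1 P lam \<phi> (\<lambda>\<omega>. X (tm m) \<omega> - Y m \<omega>) = energy (eu m) (ev m)"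
  unfolding mean_sq_H1_def energy_def
proof (intro nn_integral_cong arg_cong[of _ _ ennreal])
  fix \<omega> assume \<omega>: "\<omega> \<in> space P"
  have "X (tm m) \<omega> - Y m \<omega> \<in> U_N \<phi> N \<times> U_N \<phi> N"
    by (rule subspace_diff[OF subspace_pair X_in[OF \<omega> tm_in[OF assms]] Y_in[OF \<omega> assms]])
  from norm_H1_pair[OF this]
  show "(norm_H1 lam \<phi> (X (tm m) \<omega> - Y m \<omega>))\<^sup>2 = (\<Sum>i<N. lam i * (eu m i \<omega>)\<^sup>2 + (ev m i \<omega>)\<^sup>2)"
    by (simp add: eu_def ev_def u_def v_def yu_def yv_def inner_diff_left)
qed

lemma mean_sq_remainder:
  assumes "m < M"
  shows "mean_sq_H1 P lam \<phi> (R m) = energy (ra m) (rb m)"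
  unfolding mean_sq_H1_def energy_def ra_def rb_def
  by (intro nn_integral_cong arg_cong[of _ _ ennreal] norm_H1_pair R_in assms)

lemma mean_sq_cond_remainder:
  "mean_sq_H1 P lam \<phi> (cond_exp_N P (F t) \<phi> N (R m))
    = energy (\<lambda>i. real_cond_exp P (F t) (ra m i)) (\<lambda>i. real_cond_exp P (F t) (rb m i))"
proof -
  have "cond_exp_N P (F t) \<phi> N (R m) \<omega>
      = (lincomb N (\<lambda>i. real_cond_exp P (F t) (ra m i) \<omega>), lincomb N (\<lambda>i. real_cond_exp P (F t) (rb m i) \<omega>))" for \<omega>
    unfolding cond_exp_N_def lincomb_def ra_def[abs_def] rb_def[abs_def] ..
  then show ?thesis by (simp add: mean_sq_H1_def energy_def norm_H1_lincomb)
qed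

lemma error_adapted:
  assumes "m \<le> M" "i < N"
  shows "eu m i \<in> borel_measurable (F (tm m))" "ev m i \<in> borel_measurable (F (tm m))"
    "ga m i \<in> borel_measurable (F (tm m))" "gb m i \<in> borel_measurable (F (tm m))"
proof -
  show e: "eu m i \<in> borel_measurable (F (tm m))" "ev m i \<in> borel_measurable (F (tm m))"
    unfolding eu_def[abs_def] ev_def[abs_def]
    by (intro borel_measurable_diff u_adapted v_adapted tm_in Y_adapted assms)+
  show "ga m i \<in> borel_measurable (F (tm m))" "gb m i \<in> borel_measurable (F (tm m))"
    unfolding ga_def[abs_def] gb_def[abs_def]
    by (intro borel_measurable_add borel_measurable_times borel_measurable_const e)+
qed

text \<open>Exact identity and scheme contain the same noise term, which cancels in the difference.
  What remains is the propagated error, the remainder and a difference of nonlinear terms at the new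
  time level.\<close>

lemma error_energy_pathwise:
  assumes m: "m < M"
  shows "AE \<omega> in P. (\<Sum>i<N. lam i * (eu (Suc m) i \<omega>)\<^sup>2 + (ev (Suc m) i \<omega>)\<^sup>2)
    \<le> (1 + 3 * (max 0 C1 * \<tau>)) * (\<Sum>i<N. lam i * (ga m i \<omega> + ra m i \<omega>)\<^sup>2 + (gb m i \<omega> + rb m i \<omega>)\<^sup>2)"
  using remainder_identity[OF m] AE_space
proof eventually_elim
  case (elim \<omega>)
  show ?case
  proof (rule energy_step[where d="\<lambda>i. Fc i (tm (Suc m)) \<omega> - f_coeff N (\<lambda>j. yv (Suc m) j \<omega>) i"])
    show "max 0 C1 * \<tau> \<le> 1 / 6" by (rule tau_C1)
    fix i assume i: "i < N"
    note s = scheme_coordinates[OF elim(2) m i] and r = elim(1)[rule_format, OF i]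
    show "eu (Suc m) i \<omega> = ga m i \<omega> + ra m i \<omega>"
      using s(1) r unfolding eu_def ev_def ga_def by (simp add: algebra_simps)
    show "ev (Suc m) i \<omega> = gb m i \<omega> + rb m i \<omega> + \<tau> * (Fc i (tm (Suc m)) \<omega> - f_coeff N (\<lambda>j. yv (Suc m) j \<omega>) i)"
      using s(2) r unfolding eu_def ev_def gb_def by (simp add: algebra_simps)
  next
    show "(\<Sum>i<N. (Fc i (tm (Suc m)) \<omega> - f_coeff N (\<lambda>j. yv (Suc m) j \<omega>) i) * ev (Suc m) i \<omega>) \<le> max 0 C1 * (\<Sum>i<N. (ev (Suc m) i \<omega>)\<^sup>2)"
      unfolding Fc_def ev_def by (rule f_coeff_one_sided_lipschitz)
  qed (use tau_pos lam_nonneg in simp_all)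
qed

lemma propagated_energy: "energy (ga m) (gb m) = energy (eu m) (ev m)"
  unfolding energy_def ga_def gb_def by (simp only: wave_step_energy[OF lam_nonneg])

lemma error_recursion:
  assumes m: "m < M"
  shows "energy (eu (Suc m)) (ev (Suc m)) \<le> ennreal (exp ((3 * max 0 C1 + 1) * \<tau>)) * energy (eu m) (ev m)
    + ennreal (3 / 2) * (mean_sq_H1 P lam \<phi> (R m)
      + ennreal (1 / \<tau>) * mean_sq_H1 P lam \<phi> (cond_exp_N P (F (tm m)) \<phi> N (R m)))"
proof -
  define x where "x = 1 + 3 * (max 0 C1 * \<tau>)"
  have K: "max 0 C1 * \<tau> \<ge> 0" using tau_pos by simp
  \<comment> \<open>The upper bound is \<open>1 + 3 * (1 / 6)\<close>.\<close>
  have x: "1 \<le> x" "x \<le> 3 / 2" using K tau_C1 by (simp_all add: x_def)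
  have mM: "m \<le> M" using m by simp
  note meas = error_adapted[OF mM]
  have g: "ga m i \<in> borel_measurable P" "gb m i \<in> borel_measurable P" if "i < N" for i
    using noise.F_measurable_P[OF meas(3)[OF that] tm_nonneg] noise.F_measurable_P[OF meas(4)[OF that] tm_nonneg] by simp_all
  note r = remainder_measurable[OF m]
  let ?c = "\<lambda>h i. real_cond_exp P (F (tm m)) (h m i)"
  have c: "?c h i \<in> borel_measurable P" for h i by simp
  have sub: "subalgebra P (F (tm m))" by (rule noise.F_subalgebra[OF tm_nonneg])
  have split: "energy (\<lambda>i \<omega>. ga m i \<omega> + ra m i \<omega>) (\<lambda>i \<omega>. gb m i \<omega> + rb m i \<omega>)
      \<le> ennreal (1 + \<tau>) * energy (ga m) (gb m) + energy (ra m) (rb m) + ennreal (1 / \<tau>) * energy (?c ra) (?c rb)"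
  proof -
    have "energy (\<lambda>i \<omega>. ga m i \<omega> + ra m i \<omega>) (\<lambda>i \<omega>. gb m i \<omega> + rb m i \<omega>)
        = (\<Sum>i<N. (\<integral>\<^sup>+\<omega>. ennreal (lam i * (ga m i \<omega> + ra m i \<omega>)\<^sup>2) \<partial>P) + (\<integral>\<^sup>+\<omega>. ennreal (1 * (gb m i \<omega> + rb m i \<omega>)\<^sup>2) \<partial>P))"
      by (intro energy_split borel_measurable_add g r)
    also have "\<dots> \<le> (\<Sum>i<N.
        (ennreal (1 + \<tau>) * (\<integral>\<^sup>+\<omega>. ennreal (lam i * (ga m i \<omega>)\<^sup>2) \<partial>P) + (\<integral>\<^sup>+\<omega>. ennreal (lam i * (ra m i \<omega>)\<^sup>2) \<partial>P)
          + ennreal (1 / \<tau>) * (\<integral>\<^sup>+\<omega>. ennreal (lam i * (?c ra i \<omega>)\<^sup>2) \<partial>P))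
      + (ennreal (1 + \<tau>) * (\<integral>\<^sup>+\<omega>. ennreal (1 * (gb m i \<omega>)\<^sup>2) \<partial>P) + (\<integral>\<^sup>+\<omega>. ennreal (1 * (rb m i \<omega>)\<^sup>2) \<partial>P)
          + ennreal (1 / \<tau>) * (\<integral>\<^sup>+\<omega>. ennreal (1 * (?c rb i \<omega>)\<^sup>2) \<partial>P)))"
      by (intro sum_mono add_mono noise.second_moment_split sub meas r lam_nonneg tau_pos) simp_all
    also have "\<dots> = ennreal (1 + \<tau>) * energy (ga m) (gb m) + energy (ra m) (rb m) + ennreal (1 / \<tau>) * energy (?c ra) (?c rb)"
    proof -
      have "energy (ga m) (gb m) = (\<Sum>i<N. (\<integral>\<^sup>+\<omega>. ennreal (lam i * (ga m i \<omega>)\<^sup>2) \<partial>P) + (\<integral>\<^sup>+\<omega>. ennreal (1 * (gb m i \<omega>)\<^sup>2) \<partial>P))"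
        "energy (ra m) (rb m) = (\<Sum>i<N. (\<integral>\<^sup>+\<omega>. ennreal (lam i * (ra m i \<omega>)\<^sup>2) \<partial>P) + (\<integral>\<^sup>+\<omega>. ennreal (1 * (rb m i \<omega>)\<^sup>2) \<partial>P))"
        "energy (?c ra) (?c rb) = (\<Sum>i<N. (\<integral>\<^sup>+\<omega>. ennreal (lam i * (?c ra i \<omega>)\<^sup>2) \<partial>P) + (\<integral>\<^sup>+\<omega>. ennreal (1 * (?c rb i \<omega>)\<^sup>2) \<partial>P))"
        by (rule energy_split; rule g r c; assumption?)+
      then show ?thesis
        by (simp only: sum.distrib sum_distrib_left distrib_left add_ac)
    qed
    finally show ?thesis .
  qed
  have "energy (eu (Suc m)) (ev (Suc m)) \<le> (\<integral>\<^sup>+\<omega>. ennreal x * ennreal (\<Sum>i<N. lam i * (ga m i \<omega> + ra m i \<omega>)\<^sup>2 + (gb m i \<omega> + rb m i \<omega>)\<^sup>2) \<partial>P)"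
    unfolding energy_def
  proof (rule nn_integral_mono_AE)
    show "AE \<omega> in P. ennreal (\<Sum>i<N. lam i * (eu (Suc m) i \<omega>)\<^sup>2 + (ev (Suc m) i \<omega>)\<^sup>2)
        \<le> ennreal x * ennreal (\<Sum>i<N. lam i * (ga m i \<omega> + ra m i \<omega>)\<^sup>2 + (gb m i \<omega> + rb m i \<omega>)\<^sup>2)"
      using error_energy_pathwise[OF m]
    proof eventually_elim
      case (elim \<omega>)
      then show ?case using x(1) by (simp only: x_def[symmetric] ennreal_leI ennreal_mult'[symmetric])
    qed
  qed
  also have "\<dots> = ennreal x * energy (\<lambda>i \<omega>. ga m i \<omega> + ra m i \<omega>) (\<lambda>i \<omega>. gb m i \<omega> + rb m i \<omega>)"
    unfolding energy_def
    by (intro nn_integral_cmult measurable_compose[OF _ measurable_ennreal] borel_measurable_sum borel_measurable_add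
        borel_measurable_times borel_measurable_const borel_measurable_power g r) simp_all
  also have "\<dots> \<le> ennreal x * (ennreal (1 + \<tau>) * energy (eu m) (ev m) + (energy (ra m) (rb m) + ennreal (1 / \<tau>) * energy (?c ra) (?c rb)))"
    using split by (intro mult_left_mono) (simp_all add: propagated_energy add.assoc)
  also have "\<dots> = ennreal (x * (1 + \<tau>)) * energy (eu m) (ev m) + ennreal x * (energy (ra m) (rb m) + ennreal (1 / \<tau>) * energy (?c ra) (?c rb))"
  proof -
    have "ennreal (x * (1 + \<tau>)) = ennreal x * ennreal (1 + \<tau>)"
      using x(1) tau_pos by (intro ennreal_mult) simp_all
    then show ?thesis by (simp only: distrib_left mult.assoc)
  qed
  also have "\<dots> \<le> ennreal (exp ((3 * max 0 C1 + 1) * \<tau>)) * energy (eu m) (ev m)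
      + ennreal (3 / 2) * (energy (ra m) (rb m) + ennreal (1 / \<tau>) * energy (?c ra) (?c rb))"
  proof (intro add_mono mult_right_mono ennreal_leI)
    \<comment> \<open>\<open>1 + y \<le> exp y\<close>, once for the implicit step and once for the
      mixed term.\<close>
    have "x * (1 + \<tau>) \<le> exp (3 * (max 0 C1 * \<tau>)) * exp \<tau>"
      unfolding x_def using K tau_pos by (intro mult_mono exp_ge_add_one_self) simp_all
    also have "\<dots> = exp ((3 * max 0 C1 + 1) * \<tau>)"
      by (simp add: exp_add[symmetric] distrib_right mult.assoc)
    finally show "x * (1 + \<tau>) \<le> exp ((3 * max 0 C1 + 1) * \<tau>)" .
  qed (use x in simp_all)
  finally show ?thesis unfolding mean_sq_remainder[OF m] mean_sq_cond_remainder .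
qed

lemma error_bound:
  assumes m: "m < M"
  shows "mean_sq_H1 P lam \<phi> (\<lambda>\<omega>. X (tm (Suc m)) \<omega> - Y (Suc m) \<omega>)
    \<le> ennreal (3 / 2 * exp ((3 * max 0 C1 + 1) * T)) * ((\<Sum>i=1..m+1. mean_sq_H1 P lam \<phi> (R (i - 1)))
      + ennreal (1 / \<tau>) * (\<Sum>i=0..m. mean_sq_H1 P lam \<phi> (cond_exp_N P (F (tm i)) \<phi> N (R i))))"
proof -
  define q where "q = exp ((3 * max 0 C1 + 1) * \<tau>)"
  have q: "q \<ge> 1" unfolding q_def using tau_pos by simp
  let ?\<rho> = "\<lambda>i. mean_sq_H1 P lam \<phi> (R i)" and ?\<kappa> = "\<lambda>i. mean_sq_H1 P lam \<phi> (cond_exp_N P (F (tm i)) \<phi> N (R i))"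
  have "energy (eu 0) (ev 0) = (\<integral>\<^sup>+\<omega>. 0 \<partial>P)"
    unfolding energy_def
    by (intro nn_integral_cong) (simp add: eu_def ev_def u_def v_def yu_def yv_def tm_def scheme_0)
  then have 0: "energy (eu 0) (ev 0) = 0" by simp
  have "energy (eu (Suc m)) (ev (Suc m)) \<le> ennreal (q ^ Suc m) * (\<Sum>i<Suc m. ennreal (3 / 2) * (?\<rho> i + ennreal (1 / \<tau>) * ?\<kappa> i))"
    unfolding q_def
    by (rule discrete_gronwall_ennreal[where M=M, of "\<lambda>m. energy (eu m) (ev m)", OF 0 error_recursion]) (use m q in \<open>simp_all add: q_def\<close>)
  also have "\<dots> = ennreal (q ^ Suc m) * ennreal (3 / 2) * ((\<Sum>i<Suc m. ?\<rho> i) + ennreal (1 / \<tau>) * (\<Sum>i<Suc m. ?\<kappa> i))"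
    by (simp only: sum.distrib sum_distrib_left[symmetric] mult.assoc)
  also have "\<dots> \<le> ennreal (3 / 2 * exp ((3 * max 0 C1 + 1) * T)) * ((\<Sum>i<Suc m. ?\<rho> i) + ennreal (1 / \<tau>) * (\<Sum>i<Suc m. ?\<kappa> i))"
  proof (rule mult_right_mono)
    \<comment> \<open>The accumulated growth depends only on the elapsed time, which never exceeds
      \<open>T\<close>; this removes \<open>m\<close> and \<open>M\<close> from the
      constant.\<close>
    have "q ^ Suc m = exp ((3 * max 0 C1 + 1) * tm (Suc m))"
      unfolding q_def tm_def exp_of_nat_mult[symmetric] by (simp add: mult_ac)
    also have "\<dots> \<le> exp ((3 * max 0 C1 + 1) * T)"
      using tm_le_T[of "Suc m"] m by (simp add: mult_left_mono)
    finally have le: "3 / 2 * q ^ Suc m \<le> 3 / 2 * exp ((3 * max 0 C1 + 1) * T)" by (rule mult_left_mono) simp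
    have "ennreal (q ^ Suc m) * ennreal (3 / 2) = ennreal (q ^ Suc m * (3 / 2))"
      using q by (intro ennreal_mult[symmetric]) simp_all
    also have "\<dots> = ennreal (3 / 2 * q ^ Suc m)" by (simp only: mult.commute)
    also have "\<dots> \<le> ennreal (3 / 2 * exp ((3 * max 0 C1 + 1) * T))" by (rule ennreal_leI[OF le])
    finally show "ennreal (q ^ Suc m) * ennreal (3 / 2) \<le> ennreal (3 / 2 * exp ((3 * max 0 C1 + 1) * T))" .
  qed simp
  \<comment> \<open>\<open>R i\<close> is the remainder with index \<open>i + 1\<close>, hence the
    shift.\<close>
  also have "(\<Sum>i<Suc m. ?\<rho> i) = (\<Sum>i=1..m+1. ?\<rho> (i - 1))"
    by (rule sum.reindex_bij_witness[of _ "\<lambda>i. i - 1" Suc]) auto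
  also have "(\<Sum>i<Suc m. ?\<kappa> i) = (\<Sum>i=0..m. ?\<kappa> i)"
    by (intro sum.cong) auto
  finally show ?thesis using m by (simp only: mean_sq_error[OF Suc_leI[OF m]])
qed

end

theorem proposition2:
  fixes D :: "'a::euclidean_space set"
    and lam :: "nat \<Rightarrow> real" and \<phi> :: "nat \<Rightarrow> 'a L2"
    and f :: "real \<Rightarrow> real" and C0 C1 C2 C3 \<gamma> T :: real
    and P :: "'w measure" and F :: "real \<Rightarrow> 'w measure"
    and Q Qh :: "'a L2 \<Rightarrow> 'a L2" and W :: "real \<Rightarrow> 'w \<Rightarrow> 'a L2"
    and X0 :: "'w \<Rightarrow> 'a L2 \<times> 'a L2"
  assumes "DIM('a) = 1 \<or> DIM('a) = 2"
    and "smooth_bounded_domain D"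
    and "dirichlet_eigenpairs D lam \<phi>"
    and "nonlinearity_A1 f C0 C1 C2 C3 \<gamma>"
    and "filtered_prob_space P F"
    and "covariance_A2 D lam \<phi> Q Qh"
    and "Q_wiener_process P F (L2_on D) Q W"
    and "X0 \<in> borel_measurable (F 0)"
    and "\<forall>\<omega>\<in>space P. X0 \<omega> \<in> L2_on D \<times> L2_on D"
    and "T > 0"
  shows "\<exists>C>0. \<forall>(N::nat) (M::nat) X Y.
      N \<ge> 1 \<longrightarrow> M \<ge> 1 \<longrightarrow>
      (C1 > 0 \<longrightarrow> T / real M \<le> 1 / (6 * max 0 C1)) \<longrightarrow>
      galerkin_solution D lam \<phi> f P F W X0 T N X \<longrightarrow>
      time_scheme D lam \<phi> f P W N X (T / real M) M Y \<longrightarrow>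
      (let \<tau> = T / real M; R = local_remainder D lam \<phi> f P Qh W N X \<tau> in
        \<forall>m<M. mean_sq_H1 P lam \<phi> (\<lambda>\<omega>. X (real (Suc m) * \<tau>) \<omega> - Y (Suc m) \<omega>)
          \<le> ennreal C * ((\<Sum>i=1..m+1. mean_sq_H1 P lam \<phi> (R (i - 1)))
             + ennreal (1 / \<tau>) *
               (\<Sum>i=0..m. mean_sq_H1 P lam \<phi> (cond_exp_N P (F (real i * \<tau>)) \<phi> N (R i)))))"
proof (intro exI[of _ "3 / 2 * exp ((3 * max 0 C1 + 1) * T)"] conjI allI impI)
  \<comment> \<open>The witness was fixed beforehand and involves \<open>C1\<close> and
    \<open>T\<close> only, so it serves all \<open>N\<close>, \<open>M\<close> and \<open>m\<close>
    at once.\<close>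
  fix N M :: nat and X Y
  assume M: "M \<ge> 1" and step: "C1 > 0 \<longrightarrow> T / real M \<le> 1 / (6 * max 0 C1)"
    and X: "galerkin_solution D lam \<phi> f P F W X0 T N X"
    and Y: "time_scheme D lam \<phi> f P W N X (T / real M) M Y"
  interpret galerkin_scheme D lam \<phi> f C0 C1 C2 C3 \<gamma> P F Q Qh W X0 T N M X Y "T / real M"
    by unfold_locales (fact assms(1-7,10) M step X Y refl)+
  show "let \<tau> = T / real M; R = local_remainder D lam \<phi> f P Qh W N X \<tau> in
        \<forall>m<M. mean_sq_H1 P lam \<phi> (\<lambda>\<omega>. X (real (Suc m) * \<tau>) \<omega> - Y (Suc m) \<omega>)
          \<le> ennreal (3 / 2 * exp ((3 * max 0 C1 + 1) * T)) * ((\<Sum>i=1..m+1. mean_sq_H1 P lam \<phi> (R (i - 1)))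
             + ennreal (1 / \<tau>) *
               (\<Sum>i=0..m. mean_sq_H1 P lam \<phi> (cond_exp_N P (F (real i * \<tau>)) \<phi> N (R i))))"
    unfolding Let_def R_def[symmetric] tm_def[symmetric] using error_bound by blast
qed simp

end
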